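(* Let $k\in\mathbb Z$, $N\in\mathbb N$, and let $f\in HC_k(N)$. Then for each $s\in\mathbb R$ and each $w\in\mathbb H_0^+=\{w\in\mathbb C:\operatorname{Im}(w)>0,\ \operatorname{Re}(w)\ge0\}$ we have $$L_f(\varphi_s^w)=i^{-s}\int_{i}^{i+1}\left(f(z)\,e^{iwz}\,\zeta\left(1-s,\frac{w}{2\pi},z\right)+\int_1^\infty e^{itzw}\,t^{s-k}\,R_t(z,w)\,dt\right)dz,$$ where the path of integration of the outer integral is $\{i+t:\ t\in[0,1]\}$.
   Context: A harmonic Maass form of weight $k$ for $\Gamma_0(N)$ is a smooth $f:\mathbb H\to\mathbb C$ on the upper half-plane such that: (i) $(cz+d)^{-k}f(\gamma z)=f(z)$ for all $\gamma=\begin{pmatrix}a&b\\c&d\end{pmatrix}\in\Gamma_0(N)$; (ii) $\Delta_kf=0$, where $\Delta_k=-4y^2\frac{\partial}{\partial z}\frac{\partial}{\partial\bar z}+2iky\frac{\partial}{\partial\bar z}$, $z=x+iy$; (iii) for each $\gamma=\begin{pmatrix}*&*\\c&d\end{pmatrix}\in SL_2(\mathbb Z)$ there is a polynomial $P(z)\in\mathbb C[q^{-1}]$, $q=e^{2\pi i z}$, with $f(\gamma z)(cz+d)^{-k}-P(z)=O(e^{-\varepsilon y})$ as $y\to\infty$ for some $\varepsilon>0$. $HC_k(N)$ is the space of those forms with vanishing constant terms at all cusps (harmonic Maass cusp forms). Such $f$ has an expansion $$f(z)=\sum_{n\ge-n_0,\ n\ne0}a_f(n)e^{2\pi inz}+\sum_{n<0}b_f(n)\Gamma(1-k,-4\pi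 ny)e^{2\pi inz},$$ with $n_0\in\mathbb N$ and $\Gamma(r,z)=\int_z^\infty e^{-t}t^{r-1}dt$ the incomplete Gamma function. Set $\varphi_s^w(t)=\mathbf 1_{[1,\infty)}(t)e^{-wt}t^{s-1}$ for $t>0$. For $\operatorname{Re}(w)$ large, $L_f(\varphi_s^w)=\int_0^\infty f(iy)\varphi_s^w(y)\,dy$; for general $w\in\mathbb H_0^+$ it is understood by analytic continuation (and continuous extension) in $w$, namely $$L_f(\varphi_s^w)=\sum_{n\ge-n_0,\ n\ne0}a_f(n)E_{1-s}(2\pi n+w)+\sum_{n<0}b_f(n)\int_1^\infty\Gamma(1-k,-4\pi nt)e^{-(2\pi n+w)t}t^{s-1}dt,$$ where $E_s(z)=\int_1^\infty e^{-zt}t^{-s}dt$ for $\operatorname{Re}(z)>0$, continued analytically in $z$ to $\mathbb C\setminus(-\infty,0]$. $\zeta(s,a,z)=\sum_{m=0}^\infty e^{2\pi ima}(z+m)^{-s}$ is the Lerch zeta function. Set $f^c(z):=\overline{f(-\bar z)}$ and $(\xi_kf)(z):=2iy^k\,\overline{\frac{\partial f}{\partial\bar z}}$, so that $(\xi_kf^c)(z)=-\sum_{n<0}(-4\pi n)^{1-k}b_f(n)e^{-2\pi inz}$, and $$R_t(z,w):=\sum_{m=0}^\infty\frac{(\xi_kf^c)(t(2i-z-m))}{(z+m)^{1-s}}\,e^{itmw}.$$ All powers use the principal branch of the logarithm. *)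

theory Defs
  imports "HOL-Complex_Analysis.Complex_Analysis" "HOL-Library.Landau_Symbols"
begin

section \<open>Real-analytic calculus on open subsets of the complex plane\<close>

definition dx :: "(complex \<Rightarrow> complex) \<Rightarrow> complex \<Rightarrow> complex" where
  "dx f z = frechet_derivative f (at z) 1"

definition dy :: "(complex \<Rightarrow> complex) \<Rightarrow> complex \<Rightarrow> complex" where
  "dy f z = frechet_derivative f (at z) \<i>"

definition d_z :: "(complex \<Rightarrow> complex) \<Rightarrow> complex \<Rightarrow> complex" where
  "d_z f z = (dx f z - \<i> * dy f z) / 2"

definition d_zbar :: "(complex \<Rightarrow> complex) \<Rightarrow> complex \<Rightarrow> complex" where
  "d_zbar f z = (dx f z + \<i> * dy f z) / 2"

text \<open>\<open>differentiable\<close> is real (Frechet) differentiability, so for open \<open>S\<close> the predicate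
  \<open>Ck_on n S f\<close> says that \<open>f\<close> is of class \<open>C\<^sup>n\<close> on \<open>S\<close> as a function of two real variables.\<close>

primrec Ck_on :: "nat \<Rightarrow> complex set \<Rightarrow> (complex \<Rightarrow> complex) \<Rightarrow> bool" where
  "Ck_on 0 S f \<longleftrightarrow> continuous_on S f"
| "Ck_on (Suc n) S f \<longleftrightarrow>
     (\<forall>z\<in>S. f differentiable (at z)) \<and> Ck_on n S (dx f) \<and> Ck_on n S (dy f)"

definition smooth_on :: "complex set \<Rightarrow> (complex \<Rightarrow> complex) \<Rightarrow> bool" where
  "smooth_on S f \<longleftrightarrow> (\<forall>n. Ck_on n S f)"


section \<open>Harmonic Maass forms\<close>

definition upper_half_plane :: "complex set" where
  "upper_half_plane = {z. Im z > 0}"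

text \<open>The matrix with rows \<open>(a, b)\<close> and \<open>(c, d)\<close> is represented by \<open>(a, b, c, d)\<close>.\<close>

definition SL2Z :: "(int \<times> int \<times> int \<times> int) set" where
  "SL2Z = {(a, b, c, d). a * d - b * c = 1}"

definition Gamma0 :: "nat \<Rightarrow> (int \<times> int \<times> int \<times> int) set" where
  "Gamma0 N = {(a, b, c, d). (a, b, c, d) \<in> SL2Z \<and> int N dvd c}"

definition slash ::
  "int \<Rightarrow> (complex \<Rightarrow> complex) \<Rightarrow> int \<times> int \<times> int \<times> int \<Rightarrow> complex \<Rightarrow> complex" where
  "slash k f = (\<lambda>(a, b, c, d) z.
     (of_int c * z + of_int d) powi (- k)
     * f ((of_int a * z + of_int b) / (of_int c * z + of_int d)))"

definition Delta :: "int \<Rightarrow> (complex \<Rightarrow> complex) \<Rightarrow> complex \<Rightarrow> complex" where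
  "Delta k f z = - 4 * of_real (Im z) ^ 2 * d_z (d_zbar f) z
                 + 2 * \<i> * of_int k * of_real (Im z) * d_zbar f z"

text \<open>\<open>P\<close> is a polynomial in \<open>q\<^sup>-\<^sup>1 = exp (- 2 \<pi> \<i> z)\<close>.  The filter expresses that the
  estimate holds as \<open>Im z\<close> tends to infinity, uniformly in \<open>Re z\<close>.\<close>

definition principal_part ::
  "int \<Rightarrow> (complex \<Rightarrow> complex) \<Rightarrow> int \<times> int \<times> int \<times> int \<Rightarrow> complex poly \<Rightarrow> bool" where
  "principal_part k f \<gamma> P \<longleftrightarrow>
     (\<exists>\<epsilon>>0. (\<lambda>z. slash k f \<gamma> z - poly P (exp (- (2 * of_real pi * \<i> * z))))
        \<in> O[filtercomap Im at_top](\<lambda>z. of_real (exp (- \<epsilon> * Im z))))"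

definition harmonic_maass_form :: "int \<Rightarrow> nat \<Rightarrow> (complex \<Rightarrow> complex) \<Rightarrow> bool" where
  "harmonic_maass_form k N f \<longleftrightarrow>
     smooth_on upper_half_plane f \<and>
     (\<forall>\<gamma>\<in>Gamma0 N. \<forall>z\<in>upper_half_plane. slash k f \<gamma> z = f z) \<and>
     (\<forall>z\<in>upper_half_plane. Delta k f z = 0) \<and>
     (\<forall>\<gamma>\<in>SL2Z. \<exists>P. principal_part k f \<gamma> P)"

definition HC :: "int \<Rightarrow> nat \<Rightarrow> (complex \<Rightarrow> complex) set" where
  "HC k N = {f. harmonic_maass_form k N f \<and>
                (\<forall>\<gamma>\<in>SL2Z. \<forall>P. principal_part k f \<gamma> P \<longrightarrow> coeff P 0 = 0)}"


section \<open>The Fourier expansion\<close>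

text \<open>Only positive arguments \<open>x\<close> occur below.\<close>

definition inc_Gamma :: "real \<Rightarrow> real \<Rightarrow> real" where
  "inc_Gamma r x = integral {x..} (\<lambda>t. exp (- t) * t powr (r - 1))"

definition maass_expansion ::
  "int \<Rightarrow> (complex \<Rightarrow> complex) \<Rightarrow> nat \<Rightarrow> (int \<Rightarrow> complex) \<Rightarrow> (int \<Rightarrow> complex) \<Rightarrow> bool" where
  "maass_expansion k f n0 a b \<longleftrightarrow>
     (\<forall>z\<in>upper_half_plane. \<exists>A B.
        ((\<lambda>n. a n * exp (2 * of_real pi * \<i> * of_int n * z))
            has_sum A) {n. n \<ge> - int n0 \<and> n \<noteq> 0} \<and>
        ((\<lambda>n. b n * of_real (inc_Gamma (1 - of_int k) (- 4 * pi * of_int n * Im z))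
                  * exp (2 * of_real pi * \<i> * of_int n * z))
            has_sum B) {n. n < 0} \<and>
        f z = A + B)"


section \<open>The L-series at the test functions\<close>

text \<open>The analytic continuation to the slit plane of the integral over \<open>[1, \<infinity>)\<close> of
  \<open>exp (- z t) t\<^sup>-\<^sup>s\<close>, which converges for \<open>Re z > 0\<close>.  By the identity theorem it is unique on the
  slit plane; the values on the slit are unspecified.\<close>

definition exp_integral :: "complex \<Rightarrow> complex \<Rightarrow> complex" where
  "exp_integral s = (SOME g. g holomorphic_on (- \<real>\<^sub>\<le>\<^sub>0) \<and>
     (\<forall>z. Re z > 0 \<longrightarrow> g z = integral {1..} (\<lambda>t::real. exp (- z * of_real t) * of_real t powr (- s))))"

definition L_series ::
  "int \<Rightarrow> nat \<Rightarrow> (int \<Rightarrow> complex) \<Rightarrow> (int \<Rightarrow> complex) \<Rightarrow> real \<Rightarrow> complex \<Rightarrow> complex" where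
  "L_series k n0 a b s w =
     (\<Sum>\<^sub>\<infinity>n\<in>{n. n \<ge> - int n0 \<and> n \<noteq> 0}.
        a n * exp_integral (1 - of_real s) (2 * of_real pi * of_int n + w)) +
     (\<Sum>\<^sub>\<infinity>n\<in>{n. n < 0}.
        b n * integral {1..} (\<lambda>t::real.
          of_real (inc_Gamma (1 - of_int k) (- 4 * pi * of_int n * t))
          * exp (- (2 * of_real pi * of_int n + w) * of_real t) * of_real (t powr (s - 1))))"

text \<open>The value \<open>L\<^sub>f(\<phi>\<^sub>s\<^sup>w)\<close>, obtained from the coefficients of the expansion of \<open>f\<close>.  A form
  determines these coefficients, except for the choice of \<open>n0\<close> and the entries of \<open>a\<close> and \<open>b\<close>
  outside the two index sets; none of these affects the value.\<close>

definition L_phi :: "int \<Rightarrow> (complex \<Rightarrow> complex) \<Rightarrow> real \<Rightarrow> complex \<Rightarrow> complex" where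
  "L_phi k f s w =
     (case SOME (n0, a, b). maass_expansion k f n0 a b of (n0, a, b) \<Rightarrow> L_series k n0 a b s w)"


section \<open>The integrand\<close>

definition lerch_zeta :: "complex \<Rightarrow> complex \<Rightarrow> complex \<Rightarrow> complex" where
  "lerch_zeta s a z =
     (\<Sum>m::nat. exp (2 * of_real pi * \<i> * of_nat m * a) * (z + of_nat m) powr (- s))"

definition conj_form :: "(complex \<Rightarrow> complex) \<Rightarrow> complex \<Rightarrow> complex" where
  "conj_form f z = cnj (f (- cnj z))"

definition xi :: "int \<Rightarrow> (complex \<Rightarrow> complex) \<Rightarrow> complex \<Rightarrow> complex" where
  "xi k f z = 2 * \<i> * of_real (Im z) powi k * cnj (d_zbar f z)"

definition R_series ::
  "int \<Rightarrow> (complex \<Rightarrow> complex) \<Rightarrow> real \<Rightarrow> real \<Rightarrow> complex \<Rightarrow> complex \<Rightarrow> complex" where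
  "R_series k f s t z w =
     (\<Sum>m::nat. xi k (conj_form f) (of_real t * (2 * \<i> - z - of_nat m))
                / (z + of_nat m) powr (1 - of_real s)
                * exp (\<i> * of_real t * of_nat m * w))"

end

theory Submission
  imports Defs "HOL-Real_Asymp.Real_Asymp"
begin

text \<open>Put \<open>u = 2 \<pi> n + w\<close> for an integer \<open>n\<close>.  Every term of the L-series is a Laplace transform over
  \<open>t \<ge> 1\<close>, that is, an integral over the vertical ray \<open>z = \<i> t\<close>, or the continuation of one
  in \<open>w\<close>.  Since \<open>Im w > 0\<close>, this ray can be turned about \<open>\<i>\<close> into the horizontal ray
  \<open>z = \<i> + x\<close>, \<open>x \<ge> 0\<close>.  There \<open>exp (2 \<pi> \<i> n z)\<close> has constant modulus and \<open>exp (\<i> w z)\<close> alone gives convergence, whatever the sign of \<open>Re u\<close>.  The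
  holomorphic part of \<open>f\<close> thus contributes \<open>\<i>\<^sup>-\<^sup>s\<close> times its integral against
  \<open>exp (\<i> w z) z\<^sup>s\<^sup>-\<^sup>1\<close> over the horizontal ray.  When the ray is cut into unit segments, the
  periodicity of \<open>f\<close> collects the powers of \<open>z + m\<close> into the Lerch zeta function
  (\<open>ray_series_integral\<close>, \<open>set_integral_unroll\<close>, \<open>lerch_zeta_unfolded\<close>).

  In the non-holomorphic part the factor \<open>\<Gamma>(1 - k, -4 \<pi> n Im z)\<close> varies along the vertical ray but is
  constant along the horizontal one, so turning the ray leaves a correction.  Integration by parts
  computes it (\<open>inc_Gamma_Laplace_by_parts\<close>).  The boundary term at \<open>t = 1\<close> is what the turned ray
  gives.  The remaining integral contains the derivative of the Gamma factor, which is elementary, and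
  its coefficients are those of \<open>\<xi>\<^sub>k f\<^sup>c\<close>.  Written over the horizontal ray and cut into unit
  segments, it becomes the integral of \<open>R\<^sub>t\<close> (\<open>xi_series_integral\<close>, \<open>R_series_unfolded\<close>).

  The turning of rays rests on one function, \<open>upper_Gamma s\<close>: the primitive of
  \<open>- exp (- z) z\<^sup>s\<^sup>-\<^sup>1\<close> on the slit plane that vanishes at infinity in every sector
  \<open>\<eta> \<bar>z\<bar> \<le> Re z\<close> with \<open>\<eta> > 0\<close>.  By the fundamental theorem of calculus its values are the integrals over all admissible
  rays (\<open>upper_Gamma_ray\<close>).  The continued exponential integral, its rotated form and the
  incomplete Gamma function on the positive reals are all instances.

  The left-hand side is defined by a choice of expansion, so an expansion must exist, and the
  argument must work for any of them.  Both rest on Fourier coefficients along horizontal lines.  The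
  equation \<open>\<Delta>\<^sub>k f = 0\<close> gives two first-order differential equations in \<open>y\<close>, for the coefficients of
  \<open>\<partial>f/\<partial>z\<^sup>*\<close>, the derivative with respect to the conjugate of \<open>z\<close>, and then of \<open>f\<close>.  The growth
  condition leaves only the admissible solutions, and Fourier inversion sums them
  (\<open>maass_coeff_fourier_term\<close>, \<open>fourier_inversion\<close>).  Conversely, an expansion determines the
  coefficients of \<open>f\<close>, and one differentiation in \<open>y\<close> determines those of \<open>\<partial>f/\<partial>z\<^sup>*\<close>.  Inversion
  applied to the latter yields the expansion of \<open>\<xi>\<^sub>k f\<^sup>c\<close> (\<open>d_zbar_coeff\<close>, \<open>xi_expansion\<close>).\<close>

section \<open>Integrals over half-lines: sums, repeated integrals and unit segments\<close>

lemma set_integrable_exp_bound: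
  fixes f :: "real \<Rightarrow> complex"
  assumes "continuous_on {a..} f" "d > 0" "\<And>x. x \<ge> a \<Longrightarrow> norm (f x) \<le> C * exp (- d * x)"
  shows "set_integrable lborel {a..} f"
proof -
  have "set_integrable lebesgue {a..} (\<lambda>x::real. exp (- d * x))"
    using integrable_on_exp_minus_to_infinity[of d a] assms(2)
    by (intro nonnegative_absolutely_integrable_1) auto
  moreover have "(\<lambda>x. indicat_real {a..} x *\<^sub>R exp (- d * x)) \<in> borel_measurable lborel"
    by measurable
  ultimately have e: "set_integrable lborel {a..} (\<lambda>x::real. exp (- (x * d)))"
    unfolding set_integrable_def by (subst (asm) integrable_completion) (auto simp: algebra_simps)
  show ?thesis
  proof (rule set_integrable_bound[of lborel _ "\<lambda>x. C * exp (- (x * d))"])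
    show "set_integrable lborel {a..} (\<lambda>x. C * exp (- (x * d)))"
      using e by simp
    show "set_borel_measurable lborel {a..} f"
      using assms(1) borel_measurable_continuous_on_indicator[of "{a..}" f]
      by (simp add: set_borel_measurable_def)
    show "AE x in lborel. x \<in> {a..} \<longrightarrow> norm (f x) \<le> norm (C * exp (- (x * d)))"
    proof (intro AE_I2 impI)
      fix x assume "x \<in> {a..}"
      then have "norm (f x) \<le> C * exp (- (x * d))" using assms(3)[of x] by (simp add: algebra_simps)
      also have "\<dots> \<le> norm (C * exp (- (x * d)))" by simp
      finally show "norm (f x) \<le> norm (C * exp (- (x * d)))" .
    qed
  qed
qed

lemma set_integral_FTC_Ici:
  fixes f F :: "real \<Rightarrow> complex"
  assumes "\<And>x. x \<ge> a \<Longrightarrow> (F has_vector_derivative f x) (at x within {a..})"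
    and "set_integrable lborel {a..} f" "continuous_on {a..} f" "(F \<longlongrightarrow> L) at_top"
  shows "(LINT x:{a..}|lborel. f x) = L - F a"
proof -
  have "((\<lambda>y. LINT x:{a..y}|lborel. f x) \<longlongrightarrow> (LINT x:{a..}|lborel. f x)) at_top"
    using tendsto_set_lebesgue_integral_at_top[OF _ assms(2)] by simp
  moreover have "eventually (\<lambda>y. (LINT x:{a..y}|lborel. f x) = F y - F a) at_top"
    using eventually_ge_at_top[of a]
  proof eventually_elim
    case (elim y)
    have "(f has_integral (F y - F a)) {a..y}"
      by (rule fundamental_theorem_of_calculus[OF elim])
        (auto intro!: has_vector_derivative_within_subset[OF assms(1)])
    moreover have "set_integrable lborel {a..y} f"
      by (rule set_integrable_subset[OF assms(2)]) auto
    ultimately show ?case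
      by (simp add: set_borel_integral_eq_integral(2) integral_unique)
  qed
  ultimately have "((\<lambda>y. F y - F a) \<longlongrightarrow> (LINT x:{a..}|lborel. f x)) at_top"
    by (rule Lim_transform_eventually)
  moreover have "((\<lambda>y. F y - F a) \<longlongrightarrow> L - F a) at_top"
    by (intro tendsto_intros assms)
  ultimately show ?thesis by (rule tendsto_unique[OF trivial_limit_at_top_linorder])
qed

lemma borel_measurable_has_sum:
  fixes F :: "'b \<Rightarrow> 'a \<Rightarrow> complex"
  assumes "countable A" "\<And>n. n \<in> A \<Longrightarrow> F n \<in> borel_measurable M"
    and "\<And>x. x \<in> space M \<Longrightarrow> ((\<lambda>n. F n x) has_sum f x) A"
  shows "f \<in> borel_measurable M"
proof (cases "finite A")
  case True
  have "f x = (\<Sum>n\<in>A. F n x)" if "x \<in> space M" for x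
    using has_sum_unique[OF assms(3)[OF that] has_sum_finite[OF True]] .
  then show ?thesis
    using assms(2) by (subst measurable_cong) auto
next
  case False
  have b: "bij_betw (from_nat_into A) UNIV A"
    using bij_betw_from_nat_into[OF assms(1) False] .
  have "(\<lambda>N. \<Sum>n<N. F (from_nat_into A n) x) \<longlonglongrightarrow> f x" if "x \<in> space M" for x
  proof -
    have "((\<lambda>n. F (from_nat_into A n) x) has_sum f x) UNIV"
      using assms(3)[OF that] has_sum_reindex_bij_betw[OF b, of "\<lambda>n. F n x"] by simp
    then show ?thesis using has_sum_imp_sums unfolding sums_def by blast
  qed
  moreover have "(\<lambda>x. \<Sum>n<N. F (from_nat_into A n) x) \<in> borel_measurable M" for N
    by (intro borel_measurable_sum assms(2) from_nat_into) (use False in auto)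
  ultimately show ?thesis
    by (rule borel_measurable_LIMSEQ_metric[rotated])
qed

text \<open>The majorant is a product, so replacing \<open>f\<close> by a finite partial sum changes the integral by at
  most a tail of \<open>\<gamma>\<close> times the integral of \<open>\<bar>g\<bar>\<close>.\<close>

lemma has_sum_set_integral:
  fixes F :: "'b \<Rightarrow> 'a \<Rightarrow> complex" and g :: "'a \<Rightarrow> real"
  assumes A: "countable A" and S: "S \<in> sets M"
    and F: "\<And>n. n \<in> A \<Longrightarrow> set_integrable M S (F n)"
    and g: "set_integrable M S g" and \<gamma>: "\<gamma> summable_on A"
    and bd: "\<And>n x. n \<in> A \<Longrightarrow> x \<in> S \<Longrightarrow> norm (F n x) \<le> \<gamma> n * g x"
    and sum: "\<And>x. x \<in> S \<Longrightarrow> ((\<lambda>n. F n x) has_sum f x) A"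
  shows "set_integrable M S f"
    and "((\<lambda>n. LINT x:S|M. F n x) has_sum (LINT x:S|M. f x)) A"
proof -
  have gn: "norm (F n x) \<le> norm (\<gamma> n) * norm (g x)" if "n \<in> A" "x \<in> S" for n x
    using bd[OF that] by (metis abs_ge_self abs_mult order_trans real_norm_def)
  define \<gamma>' where "\<gamma>' n = norm (\<gamma> n)" for n
  have \<gamma>': "\<gamma>' summable_on A"
    unfolding \<gamma>'_def using \<gamma> by (simp only: summable_on_iff_abs_summable_on_real[symmetric])
  have tail: "norm (f x - (\<Sum>n\<in>X. F n x)) \<le> (infsum \<gamma>' A - sum \<gamma>' X) * norm (g x)"
    if "finite X" "X \<subseteq> A" "x \<in> S" for X x
  proof -
    have *: "((\<lambda>n. F n x) has_sum (f x - sum (\<lambda>n. F n x) X)) (A - X)"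
      by (rule has_sum_Diff[OF sum[OF that(3)] has_sum_finite[OF that(1)] that(2)])
    have **: "((\<lambda>n. \<gamma>' n * norm (g x)) has_sum ((infsum \<gamma>' A - sum \<gamma>' X) * norm (g x))) (A - X)"
      by (intro has_sum_cmult_left has_sum_Diff that has_sum_finite has_sum_infsum \<gamma>')
    show ?thesis
      by (rule norm_infsum_le[OF * **]) (use gn that in \<open>auto simp: \<gamma>'_def\<close>)
  qed
  have meas: "set_borel_measurable M S f"
    unfolding set_borel_measurable_def
  proof (rule borel_measurable_has_sum[OF A])
    show "(\<lambda>x. indicator S x *\<^sub>R F n x) \<in> borel_measurable M" if "n \<in> A" for n
      using F[OF that] unfolding set_integrable_def by auto
    show "((\<lambda>n. indicator S x *\<^sub>R F n x) has_sum indicator S x *\<^sub>R f x) A" for x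
      using sum[of x] by (cases "x \<in> S") auto
  qed
  show f: "set_integrable M S f"
  proof (rule set_integrable_bound[of M S "\<lambda>x. infsum \<gamma>' A * g x"])
    show "set_integrable M S (\<lambda>x. infsum \<gamma>' A * g x)" using g by simp
    show "AE x in M. x \<in> S \<longrightarrow> norm (f x) \<le> norm (infsum \<gamma>' A * g x)"
    proof (intro AE_I2 impI)
      fix x assume "x \<in> S"
      then have "norm (f x) \<le> infsum \<gamma>' A * norm (g x)" using tail[of "{}" x] by simp
      also have "\<dots> \<le> norm (infsum \<gamma>' A * g x)"
        by (metis abs_ge_self abs_mult mult_right_mono norm_ge_zero real_norm_def)
      finally show "norm (f x) \<le> norm (infsum \<gamma>' A * g x)" .
    qed
  qed (fact meas)
  have fin: "set_integrable M S (\<lambda>x. \<Sum>n\<in>X. F n x)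
      \<and> (LINT x:S|M. (\<Sum>n\<in>X. F n x)) = (\<Sum>n\<in>X. LINT x:S|M. F n x)"
    if "finite X" "X \<subseteq> A" for X
  proof -
    have i: "integrable M (\<lambda>x. indicat_real S x *\<^sub>R F n x)" if "n \<in> X" for n
      using F[of n] that \<open>X \<subseteq> A\<close> unfolding set_integrable_def by blast
    show ?thesis
      unfolding set_integrable_def set_lebesgue_integral_def scaleR_sum_right
      using Bochner_Integration.integrable_sum[where I=X and M=M and f="\<lambda>n x. indicat_real S x *\<^sub>R F n x", OF i]
        Bochner_Integration.integral_sum[where I=X and M=M and f="\<lambda>n x. indicat_real S x *\<^sub>R F n x", OF i]
      by blast
  qed
  show "((\<lambda>n. LINT x:S|M. F n x) has_sum (LINT x:S|M. f x)) A"
    unfolding has_sum_def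
  proof (rule Lim_transform2[OF tendsto_const])
    let ?I = "LINT x:S|M. norm (g x)"
    have "((\<lambda>X. (infsum \<gamma>' A - sum \<gamma>' X) * ?I) \<longlongrightarrow> (infsum \<gamma>' A - infsum \<gamma>' A) * ?I)
        (finite_subsets_at_top A)"
      by (intro tendsto_intros) (use has_sum_infsum[OF \<gamma>'] in \<open>simp add: has_sum_def\<close>)
    then have z: "((\<lambda>X. (infsum \<gamma>' A - sum \<gamma>' X) * ?I) \<longlongrightarrow> 0) (finite_subsets_at_top A)" by simp
    show "((\<lambda>X. (LINT x:S|M. f x) - (\<Sum>n\<in>X. LINT x:S|M. F n x)) \<longlongrightarrow> 0) (finite_subsets_at_top A)"
    proof (rule Lim_null_comparison[OF _ z])
      show "\<forall>\<^sub>F X in finite_subsets_at_top A.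
          norm ((LINT x:S|M. f x) - (\<Sum>n\<in>X. LINT x:S|M. F n x)) \<le> (infsum \<gamma>' A - sum \<gamma>' X) * ?I"
        unfolding eventually_finite_subsets_at_top
      proof (intro exI[of _ "{}"] conjI allI impI)
        fix X assume X: "finite X \<and> {} \<subseteq> X \<and> X \<subseteq> A"
        have "(LINT x:S|M. f x) - (\<Sum>n\<in>X. LINT x:S|M. F n x) = (LINT x:S|M. f x - (\<Sum>n\<in>X. F n x))"
          using fin X f by (subst set_integral_diff(2)) auto
        also have "norm \<dots> \<le> (LINT x:S|M. norm (f x - (\<Sum>n\<in>X. F n x)))"
          using fin X f by (intro set_integral_norm_bound set_integral_diff(1)) auto
        also have "\<dots> \<le> (LINT x:S|M. (infsum \<gamma>' A - sum \<gamma>' X) * norm (g x))"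
          using fin X f g tail by (intro set_integral_mono set_integrable_norm set_integral_diff(1)) (auto simp: set_integrable_norm simp del: real_norm_def)
        also have "\<dots> = (infsum \<gamma>' A - sum \<gamma>' X) * ?I" by simp
        finally show "norm ((LINT x:S|M. f x) - (\<Sum>n\<in>X. LINT x:S|M. F n x)) \<le> \<dots>" .
      qed auto
    qed
  qed
qed

text \<open>The product of the two majorants is integrable in both variables together, which is what Fubini's
  theorem asks of \<open>K\<close>.\<close>

lemma set_integral_Fubini_product_bound:
  fixes K :: "real \<Rightarrow> real \<Rightarrow> complex" and p q :: "real \<Rightarrow> real"
  assumes K: "continuous_on (S \<times> T) (\<lambda>(t, x). K t x)" and ST: "closed S" "closed T"
    and p: "set_integrable lborel S p" and q: "set_integrable lborel T q"
    and bd: "\<And>t x. t \<in> S \<Longrightarrow> x \<in> T \<Longrightarrow> norm (K t x) \<le> p t * q x"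
  shows "(LINT t:S|lborel. LINT x:T|lborel. K t x) = (LINT x:T|lborel. LINT t:S|lborel. K t x)"
    and "set_integrable lborel T (\<lambda>x. LINT t:S|lborel. K t x)"
proof -
  define H where "H = (\<lambda>(t, x). indicator (S \<times> T) (t, x) *\<^sub>R K t x)"
  define B where "B = (\<lambda>(t, x). (indicator S t *\<^sub>R p t) * (indicator T x *\<^sub>R q x))"
  have Hm: "H \<in> borel_measurable (lborel \<Otimes>\<^sub>M lborel)"
  proof -
    have "(\<lambda>z. indicator (S \<times> T) z *\<^sub>R (\<lambda>(t, x). K t x) z) \<in> borel_measurable borel"
      using K ST by (intro borel_measurable_continuous_on_indicator borel_closed closed_Times) auto
    then show ?thesis unfolding H_def lborel_prod by (simp add: case_prod_unfold)
  qed
  have pm: "(\<lambda>t. indicator S t *\<^sub>R p t) \<in> borel_measurable lborel" "integrable lborel (\<lambda>t. indicator S t *\<^sub>R p t)"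
    using p unfolding set_integrable_def by auto
  have qm: "(\<lambda>t. indicator T t *\<^sub>R q t) \<in> borel_measurable lborel" "integrable lborel (\<lambda>t. indicator T t *\<^sub>R q t)"
    using q unfolding set_integrable_def by auto
  have Bi: "integrable (lborel \<Otimes>\<^sub>M lborel) B"
  proof (rule lborel_pair.Fubini_integrable)
    show "B \<in> borel_measurable (lborel \<Otimes>\<^sub>M lborel)"
      unfolding B_def case_prod_unfold
      by (intro borel_measurable_times measurable_compose[OF measurable_fst pm(1)]
          measurable_compose[OF measurable_snd qm(1)])
    show "integrable lborel (\<lambda>x. LINT y|lborel. norm (B (x, y)))"
    proof -
      have "integrable lborel (\<lambda>x. norm (indicator S x *\<^sub>R p x) * (LINT y|lborel. norm (indicator T y *\<^sub>R q y)))"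
        by (intro integrable_mult_left integrable_norm pm)
      then show ?thesis by (simp add: B_def abs_mult)
    qed
    show "AE x in lborel. integrable lborel (\<lambda>y. B (x, y))"
      using qm by (auto simp: B_def)
  qed
  have Hi: "integrable (lborel \<Otimes>\<^sub>M lborel) (case_prod (\<lambda>t x. H (t, x)))"
  proof (rule Bochner_Integration.integrable_bound[OF Bi])
    show "AE z in lborel \<Otimes>\<^sub>M lborel. norm (case z of (t, x) \<Rightarrow> H (t, x)) \<le> norm (B z)"
    proof (rule AE_I2)
      fix z :: "real \<times> real"
      obtain t x where z: "z = (t, x)" by force
      have "norm (K t x) \<le> \<bar>p t\<bar> * \<bar>q x\<bar>" if "t \<in> S" "x \<in> T"
        using bd[OF that] by (metis abs_ge_self abs_mult order_trans)
      then show "norm (case z of (t, x) \<Rightarrow> H (t, x)) \<le> norm (B z)"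
        by (auto simp: z H_def B_def indicator_def abs_mult)
    qed
  qed (use Hm in simp)
  have in1: "(LINT x|lborel. H (t, x)) = indicator S t *\<^sub>R (LINT x:T|lborel. K t x)" for t
    unfolding H_def set_lebesgue_integral_def
    by (cases "t \<in> S") (auto simp: indicator_times)
  have in2: "(LINT t|lborel. H (t, x)) = indicator T x *\<^sub>R (LINT t:S|lborel. K t x)" for x
    unfolding H_def set_lebesgue_integral_def
    by (cases "x \<in> T") (auto simp: indicator_times)
  show "(LINT t:S|lborel. LINT x:T|lborel. K t x) = (LINT x:T|lborel. LINT t:S|lborel. K t x)"
    using lborel_pair.Fubini_integral[OF Hi] unfolding in1 in2 set_lebesgue_integral_def by simp
  show "set_integrable lborel T (\<lambda>x. LINT t:S|lborel. K t x)"
    using lborel_pair.integrable_snd[OF Hi] unfolding in2 set_integrable_def .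
qed

text \<open>The half-line is the disjoint union of the intervals \<open>[m, m + 1)\<close>, and the exponential bound
  allows the sum over \<open>m\<close> to pass under the integral.  This is the step from an integral over a ray to
  an integral over a unit segment.\<close>

lemma set_integral_unroll:
  fixes \<Phi> :: "real \<Rightarrow> complex"
  assumes I: "set_integrable lborel {0..} \<Phi>" and d: "d > 0"
    and bd: "\<And>x. x \<ge> 0 \<Longrightarrow> norm (\<Phi> x) \<le> C * exp (- d * x)"
  shows "(LINT x:{0..1}|lborel. \<Sum>m::nat. \<Phi> (x + real m)) = (LINT x:{0..}|lborel. \<Phi> x)"
    and "set_integrable lborel {0..1} (\<lambda>x. \<Sum>m::nat. \<Phi> (x + real m))"
    and "\<And>x. x \<ge> 0 \<Longrightarrow> summable (\<lambda>m::nat. norm (\<Phi> (x + real m)))"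
proof -
  have C: "C \<ge> 0" using order_trans[OF norm_ge_zero bd[of 0]] by simp
  define \<gamma> where "\<gamma> m = C * exp (- d) ^ m" for m :: nat
  have \<gamma>s: "summable \<gamma>" unfolding \<gamma>_def using d by (intro summable_mult summable_geometric) auto
  then have \<gamma>: "\<gamma> summable_on UNIV"
    by (intro norm_summable_imp_summable_on) (use C d in \<open>simp add: \<gamma>_def abs_mult\<close>)
  have b: "norm (\<Phi> (x + real m)) \<le> \<gamma> m" if "x \<ge> 0" for x :: real and m :: nat
  proof -
    have "norm (\<Phi> (x + real m)) \<le> C * exp (- d * (x + real m))" by (rule bd) (use that in simp)
    also have "\<dots> \<le> C * exp (- d * real m)" using C d that by (intro mult_left_mono) auto
    also have "\<dots> = \<gamma> m" using exp_of_nat_mult[of m "- d"] by (simp only: \<gamma>_def mult.commute[of "- d"])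
    finally show ?thesis .
  qed
  show s: "summable (\<lambda>m::nat. norm (\<Phi> (x + real m)))" if "x \<ge> 0" for x
    by (rule summable_comparison_test'[OF \<gamma>s, of 0]) (use b[OF that] in auto)
  have im: "set_integrable lborel {real m..real m + 1} \<Phi>" for m
    by (rule set_integrable_subset[OF I]) auto
  have aff: "(\<lambda>y. indicat_real {real m..real m + 1} (real m + 1 * y) *\<^sub>R \<Phi> (real m + 1 * y)) =
      (\<lambda>y. indicat_real {0..1} y *\<^sub>R \<Phi> (y + real m))" for m
    by (rule ext) (auto simp: indicator_def add.commute)
  have F: "set_integrable lborel {0..1} (\<lambda>x. \<Phi> (x + real m))" for m
    using lborel_integrable_real_affine[OF im[of m, unfolded set_integrable_def], of 1 "real m"]
    unfolding set_integrable_def aff by simp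
  have eq: "(LINT x:{0..1}|lborel. \<Phi> (x + real m)) = (LINT x:{real m..<real m + 1}|lborel. \<Phi> x)" for m
  proof -
    have "(LINT x:{0..1}|lborel. \<Phi> (x + real m)) = (LINT x:{real m..real m + 1}|lborel. \<Phi> x)"
      using lborel_integral_real_affine[of 1 "\<lambda>x. indicat_real {real m..real m + 1} x *\<^sub>R \<Phi> x" "real m"]
      unfolding set_lebesgue_integral_def aff by simp
    also have "\<dots> = (LINT x:{real m..<real m + 1}|lborel. \<Phi> x)"
      unfolding set_lebesgue_integral_def
    proof (rule Bochner_Integration.integral_cong_AE)
      have h: "set_integrable lborel {real m..<real m + 1} \<Phi>"
        by (rule set_integrable_subset[OF im[of m]]) auto
      show "AE x in lborel. indicat_real {real m..real m + 1} x *\<^sub>R \<Phi> x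
          = indicat_real {real m..<real m + 1} x *\<^sub>R \<Phi> x"
        using AE_lborel_singleton[of "real m + 1"] by eventually_elim (auto simp: indicator_def)
      show "(\<lambda>x. indicat_real {real m..<real m + 1} x *\<^sub>R \<Phi> x) \<in> borel_measurable lborel"
        using h unfolding set_integrable_def by (rule borel_measurable_integrable)
      show "(\<lambda>x. indicat_real {real m..real m + 1} x *\<^sub>R \<Phi> x) \<in> borel_measurable lborel"
        using im[of m] unfolding set_integrable_def by (rule borel_measurable_integrable)
    qed
    finally show ?thesis .
  qed
  have hs: "((\<lambda>m. \<Phi> (x + real m)) has_sum (\<Sum>m. \<Phi> (x + real m))) UNIV" if "x \<in> {0..1}" for x
  proof (rule norm_summable_imp_has_sum)
    have *: "summable (\<lambda>m. norm (\<Phi> (x + real m)))" using that by (intro s) simp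
    then show "summable (\<lambda>m. norm (\<Phi> (x + real m)))" .
    show "(\<lambda>m. \<Phi> (x + real m)) sums (\<Sum>m. \<Phi> (x + real m))"
      by (rule summable_sums, rule summable_norm_cancel, rule *)
  qed
  have one: "set_integrable lborel {0..1} (\<lambda>_::real. 1::real)" by (simp add: set_integrable_def)
  have b1: "norm (\<Phi> (x + real m)) \<le> \<gamma> m * 1" if "x \<in> {0..1}" for x m
    using b[of x m] that by simp
  show "set_integrable lborel {0..1} (\<lambda>x. \<Sum>m::nat. \<Phi> (x + real m))"
    by (rule has_sum_set_integral(1)[of "UNIV :: nat set", OF _ _ F one \<gamma> b1 hs]) simp_all
  have "((\<lambda>m. LINT x:{0..1}|lborel. \<Phi> (x + real m)) has_sum
      (LINT x:{0..1}|lborel. \<Sum>m. \<Phi> (x + real m))) UNIV"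
    by (rule has_sum_set_integral(2)[of "UNIV :: nat set", OF _ _ F one \<gamma> b1 hs]) simp_all
  then have 1: "(\<lambda>m. LINT x:{real m..<real m + 1}|lborel. \<Phi> x) sums
      (LINT x:{0..1}|lborel. \<Sum>m. \<Phi> (x + real m))"
    unfolding eq by (rule has_sum_imp_sums)
  have un: "(\<Union>m. {real m..<real m + 1}) = {0..}"
  proof (intro equalityI subsetI)
    fix x :: real assume "x \<in> {0..}"
    then have "x \<in> {real (nat \<lfloor>x\<rfloor>)..<real (nat \<lfloor>x\<rfloor>) + 1}" by (simp add: of_nat_nat)
    then show "x \<in> (\<Union>m. {real m..<real m + 1})" by blast
  qed auto
  have c: "(LINT x:(\<Union>m. {real m..<real m + 1})|lborel. \<Phi> x) = (\<Sum>m. LINT x:{real m..<real m + 1}|lborel. \<Phi> x)"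
  proof (rule lebesgue_integral_countable_add)
    show "{real i..<real i + 1} \<inter> {real j..<real j + 1} = {}" if "i \<noteq> j" for i j :: nat
    proof (rule ccontr)
      assume "\<not> ?thesis"
      then obtain x where "x \<in> {real i..<real i + 1}" "x \<in> {real j..<real j + 1}" by blast
      then have "real i < real (j + 1)" "real j < real (i + 1)" by auto
      then have "i < j + 1" "j < i + 1" by (simp_all only: of_nat_less_iff)
      then show False using that by simp
    qed
    show "set_integrable lborel (\<Union>m. {real m..<real m + 1}) \<Phi>" using I unfolding un .
  qed auto
  show "(LINT x:{0..1}|lborel. \<Sum>m::nat. \<Phi> (x + real m)) = (LINT x:{0..}|lborel. \<Phi> x)"
    by (rule trans[OF sums_unique[OF 1] c[unfolded un, symmetric]])
qed

text \<open>On the initial segment up to \<open>X\<close> the function is bounded by compactness, which only enlarges the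
  constant.\<close>

lemma set_integrable_eventually_exp_bound:
  fixes f :: "real \<Rightarrow> complex"
  assumes "continuous_on {a..} f" "d > 0" "\<And>x. x \<ge> X \<Longrightarrow> norm (f x) \<le> C * exp (- d * x)"
  shows "set_integrable lborel {a..} f"
proof -
  have "compact (f ` {a..max a X})"
    by (intro compact_continuous_image continuous_on_subset[OF assms(1)]) auto
  then obtain B where B: "\<And>x. a \<le> x \<Longrightarrow> x \<le> max a X \<Longrightarrow> norm (f x) \<le> B"
    using compact_imp_bounded bounded_iff by (metis atLeastAtMost_iff imageI)
  show ?thesis
  proof (rule set_integrable_exp_bound[OF assms(1,2)])
    fix x assume x: "x \<ge> a"
    let ?D = "\<bar>C\<bar> + \<bar>B\<bar> * exp (d * max a X)"
    show "norm (f x) \<le> ?D * exp (- d * x)"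
    proof (cases "x \<le> max a X")
      case True
      have "norm (f x) \<le> \<bar>B\<bar> * 1" using B[OF x True] by simp
      also have "\<dots> \<le> \<bar>B\<bar> * exp (d * max a X - d * x)"
        using True assms(2) by (intro mult_left_mono) auto
      also have "\<dots> \<le> ?D * exp (- d * x)"
        by (simp add: exp_diff exp_minus field_simps)
      finally show ?thesis .
    next
      case False
      then have "norm (f x) \<le> C * exp (- d * x)" by (intro assms(3)) auto
      also have "\<dots> \<le> ?D * exp (- d * x)"
        by (intro mult_right_mono) (auto intro: order_trans[OF abs_ge_self])
      finally show ?thesis .
    qed
  qed
qed

text \<open>For \<open>p > 0\<close>, raise \<open>v \<le> exp v\<close> at \<open>v = \<delta> x / p\<close> to the power \<open>p\<close>; for \<open>p \<le> 0\<close> the power is at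
  most its value at \<open>x0\<close>.\<close>

lemma powr_le_exp:
  fixes p \<delta> x0 :: real
  assumes "\<delta> > 0" "x0 > 0"
  obtains C where "C > 0" "\<And>x. x \<ge> x0 \<Longrightarrow> x powr p \<le> C * exp (\<delta> * x)"
proof (cases "p \<le> 0")
  case True
  show ?thesis
  proof (rule that[of "x0 powr p"])
    fix x assume x: "x \<ge> x0"
    have "x powr p \<le> x0 powr p * 1" using x assms True by (simp add: powr_mono2')
    also have "\<dots> \<le> x0 powr p * exp (\<delta> * x)" using x assms by (intro mult_left_mono) auto
    finally show "x powr p \<le> x0 powr p * exp (\<delta> * x)" .
  qed (use assms in simp)
next
  case False
  show ?thesis
  proof (rule that[of "(p / \<delta>) powr p"])
    fix x assume x: "x \<ge> x0"
    have "x \<le> p / \<delta> * exp (\<delta> * x / p)"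
      using exp_ge_add_one_self[of "\<delta> * x / p"] False assms by (simp add: field_simps)
    then have "x powr p \<le> (p / \<delta> * exp (\<delta> * x / p)) powr p"
      using False x assms by (intro powr_mono2) auto
    also have "\<dots> = (p / \<delta>) powr p * exp (\<delta> * x)"
      using False assms exp_powr_real[of "\<delta> * x / p" p] by (subst powr_mult) auto
    finally show "x powr p \<le> (p / \<delta>) powr p * exp (\<delta> * x)" .
  qed (use False assms in auto)
qed

section \<open>The upper incomplete Gamma function on the slit plane\<close>

lemma slit_plane:
  shows "open (- \<real>\<^sub>\<le>\<^sub>0 :: complex set)" and "starlike (- \<real>\<^sub>\<le>\<^sub>0 :: complex set)"
    and "connected (- \<real>\<^sub>\<le>\<^sub>0 :: complex set)"
proof -
  have "(\<real>\<^sub>\<le>\<^sub>0 :: complex set) = complex_of_real ` {..0}"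
    by (auto simp: nonpos_Reals_def)
  then show s: "starlike (- \<real>\<^sub>\<le>\<^sub>0 :: complex set)"
    using starlike_slotted_complex_plane_left[of 0] by simp
  then show "connected (- \<real>\<^sub>\<le>\<^sub>0 :: complex set)" by (rule starlike_imp_connected)
  show "open (- \<real>\<^sub>\<le>\<^sub>0 :: complex set)" by (simp add: open_Compl)
qed

text \<open>This determines \<open>\<Gamma>(s, z)\<close>.  Vanishing at infinity is required along every path that tends to
  infinity within some sector of the right half-plane, because below it is used along the real axis,
  along lines through \<open>0\<close> and along oblique lines.\<close>

definition is_upper_Gamma :: "real \<Rightarrow> (complex \<Rightarrow> complex) \<Rightarrow> bool" where
  "is_upper_Gamma s G \<longleftrightarrow>
     (\<forall>z\<in>- \<real>\<^sub>\<le>\<^sub>0. (G has_field_derivative - (exp (- z) * z powr (of_real s - 1))) (at z)) \<and>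
     (\<forall>\<eta>>0. \<forall>\<zeta> :: real \<Rightarrow> complex. filterlim (\<lambda>x. Re (\<zeta> x)) at_top at_top \<longrightarrow>
        (\<forall>\<^sub>F x in at_top. \<eta> * norm (\<zeta> x) \<le> Re (\<zeta> x)) \<longrightarrow> ((\<lambda>x. G (\<zeta> x)) \<longlongrightarrow> 0) at_top)"

text \<open>In the sector \<open>\<bar>z\<bar>\<close> is at most \<open>Re z / \<eta>\<close>, so the power of \<open>z\<close> can be bounded by
  \<open>exp (\<eta> \<bar>z\<bar> / 4)\<close> at the cost of a quarter of the decay.\<close>

lemma gamma_integrand_sector_bound:
  fixes s \<eta> :: real
  assumes "\<eta> > 0"
  obtains C where "C > 0" "\<And>z. 1 \<le> Re z \<Longrightarrow> \<eta> * norm z \<le> Re z \<Longrightarrow>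
    norm (exp (- z) * z powr (of_real s - 1)) \<le> C * exp (- 3 / 4 * Re z)"
proof -
  obtain C where C: "C > 0" "\<And>x. x \<ge> 1 \<Longrightarrow> x powr (s - 1) \<le> C * exp (\<eta> / 4 * x)"
    using powr_le_exp[of "\<eta> / 4" 1 "s - 1"] assms by auto
  show ?thesis
  proof (rule that[OF C(1)])
    fix z :: complex assume z: "1 \<le> Re z" "\<eta> * norm z \<le> Re z"
    have n: "norm z \<ge> 1" using z(1) complex_Re_le_cmod[of z] by simp
    have "norm (z powr (of_real s - 1)) = norm z powr (s - 1)"
      using norm_powr_real_powr'[of "of_real s - 1" z] by simp
    also have "\<dots> \<le> C * exp (\<eta> / 4 * norm z)" by (rule C(2)[OF n])
    also have "\<dots> \<le> C * exp (Re z / 4)" using z C(1) by (intro mult_left_mono) auto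
    finally have "exp (- Re z) * norm (z powr (of_real s - 1)) \<le> exp (- Re z) * (C * exp (Re z / 4))"
      by (intro mult_left_mono) auto
    also have "\<dots> = C * exp (- 3 / 4 * Re z)" by (simp add: exp_add[symmetric])
    finally show "norm (exp (- z) * z powr (of_real s - 1)) \<le> C * exp (- 3 / 4 * Re z)"
      by (simp add: norm_mult)
  qed
qed

text \<open>The slit plane is starlike, so a primitive exists.  It converges along the positive reals and is
  normalised by its limit.  A point \<open>z\<close> of the sector is compared with the real point \<open>Re z\<close>: the
  segment between them has length at most \<open>Re z / \<eta>\<close>, and the derivative is exponentially small
  on it.\<close>

lemma ex_upper_Gamma: "\<exists>G. is_upper_Gamma s G"
proof -
  define g where "g z = - (exp (- z) * z powr (of_real s - 1))" for z :: complex
  have gd: "g field_differentiable (at z)" if "z \<notin> \<real>\<^sub>\<le>\<^sub>0" for z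
    unfolding g_def field_differentiable_def using that by (auto intro!: exI derivative_eq_intros)
  then have gc: "continuous_on (- \<real>\<^sub>\<le>\<^sub>0) g"
    by (auto intro!: continuous_at_imp_continuous_on field_differentiable_imp_continuous_at)
  obtain G0 where G0: "\<And>z. z \<notin> \<real>\<^sub>\<le>\<^sub>0 \<Longrightarrow> (G0 has_field_derivative g z) (at z)"
    using holomorphic_starlike_primitive[OF gc slit_plane(2,1), of "{}"] gd by auto
  have G0v: "((\<lambda>x. G0 (of_real x)) has_vector_derivative g (of_real x)) (at x within S)"
    if "x > 0" for x :: real and S
    using has_vector_derivative_real_field[of G0 "g (of_real x)" x S] G0[of "of_real x"] that
    by (auto simp: complex_nonpos_Reals_iff intro: has_field_derivative_at_within)
  obtain C1 where C1: "C1 > 0" "\<And>z. 1 \<le> Re z \<Longrightarrow> 1 * norm z \<le> Re z \<Longrightarrow>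
    norm (exp (- z) * z powr (of_real s - 1)) \<le> C1 * exp (- 3 / 4 * Re z)"
    using gamma_integrand_sector_bound[of 1 s] by auto
  have gi: "set_integrable lborel {1..} (\<lambda>x. g (of_real x))"
  proof (rule set_integrable_exp_bound)
    show "continuous_on {1..} (\<lambda>x. g (of_real x))"
      by (intro continuous_on_compose2[OF gc] continuous_intros) (auto simp: complex_nonpos_Reals_iff)
    show "norm (g (of_real x)) \<le> C1 * exp (- (3 / 4) * x)" if "x \<ge> 1" for x
      using C1(2)[of "of_real x"] that by (simp add: g_def)
  qed simp
  define L where "L = G0 1 + (LINT x:{1..}|lborel. g (of_real x))"
  define G where "G z = G0 z - L" for z
  have Gd: "(G has_field_derivative g z) (at z)" if "z \<notin> \<real>\<^sub>\<le>\<^sub>0" for z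
    unfolding G_def by (auto intro!: derivative_eq_intros G0 that)
  have real: "((\<lambda>x. G (of_real x)) \<longlongrightarrow> 0) at_top"
  proof -
    have "((\<lambda>y. G0 1 + (LINT x:{1..y}|lborel. g (of_real x))) \<longlongrightarrow> L) at_top"
      unfolding L_def by (intro tendsto_intros tendsto_set_lebesgue_integral_at_top gi) simp
    moreover have "eventually (\<lambda>y. G0 1 + (LINT x:{1..y}|lborel. g (of_real x)) = G0 (of_real y)) at_top"
      using eventually_ge_at_top[of 1]
    proof eventually_elim
      case (elim y)
      have "((\<lambda>x. g (of_real x)) has_integral (G0 (of_real y) - G0 (of_real 1))) {1..y}"
        by (rule fundamental_theorem_of_calculus[OF elim, of "\<lambda>x. G0 (of_real x)"]) (rule G0v, simp)
      moreover have "set_integrable lborel {1..y} (\<lambda>x. g (of_real x))"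
        by (rule set_integrable_subset[OF gi]) auto
      ultimately show ?case
        by (simp add: set_borel_integral_eq_integral(2) integral_unique)
    qed
    ultimately have "((\<lambda>y. G0 (of_real y)) \<longlongrightarrow> L) at_top" by (rule Lim_transform_eventually)
    then show ?thesis unfolding G_def by (simp add: LIM_zero)
  qed
  have sector: "((\<lambda>x. G (\<zeta> x)) \<longlongrightarrow> 0) at_top"
    if \<eta>: "\<eta> > 0" and lim: "filterlim (\<lambda>x. Re (\<zeta> x)) at_top at_top"
      and sec: "\<forall>\<^sub>F x in at_top. \<eta> * norm (\<zeta> x) \<le> Re (\<zeta> x)" for \<eta> and \<zeta> :: "real \<Rightarrow> complex"
  proof -
    obtain C where C: "C > 0" "\<And>z. 1 \<le> Re z \<Longrightarrow> \<eta> * norm z \<le> Re z \<Longrightarrow>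
      norm (exp (- z) * z powr (of_real s - 1)) \<le> C * exp (- 3 / 4 * Re z)"
      using gamma_integrand_sector_bound[OF \<eta>, of s] by auto
    have d: "norm (G z - G (of_real (Re z))) \<le> C / \<eta> * (Re z * exp (- 3 / 4 * Re z))"
      if z: "1 \<le> Re z" "\<eta> * norm z \<le> Re z" for z
    proof -
      let ?S = "closed_segment z (of_real (Re z))"
      have S: "Re y = Re z \<and> norm y \<le> norm z" if "y \<in> ?S" for y
      proof -
        obtain u where u: "0 \<le> u" "u \<le> 1" "y = (1 - u) *\<^sub>R z + u *\<^sub>R of_real (Re z)"
          using \<open>y \<in> ?S\<close> by (auto simp: closed_segment_def)
        have "Re y = (1 - u) * Re z + u * Re z" using u(3) by simp
        then have re: "Re y = Re z" by (simp add: algebra_simps)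
        have "Im y = (1 - u) * Im z" using u by simp
        then have "\<bar>Im y\<bar> \<le> \<bar>Im z\<bar>" using u by (simp add: abs_mult mult_left_le_one_le)
        then have "norm y \<le> norm z"
          unfolding cmod_def re by (intro real_sqrt_le_mono add_left_mono) (simp add: abs_le_square_iff)
        with re show ?thesis by simp
      qed
      have "norm (G z - G (of_real (Re z))) \<le> C * exp (- 3 / 4 * Re z) * norm (z - of_real (Re z))"
      proof (rule field_differentiable_bound[of ?S])
        fix y assume y: "y \<in> ?S"
        have *: "Re y = Re z" "norm y \<le> norm z" using S[OF y] by auto
        have **: "\<eta> * norm y \<le> Re y"
          using z(2) *(1) mult_left_mono[OF *(2), of \<eta>] \<eta> by linarith
        show "(G has_field_derivative g y) (at y within ?S)"
          using * z(1) by (intro has_field_derivative_at_within[OF Gd]) (auto simp: complex_nonpos_Reals_iff)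
        show "norm (g y) \<le> C * exp (- 3 / 4 * Re z)"
          using C(2)[of y] * ** z by (simp add: g_def)
      qed auto
      also have "norm (z - of_real (Re z)) \<le> Re z / \<eta>"
      proof -
        have "norm (z - of_real (Re z)) = \<bar>Im z\<bar>" by (simp add: cmod_def)
        also have "\<dots> \<le> norm z" by (rule abs_Im_le_cmod)
        also have "\<dots> \<le> Re z / \<eta>" using z(2) \<eta> by (simp add: field_simps)
        finally show ?thesis .
      qed
      finally show ?thesis using C(1) by (simp add: mult_left_mono field_simps)
    qed
    have "((\<lambda>r::real. C / \<eta> * (r * exp (- 3 / 4 * r))) \<longlongrightarrow> 0) at_top" by real_asymp
    then have "((\<lambda>x. C / \<eta> * (Re (\<zeta> x) * exp (- 3 / 4 * Re (\<zeta> x)))) \<longlongrightarrow> 0) at_top"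
      by (rule filterlim_compose[OF _ lim])
    then have "((\<lambda>x. G (\<zeta> x) - G (of_real (Re (\<zeta> x)))) \<longlongrightarrow> 0) at_top"
    proof (rule Lim_null_comparison[rotated])
      have "\<forall>\<^sub>F x in at_top. 1 \<le> Re (\<zeta> x)" using lim by (simp add: filterlim_at_top)
      with sec show "\<forall>\<^sub>F x in at_top. norm (G (\<zeta> x) - G (of_real (Re (\<zeta> x))))
          \<le> C / \<eta> * (Re (\<zeta> x) * exp (- 3 / 4 * Re (\<zeta> x)))"
        by eventually_elim (rule d)
    qed
    from tendsto_add[OF this filterlim_compose[OF real lim]] show ?thesis by simp
  qed
  show ?thesis
    unfolding is_upper_Gamma_def using Gd sector unfolding g_def by (intro exI[of _ G]) auto
qed

definition upper_Gamma :: "real \<Rightarrow> complex \<Rightarrow> complex" where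
  "upper_Gamma s = (SOME G. is_upper_Gamma s G)"

lemma upper_Gamma_spec: "is_upper_Gamma s (upper_Gamma s)"
  unfolding upper_Gamma_def by (rule someI_ex[OF ex_upper_Gamma])

lemma upper_Gamma_deriv:
  "z \<notin> \<real>\<^sub>\<le>\<^sub>0 \<Longrightarrow>
    (upper_Gamma s has_field_derivative - (exp (- z) * z powr (of_real s - 1))) (at z)"
  using upper_Gamma_spec[of s] unfolding is_upper_Gamma_def by auto

lemma upper_Gamma_tendsto_0:
  fixes \<zeta> :: "real \<Rightarrow> complex"
  assumes "\<eta> > 0" "filterlim (\<lambda>x. Re (\<zeta> x)) at_top at_top" "\<forall>\<^sub>F x in at_top. \<eta> * norm (\<zeta> x) \<le> Re (\<zeta> x)"
  shows "((\<lambda>x. upper_Gamma s (\<zeta> x)) \<longlongrightarrow> 0) at_top"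
  using upper_Gamma_spec[of s] assms unfolding is_upper_Gamma_def by blast

text \<open>The fundamental theorem of calculus along the ray.  Since \<open>Re b > 0\<close>, the ray finally stays in a
  sector, so the contribution of its far end is \<open>0\<close>.\<close>

lemma upper_Gamma_ray:
  fixes a b :: complex and x0 s :: real
  assumes b: "Re b > 0" and slit: "\<And>x. x \<ge> x0 \<Longrightarrow> a + b * of_real x \<notin> \<real>\<^sub>\<le>\<^sub>0"
  defines "h \<equiv> \<lambda>x. exp (- (a + b * of_real x)) * (a + b * of_real x) powr (of_real s - 1) * b"
  shows "set_integrable lborel {x0..} h"
    and "(LINT x:{x0..}|lborel. h x) = upper_Gamma s (a + b * of_real x0)"
proof -
  define \<zeta> where "\<zeta> x = a + b * of_real x" for x :: real
  define \<eta> where "\<eta> = Re b / (2 * (norm a + norm b))"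
  have nb: "norm b > 0" using b by auto
  have \<eta>: "\<eta> > 0" unfolding \<eta>_def using b nb by (auto intro!: divide_pos_pos add_nonneg_pos)
  \<comment> \<open>beyond \<open>X\<close> the term \<open>b x\<close> dominates \<open>a\<close>, and the path lies in the sector of aperture \<open>\<eta>\<close>\<close>
  define X where "X = max 1 (max (2 * \<bar>Re a\<bar> / Re b) (2 / Re b))"
  have far: "Re (\<zeta> x) \<ge> Re b / 2 * x" "\<eta> * norm (\<zeta> x) \<le> Re (\<zeta> x)" "Re (\<zeta> x) \<ge> 1" if "x \<ge> X" for x
  proof -
    have x: "x \<ge> 1" "2 * \<bar>Re a\<bar> / Re b \<le> x" "2 / Re b \<le> x" using that by (auto simp: X_def)
    have "2 * \<bar>Re a\<bar> \<le> Re b * x" using x(2) b by (simp add: field_simps)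
    then show 1: "Re (\<zeta> x) \<ge> Re b / 2 * x" unfolding \<zeta>_def by (simp add: field_simps)
    have "2 \<le> Re b * x" using x(3) b by (simp add: field_simps)
    then show "Re (\<zeta> x) \<ge> 1" using 1 by simp
    have "norm (\<zeta> x) \<le> norm a + norm b * x"
      unfolding \<zeta>_def using x(1) by (intro norm_triangle_le) (simp add: norm_mult)
    also have "\<dots> \<le> (norm a + norm b) * x"
      using mult_left_mono[OF x(1), of "norm a"] by (simp add: algebra_simps)
    finally have "\<eta> * norm (\<zeta> x) \<le> \<eta> * ((norm a + norm b) * x)" using \<eta> by simp
    also have "\<dots> = Re b / 2 * x" 
    proof -
      have "norm a + norm b \<noteq> 0" using nb norm_ge_zero[of a] by linarith
      then show ?thesis unfolding \<eta>_def by (simp add: divide_simps)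
    qed
    finally show "\<eta> * norm (\<zeta> x) \<le> Re (\<zeta> x)" using 1 by linarith
  qed
  obtain C where C: "C > 0" "\<And>z. 1 \<le> Re z \<Longrightarrow> \<eta> * norm z \<le> Re z \<Longrightarrow>
      norm (exp (- z) * z powr (of_real s - 1)) \<le> C * exp (- 3 / 4 * Re z)"
    using gamma_integrand_sector_bound[OF \<eta>, of s] by auto
  have "continuous_on (- \<real>\<^sub>\<le>\<^sub>0) (\<lambda>z. exp (- z) * z powr (of_real s - 1) * b)"
    by (intro holomorphic_on_imp_continuous_on holomorphic_intros) auto
  moreover have "continuous_on {x0..} (\<lambda>x. a + b * of_real x)" by (intro continuous_intros)
  ultimately have hc: "continuous_on {x0..} h"
    unfolding h_def by (rule continuous_on_compose2) (use slit in auto)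
  show hi: "set_integrable lborel {x0..} h"
  proof (rule set_integrable_eventually_exp_bound[OF hc])
    show "3 / 8 * Re b > 0" using b by simp
    fix x assume "x \<ge> X"
    note f = far[OF this]
    have "norm (h x) \<le> (C * exp (- 3 / 4 * Re (\<zeta> x))) * norm b"
      unfolding h_def \<zeta>_def[symmetric] norm_mult[of _ b] by (intro mult_right_mono C(2) f) auto
    also have "\<dots> \<le> (C * exp (- (3 / 8 * Re b) * x)) * norm b"
      using f(1) C(1) by (intro mult_right_mono mult_left_mono) (auto simp: mult.commute)
    finally show "norm (h x) \<le> C * norm b * exp (- (3 / 8 * Re b) * x)" by (simp add: mult_ac)
  qed
  have "filterlim (\<lambda>x. Re b / 2 * x) at_top at_top"
    using b by (intro filterlim_tendsto_pos_mult_at_top[OF tendsto_const]) (auto simp: filterlim_ident)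
  then have lim: "filterlim (\<lambda>x. Re (\<zeta> x)) at_top at_top"
    by (rule filterlim_at_top_mono) (use far in \<open>auto simp: eventually_at_top_linorder\<close>)
  have "((\<lambda>x. - upper_Gamma s (\<zeta> x)) \<longlongrightarrow> - 0) at_top"
    by (intro tendsto_minus upper_Gamma_tendsto_0[OF \<eta> lim]) (use far in \<open>auto simp: eventually_at_top_linorder\<close>)
  moreover have "((\<lambda>x. - upper_Gamma s (\<zeta> x)) has_vector_derivative h x) (at x within {x0..})" if "x \<ge> x0" for x
  proof -
    have "((\<lambda>x. - upper_Gamma s (a + b * x)) has_field_derivative h x) (at (of_real x))"
    proof -
      have "((\<lambda>z. a + b * z) has_field_derivative b) (at (of_real x))"
        by (auto intro!: derivative_eq_intros)
      from DERIV_minus[OF DERIV_chain2[of "upper_Gamma s", OF upper_Gamma_deriv[OF slit[OF that]] this]]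
      show ?thesis by (simp add: h_def)
    qed
    then show ?thesis
      unfolding \<zeta>_def by (rule has_vector_derivative_real_field[OF has_field_derivative_at_within])
  qed
  ultimately have "(LINT x:{x0..}|lborel. h x) = - 0 - (- upper_Gamma s (\<zeta> x0))"
    by (intro set_integral_FTC_Ici hi hc)
  then show "(LINT x:{x0..}|lborel. h x) = upper_Gamma s (a + b * of_real x0)"
    by (simp add: \<zeta>_def)
qed

text \<open>The ray \<open>t \<mapsto> u t\<close>, which gives the integral that defines the exponential integral.\<close>

lemma upper_Gamma_half_line:
  assumes "Re u > 0"
  shows "set_integrable lborel {1..} (\<lambda>t. exp (- u * of_real t) * of_real (t powr (s - 1)))"
    and "(LINT t:{1..}|lborel. exp (- u * of_real t) * of_real (t powr (s - 1)))
      = u powr (- of_real s) * upper_Gamma s u"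
proof -
  have u0: "u \<noteq> 0" using assms by auto
  have slit: "0 + u * of_real x \<notin> \<real>\<^sub>\<le>\<^sub>0" if "x \<ge> 1" for x :: real
    using assms that by (simp add: complex_nonpos_Reals_iff mult_le_0_iff)
  let ?h = "\<lambda>x. exp (- (0 + u * of_real x)) * (0 + u * of_real x) powr (of_real s - 1) * u"
  have ray: "set_integrable lborel {1..} ?h" "(LINT x:{1..}|lborel. ?h x) = upper_Gamma s (0 + u * of_real 1)"
    by (rule upper_Gamma_ray[OF assms slit], assumption)+
  have eq: "exp (- u * of_real t) * of_real (t powr (s - 1)) = u powr (- of_real s) * ?h t" if "t \<ge> 1" for t
  proof -
    have "(of_real t * u) powr (of_real s - 1) = of_real (t powr (s - 1)) * u powr (of_real s - 1)"
      using that powr_of_real[of t "s - 1"] by (subst powr_times_real_left) auto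
    moreover have "u powr (- of_real s) * (u powr (of_real s - 1) * u) = 1"
      using u0 powr_add[of u "of_real s - 1" 1] by (simp add: powr_minus field_simps)
    ultimately show ?thesis by (simp add: mult_ac)
  qed
  have "set_integrable lborel {1..} (\<lambda>t. u powr (- of_real s) * ?h t)"
    by (rule set_integrable_mult_right) (rule ray(1))
  then show "set_integrable lborel {1..} (\<lambda>t. exp (- u * of_real t) * of_real (t powr (s - 1)))"
    by (subst set_integrable_cong[OF refl refl eq]) auto
  have "(LINT t:{1..}|lborel. exp (- u * of_real t) * of_real (t powr (s - 1)))
      = (LINT t:{1..}|lborel. u powr (- of_real s) * ?h t)"
    by (rule set_lebesgue_integral_cong, simp, intro allI impI, rule eq, simp)
  also have "\<dots> = u powr (- of_real s) * (LINT t:{1..}|lborel. ?h t)"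
    by (rule set_integral_mult_right)
  also have "\<dots> = u powr (- of_real s) * upper_Gamma s u"
    using ray(2) by simp
  finally show "(LINT t:{1..}|lborel. exp (- u * of_real t) * of_real (t powr (s - 1)))
      = u powr (- of_real s) * upper_Gamma s u" .
qed

text \<open>The arguments lie in \<open>(0, \<pi>)\<close> and \<open>(-\<pi>/2, 0]\<close>, so their sum stays in the range of the principal
  branch.\<close>

lemma powr_mult_upper_lower:
  fixes u v c :: complex
  assumes "Im u > 0" "Im v \<le> 0" "Re v > 0"
  shows "(u * v) powr c = u powr c * v powr c"
proof -
  have u0: "u \<noteq> 0" and v0: "v \<noteq> 0" using assms by auto
  have "0 < Im (Ln u)" "Im (Ln u) < pi"
    using assms(1) Im_Ln_pos_lt_imp[of u] by auto
  moreover have "- pi / 2 < Im (Ln v)" "Im (Ln v) \<le> 0"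
  proof -
    show "- pi / 2 < Im (Ln v)" using Re_Ln_pos_lt_imp[OF assms(3)] by auto
    show "Im (Ln v) \<le> 0"
    proof (rule ccontr)
      assume "\<not> ?thesis"
      then have "Im (Ln v) > 0" by simp
      moreover have "Im (Ln v) < pi" using Re_Ln_pos_lt_imp[OF assms(3)] pi_gt_zero by linarith
      ultimately have "Im v > 0" using Im_Ln_pos_lt[OF v0] by simp
      with assms(2) show False by simp
    qed
  qed
  ultimately have "Ln (u * v) = Ln u + Ln v"
    using u0 v0 by (intro Ln_times_simple) auto
  then show ?thesis using u0 v0 by (simp add: powr_def exp_add algebra_simps)
qed

text \<open>The path \<open>v (1 - \<i> x)\<close> starts at the real point \<open>v\<close> and goes vertically downwards.  The
  exponential decays along it like \<open>exp (- v x Im u)\<close>, so the integral converges for every \<open>u\<close> in the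
  upper half-plane, where the integral over the real half-line may diverge.\<close>

lemma upper_Gamma_rotated:
  fixes u :: complex and v s :: real
  assumes u: "Im u > 0" and v: "v > 0"
  defines "h \<equiv> \<lambda>x::real. exp (- (u * of_real v * (1 - \<i> * of_real x))) * (1 - \<i> * of_real x) powr (of_real s - 1)"
  shows "set_integrable lborel {0..} h"
    and "(LINT x:{0..}|lborel. h x)
      = \<i> * of_real (v powr (- s)) * u powr (- of_real s) * upper_Gamma s (u * of_real v)"
proof -
  define U where "U = u * of_real v"
  have U: "Im U > 0" "U \<noteq> 0" using u v by (auto simp: U_def)
  have eq0: "U + (- \<i> * U) * of_real x = U * (1 - \<i> * of_real x)" for x :: real
    by (simp add: algebra_simps)
  have slit: "U + (- \<i> * U) * of_real x \<notin> \<real>\<^sub>\<le>\<^sub>0" if "x \<ge> 0" for x :: real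
  proof
    assume "U + (- \<i> * U) * of_real x \<in> \<real>\<^sub>\<le>\<^sub>0"
    then have *: "Re U + x * Im U \<le> 0" "Im U = x * Re U"
      by (auto simp: complex_nonpos_Reals_iff algebra_simps)
    have "0 < x * Re U" using *(2) U(1) by simp
    then have "Re U > 0" using that by (simp add: zero_less_mult_iff)
    moreover have "0 \<le> x * Im U" using that U(1) by simp
    ultimately show False using *(1) by linarith
  qed
  have b: "Re (- \<i> * U) > 0" using U by simp
  let ?h = "\<lambda>x. exp (- (U + (- \<i> * U) * of_real x)) * (U + (- \<i> * U) * of_real x) powr (of_real s - 1) * (- \<i> * U)"
  have ray: "set_integrable lborel {0..} ?h" "(LINT x:{0..}|lborel. ?h x) = upper_Gamma s (U + (- \<i> * U) * of_real 0)"
    by (rule upper_Gamma_ray[OF b slit], assumption)+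
  let ?c = "\<i> * U powr (- of_real s)"
  have eq: "h x = ?c * ?h x" if "x \<ge> 0" for x
  proof -
    have "(U * (1 - \<i> * of_real x)) powr (of_real s - 1) = U powr (of_real s - 1) * (1 - \<i> * of_real x) powr (of_real s - 1)"
      using U that by (intro powr_mult_upper_lower) auto
    moreover have "U powr (- of_real s) * (U powr (of_real s - 1) * U) = 1"
      using U powr_add[of U "of_real s - 1" 1] by (simp add: powr_minus field_simps)
    ultimately show ?thesis unfolding eq0 h_def U_def[symmetric] by (simp add: mult_ac)
  qed
  have "set_integrable lborel {0..} (\<lambda>t. ?c * ?h t)"
    by (rule set_integrable_mult_right) (rule ray(1))
  then show "set_integrable lborel {0..} h"
    by (subst set_integrable_cong[OF refl refl eq]) auto
  have "(LINT t:{0..}|lborel. h t) = (LINT t:{0..}|lborel. ?c * ?h t)"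
    by (rule set_lebesgue_integral_cong, simp, intro allI impI, rule eq, simp)
  also have "\<dots> = ?c * (LINT t:{0..}|lborel. ?h t)"
    by (rule set_integral_mult_right)
  also have "\<dots> = ?c * upper_Gamma s U"
    using ray(2) by simp
  also have "U powr (- of_real s) = of_real (v powr (- s)) * u powr (- of_real s)"
    unfolding U_def using v powr_of_real[of v "- s"] by (subst mult.commute, subst powr_times_real_left) auto
  finally show "(LINT x:{0..}|lborel. h x)
      = \<i> * of_real (v powr (- s)) * u powr (- of_real s) * upper_Gamma s (u * of_real v)"
    by (simp add: U_def mult_ac)
qed

lemma upper_Gamma_holomorphic: "upper_Gamma s holomorphic_on (- \<real>\<^sub>\<le>\<^sub>0)"
  by (rule holomorphic_onI, rule field_differentiable_at_within)
    (auto simp: field_differentiable_def intro: upper_Gamma_deriv)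

text \<open>The function \<open>z\<^sup>-\<^sup>s \<Gamma>(s, z)\<close> is one continuation of the integral, and the identity theorem on the
  connected slit plane shows that the chosen one agrees with it.\<close>

lemma exp_integral_eq_upper_Gamma:
  assumes "u \<notin> \<real>\<^sub>\<le>\<^sub>0"
  shows "exp_integral (1 - of_real s) u = u powr (- of_real s) * upper_Gamma s u"
proof -
  define P where "P g \<longleftrightarrow> g holomorphic_on (- \<real>\<^sub>\<le>\<^sub>0) \<and>
     (\<forall>z. Re z > 0 \<longrightarrow> g z = integral {1..} (\<lambda>t::real. exp (- z * of_real t) * of_real t powr (- (1 - of_real s))))"
    for g :: "complex \<Rightarrow> complex"
  define g0 where "g0 z = z powr (- of_real s) * upper_Gamma s z" for z
  have g0: "P g0"
    unfolding P_def
  proof (intro conjI allI impI)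
    show "g0 holomorphic_on - \<real>\<^sub>\<le>\<^sub>0"
      unfolding g0_def by (intro holomorphic_intros upper_Gamma_holomorphic) auto
    fix z :: complex assume z: "Re z > 0"
    have "g0 z = integral {1..} (\<lambda>t. exp (- z * of_real t) * of_real (t powr (s - 1)))"
      using upper_Gamma_half_line[OF z, of s] unfolding g0_def
      by (simp add: set_borel_integral_eq_integral(2))
    also have "\<dots> = integral {1..} (\<lambda>t::real. exp (- z * of_real t) * of_real t powr (- (1 - of_real s)))"
    proof (rule integral_cong)
      fix t :: real assume "t \<in> {1..}"
      then show "exp (- z * of_real t) * of_real (t powr (s - 1)) = exp (- z * of_real t) * of_real t powr (- (1 - of_real s))"
        using powr_of_real[of t "s - 1"] by simp
    qed
    finally show "g0 z = \<dots>" .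
  qed
  have e: "P (exp_integral (1 - of_real s))"
    unfolding exp_integral_def P_def[symmetric] by (rule someI[of P, OF g0])
  have "exp_integral (1 - of_real s) u = g0 u"
  proof (rule analytic_continuation_open[where s = "{z. Re z > 0}" and s' = "- \<real>\<^sub>\<le>\<^sub>0"
        and f = "exp_integral (1 - of_real s)" and g = g0])
    show "open {z. Re z > 0}" by (rule open_halfspace_Re_gt)
    show "{z. 0 < Re z} \<noteq> {}" by (metis (mono_tags) empty_iff mem_Collect_eq one_complex.sel(1) zero_less_one)
    show "{z. 0 < Re z} \<subseteq> - \<real>\<^sub>\<le>\<^sub>0" by (auto simp: complex_nonpos_Reals_iff)
    show "exp_integral (1 - of_real s) z = g0 z" if "z \<in> {z. 0 < Re z}" for z
      using e g0 that by (simp add: P_def)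
  qed (use slit_plane e g0 assms in \<open>simp_all add: P_def\<close>)
  then show ?thesis by (simp add: g0_def)
qed

section \<open>The incomplete Gamma function on the positive reals\<close>

lemma inc_Gamma_eq_upper_Gamma:
  assumes "x > 0"
  shows "of_real (inc_Gamma r x) = upper_Gamma r (of_real x)"
proof -
  have "upper_Gamma r (of_real x) = (LINT t:{x..}|lborel. complex_of_real (exp (- t) * t powr (r - 1)))"
    and i: "set_integrable lborel {x..} (\<lambda>t. complex_of_real (exp (- t) * t powr (r - 1)))"
  proof -
    have slit: "0 + 1 * complex_of_real t \<notin> \<real>\<^sub>\<le>\<^sub>0" if "t \<ge> x" for t
      using that assms by (simp add: complex_nonpos_Reals_iff)
    let ?h = "\<lambda>t. exp (- (0 + 1 * complex_of_real t)) * (0 + 1 * of_real t) powr (of_real r - 1) * 1"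
    have eq: "?h t = complex_of_real (exp (- t) * t powr (r - 1))" if "t \<in> {x..}" for t
    proof -
      have "complex_of_real t powr (of_real r - 1) = of_real (t powr (r - 1))"
        using powr_of_real[of t "r - 1"] that assms by simp
      then show ?thesis by (simp add: exp_of_real[symmetric])
    qed
    note ray = upper_Gamma_ray[of 1 x 0 r, OF _ slit]
    show "set_integrable lborel {x..} (\<lambda>t. complex_of_real (exp (- t) * t powr (r - 1)))"
      using ray(1) by (subst set_integrable_cong[OF refl refl eq[symmetric]]) auto
    have "(LINT t:{x..}|lborel. ?h t) = (LINT t:{x..}|lborel. complex_of_real (exp (- t) * t powr (r - 1)))"
      by (rule set_lebesgue_integral_cong) (simp, intro allI impI, rule eq)
    then show "upper_Gamma r (of_real x) = (LINT t:{x..}|lborel. complex_of_real (exp (- t) * t powr (r - 1)))"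
      using ray(2) by simp
  qed
  moreover have "set_integrable lborel {x..} (\<lambda>t. exp (- t) * t powr (r - 1))"
  proof -
    have "integrable lborel (\<lambda>t. complex_of_real (indicator {x..} t *\<^sub>R (exp (- t) * t powr (r - 1))))"
      using i unfolding set_integrable_def by (simp add: scaleR_conv_of_real)
    then show ?thesis unfolding set_integrable_def complex_of_real_integrable_eq .
  qed
  ultimately show ?thesis
    unfolding inc_Gamma_def
    by (simp only: set_integral_complex_of_real set_borel_integral_eq_integral(2))
qed

lemma inc_Gamma_deriv:
  assumes "x > 0"
  shows "(inc_Gamma r has_real_derivative - (exp (- x) * x powr (r - 1))) (at x)"
proof -
  have "((\<lambda>x. upper_Gamma r (of_real x)) has_vector_derivative
      - (exp (- of_real x) * of_real x powr (of_real r - 1))) (at x)"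
    by (rule has_vector_derivative_real_field, rule has_field_derivative_at_within, rule upper_Gamma_deriv)
      (use assms in \<open>auto simp: complex_nonpos_Reals_iff\<close>)
  then have "((\<lambda>x. Re (upper_Gamma r (of_real x))) has_vector_derivative
      Re (- (exp (- of_real x) * of_real x powr (of_real r - 1)))) (at x)"
    by (rule bounded_linear.has_vector_derivative[OF bounded_linear_Re])
  moreover have "Re (- (exp (- of_real x) * of_real x powr (of_real r - 1))) = - (exp (- x) * x powr (r - 1))"
  proof -
    have "complex_of_real x powr (of_real r - 1) = of_real (x powr (r - 1))"
      using powr_of_real[of x "r - 1"] assms by simp
    then have "- (exp (- of_real x) * of_real x powr (of_real r - 1)) = complex_of_real (- (exp (- x) * x powr (r - 1)))"
      by (simp add: exp_of_real[symmetric])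
    then show ?thesis by (metis Re_complex_of_real)
  qed
  ultimately have "((\<lambda>x. Re (upper_Gamma r (of_real x))) has_real_derivative - (exp (- x) * x powr (r - 1))) (at x)"
    by (simp add: has_real_derivative_iff_has_vector_derivative)
  then show ?thesis
  proof (rule has_field_derivative_transform_within_open[of _ _ _ "{0<..}"])
    show "Re (upper_Gamma r (of_real y)) = inc_Gamma r y" if "y \<in> {0<..}" for y
      using inc_Gamma_eq_upper_Gamma[of y r] that by (metis Re_complex_of_real greaterThan_iff)
  qed (use assms in auto)
qed

lemma inc_Gamma_tendsto_0: "(inc_Gamma r \<longlongrightarrow> 0) at_top"
proof -
  have "((\<lambda>x. upper_Gamma r (of_real x)) \<longlongrightarrow> 0) at_top"
    by (rule upper_Gamma_tendsto_0[of 1]) (auto simp: filterlim_ident eventually_at_top_linorder intro!: exI[of _ 0])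
  then have "((\<lambda>x. Re (upper_Gamma r (of_real x))) \<longlongrightarrow> Re 0) at_top" by (rule tendsto_Re)
  moreover have "\<forall>\<^sub>F x in at_top. Re (upper_Gamma r (of_real x)) = inc_Gamma r x"
    using eventually_gt_at_top[of 0] by eventually_elim (metis Re_complex_of_real inc_Gamma_eq_upper_Gamma)
  ultimately show ?thesis by (simp add: Lim_transform_eventually)
qed

lemma nonneg_if_decreasing_to_0:
  fixes D :: "real \<Rightarrow> real"
  assumes "\<And>x. x \<ge> x0 \<Longrightarrow> (D has_real_derivative D' x) (at x)" "\<And>x. x \<ge> x0 \<Longrightarrow> D' x \<le> 0"
    and "(D \<longlongrightarrow> 0) at_top" "x \<ge> x0"
  shows "D x \<ge> 0"
proof (rule tendsto_le[OF trivial_limit_at_top_linorder tendsto_const assms(3)])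
  have "D y \<le> D x" if "y \<ge> x" for y
    by (rule DERIV_nonpos_imp_nonincreasing[OF that])
      (use assms(1,2,4) in \<open>meson order_trans\<close>)
  then show "\<forall>\<^sub>F y in at_top. D y \<le> D x" by (auto simp: eventually_at_top_linorder)
qed

text \<open>Each difference is monotone by comparison of derivatives and tends to \<open>0\<close>, hence has a sign.  The
  rates \<open>3/4\<close> and \<open>5/4\<close> leave room on both sides of the true rate \<open>1\<close> for the power of \<open>x\<close>.\<close>

lemma inc_Gamma_bounds:
  assumes "x0 > 0"
  obtains C c where "C > 0" "c > 0"
    "\<And>x. x \<ge> x0 \<Longrightarrow> inc_Gamma r x \<le> C * exp (- 3 / 4 * x)"
    "\<And>x. x \<ge> x0 \<Longrightarrow> c * exp (- 5 / 4 * x) \<le> inc_Gamma r x"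
proof -
  obtain A where A: "A > 0" "\<And>x. x \<ge> x0 \<Longrightarrow> x powr (r - 1) \<le> A * exp (1 / 4 * x)"
    using powr_le_exp[of "1/4" x0 "r - 1"] assms by auto
  obtain B where B: "B > 0" "\<And>x. x \<ge> x0 \<Longrightarrow> x powr (1 - r) \<le> B * exp (1 / 4 * x)"
    using powr_le_exp[of "1/4" x0 "1 - r"] assms by auto
  have B': "exp (- 1 / 4 * x) / B \<le> x powr (r - 1)" if "x \<ge> x0" for x
  proof -
    have "x powr (r - 1) * x powr (1 - r) = 1" using that assms by (simp add: powr_add[symmetric])
    moreover have "x powr (r - 1) * x powr (1 - r) \<le> x powr (r - 1) * (B * exp (1 / 4 * x))"
      by (intro mult_left_mono B that) simp
    ultimately have "1 \<le> x powr (r - 1) * (B * exp (1 / 4 * x))" by simp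
    then have "exp (- 1 / 4 * x) * 1 \<le> exp (- 1 / 4 * x) * (x powr (r - 1) * (B * exp (1 / 4 * x)))"
      by (intro mult_left_mono) auto
    also have "\<dots> = x powr (r - 1) * B" by (simp add: mult_exp_exp)
    finally show ?thesis using B(1) by (simp add: field_simps)
  qed
  show ?thesis
  proof (rule that[of "4 / 3 * A" "4 / 5 / B"])
    fix x assume x: "x \<ge> x0"
    have "0 \<le> 4 / 3 * A * exp (- 3 / 4 * x) - inc_Gamma r x"
    proof (rule nonneg_if_decreasing_to_0[OF _ _ _ x])
      fix y assume y: "y \<ge> x0"
      show "((\<lambda>x. 4 / 3 * A * exp (- 3 / 4 * x) - inc_Gamma r x) has_real_derivative
          - A * exp (- 3 / 4 * y) + exp (- y) * y powr (r - 1)) (at y)"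
        using y assms by (auto intro!: derivative_eq_intros inc_Gamma_deriv)
      have "exp (- y) * y powr (r - 1) \<le> exp (- y) * (A * exp (1 / 4 * y))"
        by (intro mult_left_mono A y) simp
      also have "\<dots> = A * exp (- 3 / 4 * y)" by (simp add: exp_add[symmetric])
      finally show "- A * exp (- 3 / 4 * y) + exp (- y) * y powr (r - 1) \<le> 0" by simp
    next
      have "((\<lambda>x. 4 / 3 * A * exp (- 3 / 4 * x)) \<longlongrightarrow> 0) at_top" by real_asymp
      from tendsto_diff[OF this inc_Gamma_tendsto_0[of r]]
      show "((\<lambda>x. 4 / 3 * A * exp (- 3 / 4 * x) - inc_Gamma r x) \<longlongrightarrow> 0) at_top" by simp
    qed
    then show "inc_Gamma r x \<le> 4 / 3 * A * exp (- 3 / 4 * x)" by simp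
    have "0 \<le> inc_Gamma r x - 4 / 5 / B * exp (- 5 / 4 * x)"
    proof (rule nonneg_if_decreasing_to_0[OF _ _ _ x])
      fix y assume y: "y \<ge> x0"
      show "((\<lambda>x. inc_Gamma r x - 4 / 5 / B * exp (- 5 / 4 * x)) has_real_derivative
          - (exp (- y) * y powr (r - 1)) + exp (- 5 / 4 * y) / B) (at y)"
        using y assms B(1) by (auto intro!: derivative_eq_intros inc_Gamma_deriv)
      have "exp (- 5 / 4 * y) / B = exp (- y) * (exp (- 1 / 4 * y) / B)" by (simp add: exp_add[symmetric])
      also have "\<dots> \<le> exp (- y) * y powr (r - 1)"
        by (intro mult_left_mono B' y) simp
      finally show "- (exp (- y) * y powr (r - 1)) + exp (- 5 / 4 * y) / B \<le> 0" by simp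
    next
      have "((\<lambda>x. 4 / 5 / B * exp (- 5 / 4 * x)) \<longlongrightarrow> 0) at_top" by real_asymp
      from tendsto_diff[OF inc_Gamma_tendsto_0[of r] this]
      show "((\<lambda>x. inc_Gamma r x - 4 / 5 / B * exp (- 5 / 4 * x)) \<longlongrightarrow> 0) at_top" by simp
    qed
    then show "4 / 5 / B * exp (- 5 / 4 * x) \<le> inc_Gamma r x" by simp
  qed (use A(1) B(1) in auto)
qed

section \<open>Fourier series of periodic functions on the line\<close>

definition echar :: "int \<Rightarrow> real \<Rightarrow> complex" where
  "echar n x = exp (2 * of_real pi * \<i> * of_int n * of_real x)"

lemma echar_mult: "echar m x * echar n x = echar (m + n) x"
  by (simp add: echar_def exp_add[symmetric] algebra_simps)

lemma echar_zero [simp]: "echar 0 x = 1" "echar n 0 = 1"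
  by (simp_all add: echar_def)

lemma norm_echar [simp]: "norm (echar n x) = 1"
  by (simp add: echar_def)

lemma cnj_echar: "cnj (echar n x) = echar (- n) x"
  by (simp add: echar_def exp_cnj)

lemma echar_add: "echar n (x + y) = echar n x * echar n y"
  by (simp add: echar_def exp_add[symmetric] algebra_simps)

lemma echar_one [simp]: "echar n 1 = 1"
  using exp_integer_2pi[of "of_int n"] by (simp add: echar_def mult_ac)

lemma echar_vector_derivative:
  "(echar n has_vector_derivative 2 * of_real pi * \<i> * of_int n * echar n x) (at x within S)"
  unfolding echar_def
  by (rule has_vector_derivative_real_field) (auto intro!: derivative_eq_intros simp: mult_ac)

lemma continuous_on_echar [continuous_intros]:
  assumes "continuous_on S f" shows "continuous_on S (\<lambda>x. echar n (f x))"
  unfolding echar_def by (intro continuous_intros assms)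

lemma integral_echar: "integral {0..1} (echar n) = (if n = 0 then 1 else 0)"
proof (cases "n = 0")
  case True
  then have "echar n = (\<lambda>_. 1)" by (intro ext) simp
  then show ?thesis using True by simp
next
  case False
  let ?c = "2 * of_real pi * \<i> * of_int n"
  have "((\<lambda>x. ?c * echar n x) has_integral (echar n 1 - echar n 0)) {0..1}"
    by (rule fundamental_theorem_of_calculus) (auto intro: echar_vector_derivative)
  then have "integral {0..1} (\<lambda>x. ?c * echar n x) = 0"
    by (rule integral_unique[THEN trans]) simp
  then have "?c * integral {0..1} (echar n) = 0" unfolding integral_mult_right .
  then show ?thesis using False by simp
qed

definition fourier_coeff :: "(real \<Rightarrow> complex) \<Rightarrow> int \<Rightarrow> complex" where
  "fourier_coeff g n = integral {0..1} (\<lambda>x. g x * echar (- n) x)"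

lemma integrable_on_unit_interval:
  "continuous_on {0..1} g \<Longrightarrow> g integrable_on {0..1 :: real}" for g :: "real \<Rightarrow> complex"
  by (rule integrable_continuous_real)

text \<open>With the partial Fourier sum \<open>S\<close> over \<open>F\<close>, the difference \<open>g - S\<close> is orthogonal to the characters
  in \<open>F\<close> and so to \<open>S\<close>; the inequality is \<open>0 \<le> \<integral> \<bar>g - S\<bar>\<^sup>2\<close>.\<close>

lemma Bessel_inequality:
  fixes g :: "real \<Rightarrow> complex"
  assumes g: "continuous_on {0..1} g" and F: "finite F"
  shows "(\<Sum>n\<in>F. (norm (fourier_coeff g n))\<^sup>2) \<le> integral {0..1} (\<lambda>x. (norm (g x))\<^sup>2)"
proof -
  define c where "c = fourier_coeff g"
  define S where "S x = (\<Sum>n\<in>F. c n * echar n x)" for x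
  have cS: "continuous_on {0..1} S" unfolding S_def by (intro continuous_intros)
  have orth: "integral {0..1} (\<lambda>x. (g x - S x) * echar (- m) x) = 0" if m: "m \<in> F" for m
  proof -
    have "integral {0..1} (\<lambda>x. S x * echar (- m) x) = integral {0..1} (\<lambda>x. \<Sum>n\<in>F. c n * echar (n - m) x)"
      unfolding S_def sum_distrib_right by (simp add: mult.assoc echar_mult)
    also have "\<dots> = (\<Sum>n\<in>F. c n * integral {0..1} (echar (n - m)))"
      by (subst integral_sum[OF F]) (auto intro!: integrable_on_unit_interval continuous_intros)
    also have "\<dots> = (\<Sum>n\<in>F. if n = m then c n else 0)" by (rule sum.cong) (auto simp: integral_echar)
    also have "\<dots> = c m" using F m by simp
    finally have *: "integral {0..1} (\<lambda>x. S x * echar (- m) x) = c m" .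
    have "integral {0..1} (\<lambda>x. (g x - S x) * echar (- m) x)
        = integral {0..1} (\<lambda>x. g x * echar (- m) x) - integral {0..1} (\<lambda>x. S x * echar (- m) x)"
      unfolding left_diff_distrib
      by (rule integral_diff) (intro integrable_on_unit_interval continuous_intros g cS)+
    then show ?thesis unfolding * by (simp add: c_def fourier_coeff_def)
  qed
  have "integral {0..1} (\<lambda>x. (g x - S x) * cnj (S x)) = integral {0..1} (\<lambda>x. \<Sum>m\<in>F. cnj (c m) * ((g x - S x) * echar (- m) x))"
    unfolding S_def cnj_sum sum_distrib_left by (simp add: cnj_echar mult_ac)
  also have "\<dots> = (\<Sum>m\<in>F. cnj (c m) * integral {0..1} (\<lambda>x. (g x - S x) * echar (- m) x))"
    by (subst integral_sum[OF F]) (auto intro!: integrable_on_unit_interval continuous_intros g cS)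
  also have "\<dots> = 0" by (simp add: orth)
  finally have 1: "integral {0..1} (\<lambda>x. (g x - S x) * cnj (S x)) = 0" .
  have 2: "integral {0..1} (\<lambda>x. S x * cnj (g x)) = (\<Sum>n\<in>F. c n * cnj (c n))"
  proof -
    have "integral {0..1} (\<lambda>x. S x * cnj (g x)) = integral {0..1} (\<lambda>x. \<Sum>n\<in>F. c n * (echar n x * cnj (g x)))"
      by (simp add: S_def sum_distrib_right mult.assoc)
    also have "\<dots> = (\<Sum>n\<in>F. c n * integral {0..1} (\<lambda>x. echar n x * cnj (g x)))"
      by (subst integral_sum[OF F]) (auto intro!: integrable_on_unit_interval continuous_intros g)
    also have "\<dots> = (\<Sum>n\<in>F. c n * cnj (c n))"
      unfolding c_def fourier_coeff_def integral_cnj by (simp add: cnj_echar mult.commute)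
    finally show ?thesis .
  qed
  have "complex_of_real (integral {0..1} (\<lambda>x. (norm (g x - S x))\<^sup>2))
      = integral {0..1} (\<lambda>x. (g x - S x) * cnj (g x - S x))"
    unfolding complex_norm_square[symmetric]
    by (rule sym, rule integral_unique, rule has_integral_of_real, rule integrable_integral,
        intro integrable_continuous_real continuous_intros g cS)
  also have "\<dots> = integral {0..1} (\<lambda>x. (g x * cnj (g x) - S x * cnj (g x)) - (g x - S x) * cnj (S x))"
    by (simp add: algebra_simps)
  also have "\<dots> = integral {0..1} (\<lambda>x. g x * cnj (g x) - S x * cnj (g x)) - integral {0..1} (\<lambda>x. (g x - S x) * cnj (S x))"
    by (rule integral_diff) (intro integrable_on_unit_interval continuous_intros g cS)+
  also have "\<dots> = integral {0..1} (\<lambda>x. g x * cnj (g x)) - integral {0..1} (\<lambda>x. S x * cnj (g x))"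
    unfolding 1 by (simp, rule integral_diff) (intro integrable_on_unit_interval continuous_intros g cS)+
  also have "integral {0..1} (\<lambda>x. g x * cnj (g x)) = complex_of_real (integral {0..1} (\<lambda>x. (norm (g x))\<^sup>2))"
    unfolding complex_norm_square[symmetric]
    by (rule integral_unique, rule has_integral_of_real, rule integrable_integral,
        intro integrable_continuous_real continuous_intros g cS)
  also have "integral {0..1} (\<lambda>x. S x * cnj (g x)) = complex_of_real (\<Sum>n\<in>F. (norm (c n))\<^sup>2)"
    unfolding 2 by (simp add: complex_norm_square[symmetric])
  finally have "integral {0..1} (\<lambda>x. (norm (g x - S x))\<^sup>2)
      = integral {0..1} (\<lambda>x. (norm (g x))\<^sup>2) - (\<Sum>n\<in>F. (norm (c n))\<^sup>2)"
    unfolding of_real_diff[symmetric] of_real_eq_iff .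
  moreover have "0 \<le> integral {0..1} (\<lambda>x. (norm (g x - S x))\<^sup>2)"
    by (rule integral_nonneg) (intro integrable_continuous_real continuous_intros g cS, simp)
  ultimately show ?thesis by (simp add: c_def)
qed

text \<open>Bessel's inequality bounds the partial sums of the squared coefficients along \<open>\<nu>\<close>.\<close>

lemma Riemann_Lebesgue:
  fixes g :: "real \<Rightarrow> complex" and \<nu> :: "nat \<Rightarrow> int"
  assumes g: "continuous_on {0..1} g" and \<nu>: "inj \<nu>"
  shows "(\<lambda>N. fourier_coeff g (\<nu> N)) \<longlonglongrightarrow> 0"
proof -
  have "summable (\<lambda>N. (norm (fourier_coeff g (\<nu> N)))\<^sup>2)"
  proof (rule summableI_nonneg_bounded)
    fix N
    show "(\<Sum>i<N. (norm (fourier_coeff g (\<nu> i)))\<^sup>2) \<le> integral {0..1} (\<lambda>x. (norm (g x))\<^sup>2)"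
      using Bessel_inequality[OF g, of "\<nu> ` {..<N}"] inj_on_subset[OF \<nu>, of "{..<N}"]
      by (simp add: sum.reindex)
  qed simp
  then have "(\<lambda>N. sqrt ((norm (fourier_coeff g (\<nu> N)))\<^sup>2)) \<longlonglongrightarrow> sqrt 0"
    by (intro tendsto_real_sqrt summable_LIMSEQ_zero)
  then show ?thesis by (simp add: tendsto_norm_zero_iff)
qed

text \<open>For an antiderivative \<open>G\<close> of \<open>h\<close> the integral is \<open>G (x + 1) - G x\<close>, which has derivative
  \<open>h (x + 1) - h x = 0\<close> in \<open>x\<close>.\<close>

lemma integral_periodic_shift:
  fixes h :: "real \<Rightarrow> complex"
  assumes h: "continuous_on UNIV h" and per: "\<And>x. h (x + 1) = h x"
  shows "integral {0..1} (\<lambda>t. h (x + t)) = integral {0..1} h"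
proof -
  \<comment> \<open>an interval whose interior contains both unit intervals starting at \<open>0\<close> and at \<open>x\<close>\<close>
  define a b where "a = - \<bar>x\<bar> - 1" and "b = \<bar>x\<bar> + 3"
  obtain G where G: "\<And>t. t \<in> {a..b} \<Longrightarrow> (G has_vector_derivative h t) (at t within {a..b})"
    using antiderivative_continuous[of a b h] continuous_on_subset[OF h] by auto
  have Gs: "((\<lambda>t. G (c + t)) has_vector_derivative h (c + t)) (at t within T)"
    if "c + t \<in> {a<..<b}" for c t T
  proof -
    have "(G has_vector_derivative h (c + t)) (at (c + t))"
      using G[of "c + t"] that at_within_Icc_at[of a "c + t" b] by simp
    moreover have "((\<lambda>t. c + t) has_vector_derivative 1) (at t)"
      by (auto intro!: derivative_eq_intros)
    ultimately show ?thesis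
      using vector_diff_chain_at[of "\<lambda>t. c + t" 1 t G "h (c + t)"]
      by (simp add: o_def has_vector_derivative_at_within)
  qed
  have per_int: "integral {0..1} (\<lambda>t. h (c + t)) = G (c + 1) - G c" if "c \<in> {- \<bar>x\<bar>..\<bar>x\<bar>}" for c
  proof -
    have "((\<lambda>t. h (c + t)) has_integral (G (c + 1) - G (c + 0))) {0..1}"
      by (rule fundamental_theorem_of_calculus, simp, rule Gs) (use that in \<open>auto simp: a_def b_def\<close>)
    then show ?thesis by (simp add: integral_unique)
  qed
  have "\<exists>k. \<forall>c\<in>{- \<bar>x\<bar>..\<bar>x\<bar>}. G (c + 1) - G c = k"
  proof (rule has_derivative_zero_constant)
    fix c assume c: "c \<in> {- \<bar>x\<bar>..\<bar>x\<bar>}"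
    have "((\<lambda>t. G (1 + t) - G (0 + t)) has_vector_derivative (h (1 + c) - h (0 + c))) (at c within {- \<bar>x\<bar>..\<bar>x\<bar>})"
      by (intro derivative_intros Gs) (use c in \<open>auto simp: a_def b_def\<close>)
    then show "((\<lambda>c. G (c + 1) - G c) has_derivative (\<lambda>h. 0)) (at c within {- \<bar>x\<bar>..\<bar>x\<bar>})"
      using per[of c] by (simp add: has_vector_derivative_def add.commute)
  qed simp
  then have "G (x + 1) - G x = G (0 + 1) - G 0" by (metis abs_ge_minus_self abs_ge_self abs_ge_zero atLeastAtMost_iff minus_le_iff neg_le_0_iff_le)
  then show ?thesis using per_int[of x] per_int[of 0] by (auto simp: abs_le_iff abs_ge_self minus_le_iff)
qed

lemma vector_derivative_slope_at_0:
  fixes \<phi> :: "real \<Rightarrow> complex"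
  assumes "(\<phi> has_vector_derivative \<phi>') (at 0)"
  shows "((\<lambda>x. (\<phi> x - \<phi> 0) / of_real x) \<longlongrightarrow> \<phi>') (at 0)"
proof -
  have "((\<lambda>x. norm (\<phi> x - \<phi> 0 - x *\<^sub>R \<phi>') / norm x) \<longlongrightarrow> 0) (at 0)"
    using assms by (simp add: has_vector_derivative_def has_derivative_at)
  then have "((\<lambda>x. norm ((\<phi> x - \<phi> 0) / of_real x - \<phi>')) \<longlongrightarrow> 0) (at 0)"
  proof (rule Lim_transform_eventually)
    have "norm (\<phi> x - \<phi> 0 - x *\<^sub>R \<phi>') / norm x = norm ((\<phi> x - \<phi> 0) / of_real x - \<phi>')" if "x \<noteq> 0" for x
    proof -
      have "(\<phi> x - \<phi> 0) / of_real x - \<phi>' = (\<phi> x - \<phi> 0 - x *\<^sub>R \<phi>') / of_real x"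
        using that by (simp add: diff_divide_distrib scaleR_conv_of_real)
      then show ?thesis by (simp add: norm_divide)
    qed
    then show "\<forall>\<^sub>F x in at 0. norm (\<phi> x - \<phi> 0 - x *\<^sub>R \<phi>') / norm x = norm ((\<phi> x - \<phi> 0) / of_real x - \<phi>')"
      by (auto simp: eventually_at_filter)
  qed
  then show ?thesis by (simp add: tendsto_norm_zero_iff LIM_zero_iff)
qed

text \<open>Chernoff's argument.  Since \<open>\<phi> - \<phi> 0 = \<psi> (echar 1 - 1)\<close> with a continuous \<open>\<psi>\<close>, the coefficients of
  \<open>\<phi>\<close> are consecutive differences of those of \<open>\<psi>\<close>, apart from the constant \<open>\<phi> 0\<close> at \<open>n = 0\<close>.  The
  symmetric partial sums telescope, and the two remaining terms tend to \<open>0\<close> by Riemann-Lebesgue.\<close>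

lemma fourier_partial_sums_at_0:
  fixes \<phi> :: "real \<Rightarrow> complex"
  assumes c: "continuous_on UNIV \<phi>" and per: "\<And>x. \<phi> (x + 1) = \<phi> x"
    and d: "(\<phi> has_vector_derivative \<phi>') (at 0)"
  shows "(\<lambda>N. \<Sum>n=- int N..int N. fourier_coeff \<phi> n) \<longlonglongrightarrow> \<phi> 0"
proof -
  \<comment> \<open>at the integers the quotient is replaced by its limit\<close>
  define \<psi> where "\<psi> x = (if x \<in> \<int> then \<phi>' / (2 * of_real pi * \<i>) else (\<phi> x - \<phi> 0) / (echar 1 x - 1))" for x
  have e1: "echar 1 x = 1 \<longleftrightarrow> x \<in> \<int>" for x
  proof -
    have "echar 1 x = 1 \<longleftrightarrow> (\<exists>n::int. 2 * pi * x = of_int (2 * n) * pi)"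
      unfolding echar_def exp_eq_1 by simp
    also have "\<dots> \<longleftrightarrow> x \<in> \<int>" by (auto simp: Ints_def mult_ac)
    finally show ?thesis .
  qed
  have \<psi>per: "\<psi> (1 + x) = \<psi> x" for x
  proof -
    have "1 + x \<in> \<int> \<longleftrightarrow> x \<in> \<int>" by (metis Ints_1 Ints_add Ints_diff add_diff_cancel_left')
    then show ?thesis using per[of x] by (simp add: \<psi>_def echar_add add.commute)
  qed
  have cont0: "isCont \<psi> 0"
  proof -
    have 1: "((\<lambda>x. (\<phi> x - \<phi> 0) / of_real x) \<longlongrightarrow> \<phi>') (at 0)"
      by (rule vector_derivative_slope_at_0[OF d])
    have 2: "((\<lambda>x. (echar 1 x - echar 1 0) / of_real x) \<longlongrightarrow> 2 * of_real pi * \<i> * of_int 1 * echar 1 0) (at 0)"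
      by (rule vector_derivative_slope_at_0[OF echar_vector_derivative])
    have "((\<lambda>x. ((\<phi> x - \<phi> 0) / of_real x) / ((echar 1 x - echar 1 0) / of_real x)) \<longlongrightarrow> \<psi> 0) (at 0)"
      using tendsto_divide[OF 1 2] by (simp add: \<psi>_def)
    then have "(\<psi> \<longlongrightarrow> \<psi> 0) (at 0)"
    proof (rule Lim_transform_eventually)
      have "((\<phi> x - \<phi> 0) / of_real x) / ((echar 1 x - echar 1 0) / of_real x) = \<psi> x"
        if "x \<noteq> 0" "\<bar>x\<bar> < 1" for x
      proof -
        have "x \<notin> \<int>" using that by (auto elim!: Ints_cases)
        then show ?thesis using that by (simp add: \<psi>_def)
      qed
      then show "\<forall>\<^sub>F x in at 0. ((\<phi> x - \<phi> 0) / of_real x) / ((echar 1 x - echar 1 0) / of_real x) = \<psi> x"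
        unfolding eventually_at by (intro exI[of _ 1]) auto
    qed
    then show ?thesis by (simp add: isCont_def)
  qed
  have "isCont \<psi> x" if x: "x \<in> {0..1}" for x
  proof -
    consider "x = 0" | "x = 1" | "0 < x" "x < 1" using x by fastforce
    then show ?thesis
    proof cases
      case 2
      have "isCont (\<lambda>y. \<psi> (-1 + y)) 1" by (rule continuous_at_compose[unfolded o_def, of 1 "\<lambda>y. -1 + y" \<psi>]) (use cont0 in auto)
      moreover have "\<psi> (-1 + y) = \<psi> y" for y using \<psi>per[of "-1 + y"] by simp
      ultimately show ?thesis using 2 by simp
    next
      case 3
      have ni: "y \<notin> \<int>" if "y \<in> {0<..<1}" for y :: real
      proof
        assume "y \<in> \<int>"
        then obtain z :: int where z: "y = of_int z" by (rule Ints_cases)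
        have "of_int 0 < (of_int z :: real)" "of_int z < (of_int 1 :: real)" using that z by auto
        then have "0 < z" "z < 1" by (simp_all only: of_int_less_iff)
        then show False by simp
      qed
      have "continuous_on {0<..<1} (\<lambda>y. (\<phi> y - \<phi> 0) / (echar 1 y - 1))"
        by (intro continuous_intros continuous_on_subset[OF c]) (use ni e1 in auto)
      then have "continuous_on {0<..<1} \<psi>"
        by (rule continuous_on_eq) (use ni in \<open>simp add: \<psi>_def\<close>)
      then show ?thesis using 3 by (simp add: continuous_on_eq_continuous_at)
    qed (use cont0 in simp)
  qed
  then have \<psi>c: "continuous_on {0..1} \<psi>" by (intro continuous_at_imp_continuous_on) auto
  have rel: "\<phi> x = \<phi> 0 + \<psi> x * (echar 1 x - 1)" if "x \<in> {0..1}" for x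
  proof (cases "x \<in> \<int>")
    case True
    then have "x = 0 \<or> x = 1" using that by (auto elim!: Ints_cases)
    then show ?thesis using per[of 0] by auto
  next
    case False
    then show ?thesis using e1[of x] by (simp add: \<psi>_def)
  qed
  have step: "fourier_coeff \<phi> n = (if n = 0 then \<phi> 0 else 0) + (fourier_coeff \<psi> (n - 1) - fourier_coeff \<psi> n)" for n
  proof -
    have "fourier_coeff \<phi> n = integral {0..1} (\<lambda>x. \<phi> 0 * echar (- n) x + (\<psi> x * echar (- (n - 1)) x - \<psi> x * echar (- n) x))"
      unfolding fourier_coeff_def
    proof (rule integral_cong)
      fix x :: real assume "x \<in> {0..1}"
      have "echar (- (n - 1)) x = echar 1 x * echar (- n) x" by (simp add: echar_mult)
      then show "\<phi> x * echar (- n) x = \<phi> 0 * echar (- n) x + (\<psi> x * echar (- (n - 1)) x - \<psi> x * echar (- n) x)"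
        unfolding rel[OF \<open>x \<in> {0..1}\<close>] by (simp add: algebra_simps)
    qed
    also have "\<dots> = integral {0..1} (\<lambda>x. \<phi> 0 * echar (- n) x)
        + integral {0..1} (\<lambda>x. \<psi> x * echar (- (n - 1)) x - \<psi> x * echar (- n) x)"
      by (rule integral_add) (intro integrable_on_unit_interval continuous_intros \<psi>c)+
    also have "integral {0..1} (\<lambda>x. \<psi> x * echar (- (n - 1)) x - \<psi> x * echar (- n) x) = fourier_coeff \<psi> (n - 1) - fourier_coeff \<psi> n"
      unfolding fourier_coeff_def by (rule integral_diff) (intro integrable_on_unit_interval continuous_intros \<psi>c)+
    also have "integral {0..1} (\<lambda>x. \<phi> 0 * echar (- n) x) = (if n = 0 then \<phi> 0 else 0)"
      using integral_echar[of "- n"] by simp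
    finally show ?thesis .
  qed
  have sum: "(\<Sum>n=- int N..int N. fourier_coeff \<phi> n) = \<phi> 0 + (fourier_coeff \<psi> (- int N - 1) - fourier_coeff \<psi> (int N))" for N
  proof (induction N)
    case 0
    show ?case using step[of 0] by simp
  next
    case (Suc N)
    have "{- int (Suc N)..int (Suc N)} = insert (- int (Suc N)) (insert (int (Suc N)) {- int N..int N})" by auto
    then have "(\<Sum>n=- int (Suc N)..int (Suc N). fourier_coeff \<phi> n)
        = fourier_coeff \<phi> (- int (Suc N)) + (fourier_coeff \<phi> (int (Suc N)) + (\<Sum>n=- int N..int N. fourier_coeff \<phi> n))"
      by simp
    moreover have "fourier_coeff \<psi> (- int (Suc N)) = fourier_coeff \<psi> (- int N - 1)"
      "fourier_coeff \<psi> (int (Suc N) - 1) = fourier_coeff \<psi> (int N)"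
      by (rule arg_cong[where f = "fourier_coeff \<psi>"], simp)+
    ultimately show ?case
      unfolding Suc step[of "- int (Suc N)"] step[of "int (Suc N)"] by simp
  qed
  have "(\<lambda>N. \<phi> 0 + (fourier_coeff \<psi> (- int N - 1) - fourier_coeff \<psi> (int N))) \<longlonglongrightarrow> \<phi> 0 + (0 - 0)"
    by (intro tendsto_intros Riemann_Lebesgue[OF \<psi>c]) (auto simp: inj_def)
  then show ?thesis unfolding sum by simp
qed

text \<open>Translation moves the point to \<open>0\<close> and multiplies the coefficients by characters.  Absolute
  summability upgrades the convergence of the symmetric partial sums to that of the unordered sum.\<close>

lemma fourier_inversion:
  fixes \<phi> :: "real \<Rightarrow> complex"
  assumes c: "continuous_on UNIV \<phi>" and per: "\<And>x. \<phi> (x + 1) = \<phi> x"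
    and d: "(\<phi> has_vector_derivative \<phi>') (at x)"
    and s: "(\<lambda>n. norm (fourier_coeff \<phi> n)) summable_on UNIV"
  shows "((\<lambda>n. fourier_coeff \<phi> n * echar n x) has_sum \<phi> x) UNIV"
proof -
  define \<phi>x where "\<phi>x t = \<phi> (x + t)" for t
  have coeff: "fourier_coeff \<phi>x n = fourier_coeff \<phi> n * echar n x" for n
  proof -
    have "fourier_coeff \<phi>x n = integral {0..1} (\<lambda>t. (\<phi> (x + t) * echar (- n) (x + t)) * echar n x)"
      unfolding fourier_coeff_def \<phi>x_def
    proof (rule integral_cong)
      fix t :: real
      have "echar (- n) x * echar n x = 1" by (simp add: echar_mult)
      then show "\<phi> (x + t) * echar (- n) t = \<phi> (x + t) * echar (- n) (x + t) * echar n x"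
        by (simp add: echar_add mult_ac)
    qed
    also have "\<dots> = integral {0..1} (\<lambda>t. \<phi> (x + t) * echar (- n) (x + t)) * echar n x"
      by (rule integral_mult_left)
    also have "integral {0..1} (\<lambda>t. \<phi> (x + t) * echar (- n) (x + t)) = fourier_coeff \<phi> n"
      unfolding fourier_coeff_def
      by (rule integral_periodic_shift[where h = "\<lambda>t. \<phi> t * echar (- n) t"])
        (auto intro!: continuous_intros c simp: per echar_add)
    finally show ?thesis .
  qed
  have "(\<lambda>N. \<Sum>n=- int N..int N. fourier_coeff \<phi>x n) \<longlonglongrightarrow> \<phi>x 0"
  proof (rule fourier_partial_sums_at_0)
    show "continuous_on UNIV \<phi>x" unfolding \<phi>x_def
      by (intro continuous_on_compose2[OF c] continuous_intros) auto
    show "\<phi>x (t + 1) = \<phi>x t" for t unfolding \<phi>x_def using per[of "x + t"] by (simp add: add_ac)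
    have "((\<lambda>t. x + t) has_vector_derivative 1) (at 0)"
      by (auto intro!: derivative_eq_intros)
    then show "(\<phi>x has_vector_derivative \<phi>') (at 0)"
      using vector_diff_chain_at[of "\<lambda>t. x + t" 1 0 \<phi> \<phi>'] d by (simp add: \<phi>x_def[abs_def] o_def)
  qed
  then have 1: "(\<lambda>N. \<Sum>n=- int N..int N. fourier_coeff \<phi> n * echar n x) \<longlonglongrightarrow> \<phi> x"
    by (simp add: coeff \<phi>x_def)
  have "(\<lambda>n. norm (fourier_coeff \<phi> n * echar n x)) summable_on UNIV"
    using s by (simp add: norm_mult)
  then have "(\<lambda>n. fourier_coeff \<phi> n * echar n x) summable_on UNIV" by (rule abs_summable_summable)
  then obtain S where S: "((\<lambda>n. fourier_coeff \<phi> n * echar n x) has_sum S) UNIV"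
    by (auto simp: summable_on_def)
  have "filterlim (\<lambda>N. {- int N..int N}) (finite_subsets_at_top UNIV) sequentially"
    unfolding filterlim_iff eventually_finite_subsets_at_top
  proof (intro allI impI, elim exE conjE)
    fix P and X :: "int set"
    assume X: "finite X" and P: "\<forall>Y. finite Y \<and> X \<subseteq> Y \<and> Y \<subseteq> UNIV \<longrightarrow> P Y"
    have "\<exists>M. \<forall>n\<in>X. \<bar>n\<bar> \<le> int M"
    proof -
      have "\<bar>n\<bar> \<le> int (\<Sum>m\<in>X. nat \<bar>m\<bar>)" if "n \<in> X" for n
      proof -
        have "nat \<bar>n\<bar> \<le> (\<Sum>m\<in>X. nat \<bar>m\<bar>)" using X that by (rule member_le_sum[rotated 2]) auto
        then show ?thesis by linarith
      qed
      then show ?thesis by blast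
    qed
    then obtain M where M: "\<And>n. n \<in> X \<Longrightarrow> \<bar>n\<bar> \<le> int M" by blast
    show "\<forall>\<^sub>F N in sequentially. P {- int N..int N}"
      unfolding eventually_sequentially
    proof (intro exI[of _ M] allI impI)
      fix N assume "M \<le> N"
      have "X \<subseteq> {- int N..int N}"
      proof
        fix n assume "n \<in> X"
        from M[OF this] \<open>M \<le> N\<close> show "n \<in> {- int N..int N}" by (simp add: abs_le_iff)
      qed
      then show "P {- int N..int N}" using P by blast
    qed
  qed
  with S have "(\<lambda>N. \<Sum>n=- int N..int N. fourier_coeff \<phi> n * echar n x) \<longlonglongrightarrow> S"
    unfolding has_sum_def by (rule filterlim_compose)
  with 1 have "S = \<phi> x" by (metis LIMSEQ_unique)
  with S show ?thesis by simp
qed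

lemma fourier_coeff_of_series:
  fixes \<phi> :: "real \<Rightarrow> complex"
  assumes c: "continuous_on {0..1} \<phi>" and s: "(\<lambda>n. norm (\<gamma> n)) summable_on (UNIV :: int set)"
    and sum: "\<And>x. x \<in> {0..1} \<Longrightarrow> ((\<lambda>n. \<gamma> n * echar n x) has_sum \<phi> x) UNIV"
  shows "fourier_coeff \<phi> m = \<gamma> m"
proof -
  have cs: "set_integrable lborel {0..1} h" if "continuous_on {0..1} h" for h :: "real \<Rightarrow> complex"
    using that by (rule borel_integrable_compact[OF compact_Icc, unfolded set_integrable_def[symmetric]])
  have e: "(LINT x:{0..1}|lborel. h x) = integral {0..1} h" if "continuous_on {0..1} h" for h :: "real \<Rightarrow> complex"
    by (rule set_borel_integral_eq_integral(2)[OF cs[OF that]])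
  have "((\<lambda>n. LINT x:{0..1}|lborel. \<gamma> n * echar (n - m) x) has_sum
      (LINT x:{0..1}|lborel. \<phi> x * echar (- m) x)) UNIV"
  proof (rule has_sum_set_integral(2)[where \<gamma> = "\<lambda>n. norm (\<gamma> n)" and g = "\<lambda>_. 1"])
    show "((\<lambda>n. \<gamma> n * echar (n - m) x) has_sum \<phi> x * echar (- m) x) UNIV" if "x \<in> {0..1}" for x
      using has_sum_cmult_left[OF sum[OF that], of "echar (- m) x"] by (simp add: mult.assoc echar_mult)
    show "set_integrable lborel {0..1} (\<lambda>x. \<gamma> n * echar (n - m) x)" for n
      by (intro cs continuous_intros)
    show "set_integrable lborel {0..1} (\<lambda>_ :: real. 1 :: real)"
      unfolding set_integrable_def by (rule borel_integrable_compact) auto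
  qed (use s in \<open>simp_all add: norm_mult\<close>)
  moreover have "(LINT x:{0..1}|lborel. \<gamma> n * echar (n - m) x) = (if n = m then \<gamma> m else 0)" for n
    by (subst e) (auto intro!: continuous_intros simp: integral_echar)
  ultimately have "((\<lambda>n. if n = m then \<gamma> m else 0) has_sum integral {0..1} (\<lambda>x. \<phi> x * echar (- m) x)) UNIV"
    by (subst (asm) e) (auto intro!: continuous_intros c)
  moreover have "((\<lambda>n. if n = m then \<gamma> m else 0) has_sum \<gamma> m) UNIV"
    using has_sum_cong_neutral[of UNIV "{m}" "\<lambda>n. if n = m then \<gamma> m else 0" "\<lambda>n. \<gamma> m" "\<gamma> m"]
      has_sum_finite[of "{m}" "\<lambda>n. \<gamma> m"] by simp
  ultimately show ?thesis unfolding fourier_coeff_def by (rule has_sum_unique)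
qed

section \<open>Fourier coefficients along horizontal lines\<close>

text \<open>The properties that a harmonic Maass form shares with its derivative \<open>d_zbar f\<close>; the lemmas
  on Fourier coefficients are applied to both.\<close>

definition C1_periodic :: "(complex \<Rightarrow> complex) \<Rightarrow> bool" where
  "C1_periodic g \<longleftrightarrow>
     (\<forall>z\<in>upper_half_plane. g differentiable (at z)) \<and>
     continuous_on upper_half_plane (dx g) \<and> continuous_on upper_half_plane (dy g) \<and>
     (\<forall>z\<in>upper_half_plane. g (z + 1) = g z)"

lemma open_upper_half_plane: "open upper_half_plane"
  unfolding upper_half_plane_def by (rule open_halfspace_Im_gt)

lemma Complex_in_upper [simp]: "Complex x y \<in> upper_half_plane \<longleftrightarrow> y > 0"
  by (simp add: upper_half_plane_def)

lemma continuous_on_Complex_comp [continuous_intros]: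
  assumes "continuous_on S a" "continuous_on S b"
  shows "continuous_on S (\<lambda>t. Complex (a t) (b t))"
  unfolding Complex_eq by (intro continuous_intros assms)

lemma horizontal_derivative:
  assumes "g differentiable (at (Complex x y))"
  shows "((\<lambda>x. g (Complex x y)) has_vector_derivative dx g (Complex x y)) (at x within S)"
proof -
  let ?D = "frechet_derivative g (at (Complex x y))"
  have g: "(g has_derivative ?D) (at (Complex x y))"
    using assms by (simp add: frechet_derivative_works)
  have l: "linear ?D" using has_derivative_linear[OF g] .
  have *: "((\<lambda>x. Complex x y) has_derivative (\<lambda>h. h *\<^sub>R 1)) (at x within S)"
    unfolding Complex_eq by (auto intro!: derivative_eq_intros simp: scaleR_conv_of_real)
  have "((\<lambda>x. g (Complex x y)) has_derivative (\<lambda>h. ?D (h *\<^sub>R 1))) (at x within S)"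
    by (rule has_derivative_compose[OF * g])
  then show ?thesis
    unfolding has_vector_derivative_def dx_def by (simp add: linear_scale[OF l])
qed

lemma vertical_derivative:
  assumes "g differentiable (at (Complex x y))"
  shows "((\<lambda>y. g (Complex x y)) has_vector_derivative dy g (Complex x y)) (at y within S)"
proof -
  let ?D = "frechet_derivative g (at (Complex x y))"
  have g: "(g has_derivative ?D) (at (Complex x y))"
    using assms by (simp add: frechet_derivative_works)
  have l: "linear ?D" using has_derivative_linear[OF g] .
  have *: "((\<lambda>y. Complex x y) has_derivative (\<lambda>h. h *\<^sub>R \<i>)) (at y within S)"
    unfolding Complex_eq by (auto intro!: derivative_eq_intros simp: scaleR_conv_of_real mult.commute)
  have "((\<lambda>y. g (Complex x y)) has_derivative (\<lambda>h. ?D (h *\<^sub>R \<i>))) (at y within S)"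
    by (rule has_derivative_compose[OF * g])
  then show ?thesis
    unfolding has_vector_derivative_def dy_def by (simp add: linear_scale[OF l])
qed

context
  fixes g :: "complex \<Rightarrow> complex"
  assumes g: "C1_periodic g"
begin

lemma C1_diff: "y > 0 \<Longrightarrow> g differentiable (at (Complex x y))"
  using g by (simp add: C1_periodic_def)

lemma C1_continuous: "continuous_on upper_half_plane g"
  using g unfolding C1_periodic_def
  by (intro continuous_at_imp_continuous_on ballI differentiable_imp_continuous_within) auto

lemma C1_continuous_line:
  assumes "y > 0" shows "continuous_on S (\<lambda>x. g (Complex x y))"
  by (rule continuous_on_compose2[OF C1_continuous]) (use assms in \<open>auto intro!: continuous_intros\<close>)

lemma C1_continuous_line_dx:
  assumes "y > 0" shows "continuous_on S (\<lambda>x. dx g (Complex x y))"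
  by (rule continuous_on_compose2[of upper_half_plane]) (use assms g in \<open>auto simp: C1_periodic_def intro!: continuous_intros\<close>)

lemma C1_continuous_line_dy:
  assumes "y > 0" shows "continuous_on S (\<lambda>x. dy g (Complex x y))"
  by (rule continuous_on_compose2[of upper_half_plane]) (use assms g in \<open>auto simp: C1_periodic_def intro!: continuous_intros\<close>)

lemma C1_line_periodic: "y > 0 \<Longrightarrow> g (Complex (x + 1) y) = g (Complex x y)"
proof -
  assume "y > 0"
  then have "g (Complex x y + 1) = g (Complex x y)" using g by (simp add: C1_periodic_def)
  moreover have "Complex x y + 1 = Complex (x + 1) y" by (simp add: complex_eq_iff)
  ultimately show ?thesis by simp
qed

text \<open>Integration by parts over one period.\<close>

lemma fourier_coeff_dx:
  assumes y: "y > 0"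
  shows "fourier_coeff (\<lambda>x. dx g (Complex x y)) n
    = 2 * of_real pi * \<i> * of_int n * fourier_coeff (\<lambda>x. g (Complex x y)) n"
proof -
  let ?c = "2 * of_real pi * \<i> * of_int n"
  let ?G = "\<lambda>x. g (Complex x y) * echar (- n) x"
  have "((\<lambda>x. g (Complex x y) * (2 * of_real pi * \<i> * of_int (- n) * echar (- n) x)
      + dx g (Complex x y) * echar (- n) x) has_integral (?G 1 - ?G 0)) {0..1}"
    by (rule fundamental_theorem_of_calculus, simp,
        rule has_vector_derivative_mult[OF horizontal_derivative[OF C1_diff[OF y]] echar_vector_derivative])
  moreover have "?G 1 = ?G 0" using C1_line_periodic[OF y, of 0] by simp
  ultimately have "integral {0..1} (\<lambda>x. g (Complex x y) * (2 * of_real pi * \<i> * of_int (- n) * echar (- n) x)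
      + dx g (Complex x y) * echar (- n) x) = 0"
    by (simp add: integral_unique)
  then have "0 = integral {0..1} (\<lambda>x. dx g (Complex x y) * echar (- n) x - ?c * ?G x)"
    by (simp add: algebra_simps)
  also have "\<dots> = integral {0..1} (\<lambda>x. dx g (Complex x y) * echar (- n) x) - integral {0..1} (\<lambda>x. ?c * ?G x)"
    by (rule integral_diff) (intro integrable_on_unit_interval continuous_intros C1_continuous_line C1_continuous_line_dx y)+
  finally show ?thesis unfolding fourier_coeff_def integral_mult_right by simp
qed

lemma fourier_coeff_dy:
  assumes y: "y > 0"
  shows "((\<lambda>y. fourier_coeff (\<lambda>x. g (Complex x y)) n) has_vector_derivative
    fourier_coeff (\<lambda>x. dy g (Complex x y)) n) (at y)"
proof -
  have "((\<lambda>y. integral (cbox 0 1) (\<lambda>x. g (Complex x y) * echar (- n) x)) has_vector_derivative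
      integral (cbox 0 1) (\<lambda>x. dy g (Complex x y) * echar (- n) x)) (at y within {0<..})"
  proof (rule leibniz_rule_vector_derivative[where U = "{0<..}"])
    fix v x :: real assume "v \<in> {0<..}"
    then show "((\<lambda>y. g (Complex x y) * echar (- n) x) has_vector_derivative dy g (Complex x v) * echar (- n) x)
        (at v within {0<..})"
      by (intro has_vector_derivative_mult_left vertical_derivative C1_diff) auto
  next
    fix v :: real assume "v \<in> {0<..}"
    then show "(\<lambda>x. g (Complex x v) * echar (- n) x) integrable_on cbox 0 1"
      by (intro integrable_continuous continuous_intros C1_continuous_line) auto
  next
    show "continuous_on ({0<..} \<times> cbox 0 1) (\<lambda>(v, x). dy g (Complex x v) * echar (- n) x)"
      unfolding case_prod_unfold
    proof (rule continuous_on_mult)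
      have d: "continuous_on upper_half_plane (dy g)" using g by (simp add: C1_periodic_def)
      show "continuous_on ({0<..} \<times> cbox 0 1) (\<lambda>p. dy g (Complex (snd p) (fst p)))"
        by (rule continuous_on_compose2[OF d]) (auto intro!: continuous_intros)
      show "continuous_on ({0<..} \<times> cbox 0 1) (\<lambda>p :: real \<times> real. echar (- n) (snd p))"
        by (intro continuous_intros)
    qed
  qed (use y in auto)
  then show ?thesis
    unfolding fourier_coeff_def cbox_interval
    by (subst (asm) has_vector_derivative_within_open) (use y in auto)
qed

text \<open>On a single coefficient the complex derivatives become ordinary differential operators in \<open>y\<close>.\<close>

lemma fourier_coeff_d_zbar:
  assumes y: "y > 0"
    and c: "((\<lambda>y. fourier_coeff (\<lambda>x. g (Complex x y)) n) has_vector_derivative c') (at y)"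
  shows "fourier_coeff (\<lambda>x. d_zbar g (Complex x y)) n
    = \<i> / 2 * (2 * of_real pi * of_int n * fourier_coeff (\<lambda>x. g (Complex x y)) n + c')"
    and "fourier_coeff (\<lambda>x. d_z g (Complex x y)) n
    = \<i> / 2 * (2 * of_real pi * of_int n * fourier_coeff (\<lambda>x. g (Complex x y)) n - c')"
proof -
  have c': "c' = fourier_coeff (\<lambda>x. dy g (Complex x y)) n"
    using vector_derivative_unique_at[OF c fourier_coeff_dy[OF y]] .
  have "fourier_coeff (\<lambda>x. d_zbar g (Complex x y)) n
      = integral {0..1} (\<lambda>x. 1 / 2 * (dx g (Complex x y) * echar (- n) x) + \<i> / 2 * (dy g (Complex x y) * echar (- n) x))"
    unfolding fourier_coeff_def d_zbar_def by (rule integral_cong) (simp add: field_simps)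
  also have "\<dots> = integral {0..1} (\<lambda>x. 1 / 2 * (dx g (Complex x y) * echar (- n) x))
      + integral {0..1} (\<lambda>x. \<i> / 2 * (dy g (Complex x y) * echar (- n) x))"
    by (rule integral_add) (intro integrable_on_unit_interval continuous_intros C1_continuous_line_dy C1_continuous_line_dx y)+
  also have "\<dots> = 1 / 2 * fourier_coeff (\<lambda>x. dx g (Complex x y)) n + \<i> / 2 * fourier_coeff (\<lambda>x. dy g (Complex x y)) n"
    unfolding fourier_coeff_def integral_mult_right ..
  finally show "fourier_coeff (\<lambda>x. d_zbar g (Complex x y)) n
    = \<i> / 2 * (2 * of_real pi * of_int n * fourier_coeff (\<lambda>x. g (Complex x y)) n + c')"
    unfolding fourier_coeff_dx[OF y] c' by (simp add: algebra_simps)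
  have "fourier_coeff (\<lambda>x. d_z g (Complex x y)) n
      = integral {0..1} (\<lambda>x. 1 / 2 * (dx g (Complex x y) * echar (- n) x) - \<i> / 2 * (dy g (Complex x y) * echar (- n) x))"
    unfolding fourier_coeff_def d_z_def by (rule integral_cong) (simp add: field_simps)
  also have "\<dots> = integral {0..1} (\<lambda>x. 1 / 2 * (dx g (Complex x y) * echar (- n) x))
      - integral {0..1} (\<lambda>x. \<i> / 2 * (dy g (Complex x y) * echar (- n) x))"
    by (rule integral_diff) (intro integrable_on_unit_interval continuous_intros C1_continuous_line_dy C1_continuous_line_dx y)+
  also have "\<dots> = 1 / 2 * fourier_coeff (\<lambda>x. dx g (Complex x y)) n - \<i> / 2 * fourier_coeff (\<lambda>x. dy g (Complex x y)) n"
    unfolding fourier_coeff_def integral_mult_right ..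
  finally show "fourier_coeff (\<lambda>x. d_z g (Complex x y)) n
    = \<i> / 2 * (2 * of_real pi * of_int n * fourier_coeff (\<lambda>x. g (Complex x y)) n - c')"
    unfolding fourier_coeff_dx[OF y] c' by (simp add: algebra_simps)
qed

lemma C1_fourier_inversion:
  assumes y: "y > 0" and s: "(\<lambda>n. norm (fourier_coeff (\<lambda>x. g (Complex x y)) n)) summable_on UNIV"
  shows "((\<lambda>n. fourier_coeff (\<lambda>x. g (Complex x y)) n * echar n x) has_sum g (Complex x y)) UNIV"
  by (rule fourier_inversion[where \<phi> = "\<lambda>x. g (Complex x y)", OF C1_continuous_line[OF y] C1_line_periodic[OF y]
        horizontal_derivative[OF C1_diff[OF y]] s])

lemma C1_fourier_coeff_bound:
  assumes y: "y > 0"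
  obtains M where "M \<ge> 0" "\<And>n. norm (fourier_coeff (\<lambda>x. g (Complex x y)) n) \<le> M"
proof -
  have "compact ((\<lambda>x. g (Complex x y)) ` {0..1})"
    by (intro compact_continuous_image C1_continuous_line y) auto
  then obtain M where M: "\<And>x. x \<in> {0..1} \<Longrightarrow> norm (g (Complex x y)) \<le> M"
    using compact_imp_bounded bounded_iff by (metis imageI)
  have "norm (fourier_coeff (\<lambda>x. g (Complex x y)) n) \<le> M * (1 - 0)" for n
    unfolding fourier_coeff_def
    by (rule integral_bound) (use M in \<open>auto simp: norm_mult intro!: continuous_intros C1_continuous_line y\<close>)
  moreover have "M \<ge> 0" using order_trans[OF norm_ge_zero M[of 0]] by simp
  ultimately show ?thesis using that by simp
qed

end

lemma frechet_derivative_periodic: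
  assumes "\<And>z. z \<in> upper_half_plane \<Longrightarrow> f differentiable (at z)"
    and "\<And>z. z \<in> upper_half_plane \<Longrightarrow> f (z + 1) = f z" and z: "z \<in> upper_half_plane"
  shows "frechet_derivative f (at (z + 1)) = frechet_derivative f (at z)"
proof -
  have "z + 1 \<in> upper_half_plane" using z by (simp add: upper_half_plane_def)
  then have "(f has_derivative frechet_derivative f (at (z + 1))) (at (z + 1))"
    using assms(1) frechet_derivative_works by blast
  moreover have "((\<lambda>w. w + 1) has_derivative (\<lambda>h. h)) (at z)" by (auto intro!: derivative_eq_intros)
  ultimately have "((\<lambda>w. f (w + 1)) has_derivative frechet_derivative f (at (z + 1))) (at z)"
    using has_derivative_compose[of "\<lambda>w. w + 1" "\<lambda>h. h" z UNIV f] by simp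
  then have "(f has_derivative frechet_derivative f (at (z + 1))) (at z)"
    by (rule has_derivative_transform_within_open[OF _ open_upper_half_plane z]) (use assms(2) in auto)
  then show ?thesis by (rule frechet_derivative_at)
qed

lemma d_zbar_derivatives:
  assumes "dx f differentiable (at z)" "dy f differentiable (at z)"
  shows "d_zbar f differentiable (at z)"
    and "dx (d_zbar f) z = (dx (dx f) z + \<i> * dx (dy f) z) / 2"
    and "dy (d_zbar f) z = (dy (dx f) z + \<i> * dy (dy f) z) / 2"
proof -
  have x: "(dx f has_derivative frechet_derivative (dx f) (at z)) (at z)"
    and y: "(dy f has_derivative frechet_derivative (dy f) (at z)) (at z)"
    using assms by (simp_all add: frechet_derivative_works)
  have d: "(d_zbar f has_derivative
      (\<lambda>h. (frechet_derivative (dx f) (at z) h + \<i> * frechet_derivative (dy f) (at z) h) / 2)) (at z)"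
    unfolding d_zbar_def[abs_def] divide_inverse
    by (intro has_derivative_mult_left has_derivative_add x has_derivative_mult_right y)
  then show "d_zbar f differentiable (at z)" by (rule differentiableI)
  note e = frechet_derivative_at[OF d, symmetric]
  show "dx (d_zbar f) z = (dx (dx f) z + \<i> * dx (dy f) z) / 2"
    "dy (d_zbar f) z = (dy (dx f) z + \<i> * dy (dy f) z) / 2"
    by (simp_all add: dx_def[of "d_zbar f"] dy_def[of "d_zbar f"] e dx_def[of "dx f"] dx_def[of "dy f"]
        dy_def[of "dx f"] dy_def[of "dy f"])
qed

text \<open>The period \<open>1\<close> comes from the translation matrix in \<open>\<Gamma>\<^sub>0(N)\<close>, whose automorphy factor is \<open>1\<close>.\<close>

lemma harmonic_maass_form_C1:
  assumes f: "harmonic_maass_form k N f"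
  shows "C1_periodic f" and "C1_periodic (d_zbar f)"
proof -
  have sm: "Ck_on (Suc (Suc 0)) upper_half_plane f"
    using f unfolding harmonic_maass_form_def smooth_on_def by blast
  have per: "f (z + 1) = f z" if "z \<in> upper_half_plane" for z
  proof -
    have "(1, 1, 0, 1) \<in> Gamma0 N" by (simp add: Gamma0_def SL2Z_def)
    then have "slash k f (1, 1, 0, 1) z = f z" using f that unfolding harmonic_maass_form_def by blast
    then show ?thesis by (simp add: slash_def)
  qed
  have d: "f differentiable (at z)" if "z \<in> upper_half_plane" for z using sm that by simp
  have d2: "dx f differentiable (at z)" "dy f differentiable (at z)" if "z \<in> upper_half_plane" for z
    using sm that by simp_all
  have c2: "continuous_on upper_half_plane (dx (dx f))" "continuous_on upper_half_plane (dy (dx f))"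
    "continuous_on upper_half_plane (dx (dy f))" "continuous_on upper_half_plane (dy (dy f))"
    using sm by simp_all
  show "C1_periodic f"
    unfolding C1_periodic_def using d d2 per
    by (auto intro!: continuous_at_imp_continuous_on differentiable_imp_continuous_within)
  show "C1_periodic (d_zbar f)"
    unfolding C1_periodic_def
  proof (intro conjI ballI)
    show "d_zbar f differentiable (at z)" if "z \<in> upper_half_plane" for z
      by (rule d_zbar_derivatives(1)[OF d2[OF that]])
    have "continuous_on upper_half_plane (\<lambda>z. (dx (dx f) z + \<i> * dx (dy f) z) / 2)"
      by (intro continuous_intros c2) auto
    then show "continuous_on upper_half_plane (dx (d_zbar f))"
      by (rule continuous_on_eq) (simp add: d_zbar_derivatives(2)[OF d2])
    have "continuous_on upper_half_plane (\<lambda>z. (dy (dx f) z + \<i> * dy (dy f) z) / 2)"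
      by (intro continuous_intros c2) auto
    then show "continuous_on upper_half_plane (dy (d_zbar f))"
      by (rule continuous_on_eq) (simp add: d_zbar_derivatives(3)[OF d2])
    show "d_zbar f (z + 1) = d_zbar f z" if "z \<in> upper_half_plane" for z
      unfolding d_zbar_def dx_def dy_def using frechet_derivative_periodic[OF d per that] by simp
  qed
qed

section \<open>The differential equations for the coefficients of a harmonic Maass form\<close>

lemma exp_eq_echar:
  "exp (2 * of_real pi * \<i> * of_int n * z) = of_real (exp (- 2 * pi * of_int n * Im z)) * echar n (Re z)"
proof -
  have "2 * of_real pi * \<i> * of_int n * z
      = of_real (- 2 * pi * of_int n * Im z) + 2 * of_real pi * \<i> * of_int n * of_real (Re z)"
    by (simp add: complex_eq_iff)
  then show ?thesis by (simp only: exp_add exp_of_real echar_def)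
qed

lemma const_if_vector_derivative_zero:
  fixes D :: "real \<Rightarrow> complex"
  assumes "\<And>y. y > 0 \<Longrightarrow> (D has_vector_derivative 0) (at y)"
  shows "\<exists>K. \<forall>y>0. D y = K"
proof -
  have "\<exists>K. \<forall>y\<in>{0<..}. D y = K"
    by (rule has_derivative_zero_constant)
      (use assms in \<open>auto simp: has_vector_derivative_def intro: has_derivative_at_withinI\<close>)
  then show ?thesis by auto
qed

lemma has_vector_derivative_of_real_fun:
  "(r has_real_derivative r') (at y) \<Longrightarrow> ((\<lambda>y. of_real (r y) :: complex) has_vector_derivative of_real r') (at y)"
  by (rule has_vector_derivative_of_real) (simp add: has_real_derivative_iff_has_vector_derivative)

lemma fourier_coeff_cmult:
  "fourier_coeff (\<lambda>x. c * g x) n = c * fourier_coeff g n"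
  unfolding fourier_coeff_def mult.assoc by (rule integral_mult_right)

text \<open>For \<open>h = d_zbar f\<close> the equation \<open>Delta k f = 0\<close> reads \<open>d_z h = (\<i> k / (2 y)) h\<close>.  On the \<open>n\<close>-th
  coefficient this is \<open>h' = (2 \<pi> n - k / y) h\<close>.  Multiplication by the
  reciprocal of a solution makes every other solution constant.\<close>

lemma d_zbar_coeff_ODE_solved:
  assumes f: "harmonic_maass_form k N f"
  obtains \<kappa> where "\<And>y. y > 0 \<Longrightarrow> fourier_coeff (\<lambda>x. d_zbar f (Complex x y)) n
    = \<kappa> * of_real (y powr (- of_int k) * exp (2 * pi * of_int n * y))"
proof -
  define h where "h y = fourier_coeff (\<lambda>x. d_zbar f (Complex x y)) n" for y
  note C1 = harmonic_maass_form_C1[OF f]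
  \<comment> \<open>the reciprocal of the expected solution, so that \<open>h w\<close> is constant\<close>
  define w where "w y = y powr of_int k * exp (- 2 * pi * of_int n * y)" for y :: real
  have wd: "(w has_real_derivative (of_int k / y - 2 * pi * of_int n) * w y) (at y)" if "y > 0" for y
    unfolding w_def using that
    by (auto intro!: derivative_eq_intros simp: field_simps powr_diff)
  have hd: "(h has_vector_derivative (2 * of_real pi * of_int n - of_int k / of_real y) * h y) (at y)" if y: "y > 0" for y
  proof -
    define h' where "h' = fourier_coeff (\<lambda>x. dy (d_zbar f) (Complex x y)) n"
    have 1: "(h has_vector_derivative h') (at y)"
      unfolding h_def h'_def by (rule fourier_coeff_dy[OF C1(2) y])
    have pt: "d_z (d_zbar f) (Complex x y) = (\<i> * of_int k / (2 * of_real y)) * d_zbar f (Complex x y)" for x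
    proof -
      have "Delta k f (Complex x y) = 0"
        using f y unfolding harmonic_maass_form_def by (metis Complex_in_upper)
      then have "2 * of_real y * d_z (d_zbar f) (Complex x y) * (2 * of_real y)
          = \<i> * of_int k * d_zbar f (Complex x y) * (2 * of_real y)"
        by (auto simp: Delta_def power2_eq_square algebra_simps)
      then have "2 * of_real y * d_z (d_zbar f) (Complex x y) = \<i> * of_int k * d_zbar f (Complex x y)"
        by (rule mult_right_cancel[THEN iffD1, rotated]) (use y in simp)
      then show ?thesis using y by (simp add: field_simps)
    qed
    have "\<i> / 2 * (2 * of_real pi * of_int n * h y - h') = \<i> * of_int k / (2 * of_real y) * h y"
      using fourier_coeff_d_zbar(2)[OF C1(2) y 1[unfolded h_def]]
      unfolding pt fourier_coeff_cmult h_def by simp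
    then have "\<i> / 2 * (2 * of_real pi * of_int n * h y - h') = \<i> / 2 * (of_int k / of_real y * h y)"
      by (simp add: mult_ac)
    then have "2 * of_real pi * of_int n * h y - h' = of_int k / of_real y * h y"
      by (simp only: mult_cancel_left) simp
    then have "h' = (2 * of_real pi * of_int n - of_int k / of_real y) * h y"
      by (simp add: algebra_simps)
    then show ?thesis using 1 by simp
  qed
  have "\<exists>\<kappa>. \<forall>y>0. h y * of_real (w y) = \<kappa>"
  proof (rule const_if_vector_derivative_zero)
    fix y :: real assume y: "y > 0"
    have "((\<lambda>y. h y * of_real (w y)) has_vector_derivative
        (h y * of_real ((of_int k / y - 2 * pi * of_int n) * w y)
         + (2 * of_real pi * of_int n - of_int k / of_real y) * h y * of_real (w y))) (at y)"
      by (rule has_vector_derivative_mult[OF hd[OF y] has_vector_derivative_of_real_fun[OF wd[OF y]]])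
    then show "((\<lambda>y. h y * of_real (w y)) has_vector_derivative 0) (at y)"
      by (simp add: algebra_simps)
  qed
  then obtain \<kappa> where \<kappa>: "\<And>y. y > 0 \<Longrightarrow> h y * of_real (w y) = \<kappa>" by blast
  show ?thesis
  proof (rule that)
    fix y :: real assume y: "y > 0"
    have "w y * (y powr (- of_int k) * exp (2 * pi * of_int n * y)) = 1"
      unfolding w_def using y by (simp add: powr_minus exp_minus field_simps)
    then have "h y = h y * of_real (w y * (y powr (- of_int k) * exp (2 * pi * of_int n * y)))" by simp
    also have "\<dots> = (h y * of_real (w y)) * of_real (y powr (- of_int k) * exp (2 * pi * of_int n * y))"
      by (simp only: of_real_mult mult.assoc)
    finally show "fourier_coeff (\<lambda>x. d_zbar f (Complex x y)) n
        = \<kappa> * of_real (y powr (- of_int k) * exp (2 * pi * of_int n * y))"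
      unfolding \<kappa>[OF y] by (simp only: h_def)
  qed
qed

text \<open>The \<open>n\<close>-th coefficients \<open>c\<close> of \<open>f\<close> and \<open>h\<close> of \<open>d_zbar f\<close> satisfy \<open>c' + 2 \<pi> n c = - 2 \<i> h\<close>, with \<open>h\<close>
  already known; \<open>exp (2 \<pi> n y)\<close> is the integrating factor.\<close>

lemma maass_coeff_ODE:
  assumes f: "harmonic_maass_form k N f"
  obtains \<kappa> where "\<And>y. y > 0 \<Longrightarrow>
    ((\<lambda>y. fourier_coeff (\<lambda>x. f (Complex x y)) n * of_real (exp (2 * pi * of_int n * y))) has_vector_derivative
      \<kappa> * of_real (y powr (- of_int k) * exp (4 * pi * of_int n * y))) (at y)"
proof -
  obtain \<kappa> where \<kappa>: "\<And>y. y > 0 \<Longrightarrow> fourier_coeff (\<lambda>x. d_zbar f (Complex x y)) n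
    = \<kappa> * of_real (y powr (- of_int k) * exp (2 * pi * of_int n * y))"
    by (rule d_zbar_coeff_ODE_solved[OF f, of n], rule that)
  note C1 = harmonic_maass_form_C1[OF f]
  define c where "c y = fourier_coeff (\<lambda>x. f (Complex x y)) n" for y
  define e where "e y = exp (2 * pi * of_int n * y)" for y
  show ?thesis
  proof (rule that[of "- 2 * \<i> * \<kappa>"])
    fix y :: real assume y: "y > 0"
    define c' where "c' = fourier_coeff (\<lambda>x. dy f (Complex x y)) n"
    have 1: "(c has_vector_derivative c') (at y)"
      unfolding c_def c'_def by (rule fourier_coeff_dy[OF C1(1) y])
    have "\<kappa> * of_real (y powr (- of_int k) * e y) = \<i> / 2 * (2 * of_real pi * of_int n * c y + c')"
      using fourier_coeff_d_zbar(1)[OF C1(1) y 1[unfolded c_def]] \<kappa>[OF y] by (simp add: c_def e_def)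
    then have "- 2 * \<i> * (\<kappa> * of_real (y powr (- of_int k) * e y))
        = - 2 * \<i> * (\<i> / 2 * (2 * of_real pi * of_int n * c y + c'))" by (simp only:)
    also have "\<dots> = 2 * of_real pi * of_int n * c y + c'" by simp
    finally have c': "c' + 2 * of_real pi * of_int n * c y = - 2 * \<i> * \<kappa> * of_real (y powr (- of_int k) * e y)"
      by (simp add: algebra_simps)
    have ed: "(e has_real_derivative 2 * pi * of_int n * e y) (at y)"
      unfolding e_def by (auto intro!: derivative_eq_intros)
    have "((\<lambda>y. c y * of_real (e y)) has_vector_derivative
        (c y * of_real (2 * pi * of_int n * e y) + c' * of_real (e y))) (at y)"
      by (rule has_vector_derivative_mult[OF 1 has_vector_derivative_of_real_fun[OF ed]])
    also have "c y * of_real (2 * pi * of_int n * e y) + c' * of_real (e y)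
        = (c' + 2 * of_real pi * of_int n * c y) * of_real (e y)" by (simp add: algebra_simps)
    also have "\<dots> = - 2 * \<i> * \<kappa> * of_real (y powr (- of_int k) * (e y * e y))"
      unfolding c' by simp
    also have "e y * e y = exp (4 * pi * of_int n * y)" by (simp add: e_def exp_add[symmetric])
    finally show "((\<lambda>y. fourier_coeff (\<lambda>x. f (Complex x y)) n * of_real (exp (2 * pi * of_int n * y))) has_vector_derivative
      - 2 * \<i> * \<kappa> * of_real (y powr (- of_int k) * exp (4 * pi * of_int n * y))) (at y)"
      by (simp add: c_def e_def)
  qed
qed

text \<open>The growth condition at the cusp \<open>\<infinity>\<close>, integrated against a character.  The number \<open>p n\<close> is the
  coefficient of \<open>q\<^sup>n\<close> in the principal part; it vanishes for \<open>n = 0\<close> because \<open>f\<close> is a cusp form.\<close>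

lemma maass_coeff_growth:
  assumes f: "f \<in> HC k N"
  obtains p :: "int \<Rightarrow> complex" and n0 :: nat and \<epsilon> C Y :: real
  where "\<epsilon> > 0" "Y \<ge> 1" "C \<ge> 0" "\<And>n. n \<ge> 0 \<Longrightarrow> p n = 0" "\<And>n. n < - int n0 \<Longrightarrow> p n = 0"
    "\<And>n y. y \<ge> Y \<Longrightarrow> norm (fourier_coeff (\<lambda>x. f (Complex x y)) n - p n * of_real (exp (- 2 * pi * of_int n * y)))
      \<le> C * exp (- \<epsilon> * y)"
proof -
  have id: "(1, 0, 0, 1) \<in> SL2Z" by (simp add: SL2Z_def)
  have hm: "harmonic_maass_form k N f" using f by (simp add: HC_def)
  then obtain P where P: "principal_part k f (1, 0, 0, 1) P"
    using id unfolding harmonic_maass_form_def by blast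
  then have P0: "coeff P 0 = 0" using f id unfolding HC_def by blast
  have C1: "C1_periodic f" by (rule harmonic_maass_form_C1[OF hm])
  from P obtain \<epsilon> where \<epsilon>: "\<epsilon> > 0" and
    "(\<lambda>z. slash k f (1, 0, 0, 1) z - poly P (exp (- (2 * of_real pi * \<i> * z))))
        \<in> O[filtercomap Im at_top](\<lambda>z. of_real (exp (- \<epsilon> * Im z)) :: complex)"
    unfolding principal_part_def by blast
  then obtain C where C: "C > 0" and "\<forall>\<^sub>F z in filtercomap Im at_top.
     norm (slash k f (1, 0, 0, 1) z - poly P (exp (- (2 * of_real pi * \<i> * z)))) \<le> C * norm (of_real (exp (- \<epsilon> * Im z)) :: complex)"
    by (auto simp: bigo_def)
  then obtain Y where Y: "\<And>z. Im z \<ge> Y \<Longrightarrow> norm (f z - poly P (exp (- (2 * of_real pi * \<i> * z)))) \<le> C * exp (- \<epsilon> * Im z)"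
    by (auto simp: eventually_filtercomap_at_top_linorder slash_def)
  define p where "p n = (if n \<le> 0 then coeff P (nat (- n)) else 0)" for n :: int
  show ?thesis
  proof (rule that[of \<epsilon> "max 1 Y" C p "degree P"])
    show "p n = 0" if "n \<ge> 0" for n using that P0 by (auto simp: p_def)
    show "p n = 0" if "n < - int (degree P)" for n using that by (auto simp: p_def intro!: coeff_eq_0)
    fix n :: int and y :: real assume y: "y \<ge> max 1 Y"
    then have y0: "y > 0" by auto
    define Q where "Q x = poly P (exp (- (2 * of_real pi * \<i> * Complex x y)))" for x
    have Qsum: "Q x = (\<Sum>j\<le>degree P. (coeff P j * of_real (exp (2 * pi * of_nat j * y))) * echar (- int j) x)" for x
    proof -
      have "exp (- (2 * of_real pi * \<i> * Complex x y)) ^ j = of_real (exp (2 * pi * of_nat j * y)) * echar (- int j) x" for j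
        using exp_eq_echar[of "- int j" "Complex x y"] exp_of_nat_mult[of j "- (2 * of_real pi * \<i> * Complex x y)"]
        by (simp add: mult_ac)
      then show ?thesis unfolding Q_def poly_altdef by (simp add: mult.assoc)
    qed
    have Qc: "continuous_on {0..1} Q" unfolding Qsum[abs_def] by (intro continuous_intros)
    have "fourier_coeff Q n = (\<Sum>j\<le>degree P. (coeff P j * of_real (exp (2 * pi * of_nat j * y))) * integral {0..1} (echar (- int j - n)))"
    proof -
      have "fourier_coeff Q n = integral {0..1} (\<lambda>x. \<Sum>j\<le>degree P. (coeff P j * of_real (exp (2 * pi * of_nat j * y))) * echar (- int j - n) x)"
        unfolding fourier_coeff_def Qsum sum_distrib_right mult.assoc echar_mult by simp
      also have "\<dots> = (\<Sum>j\<le>degree P. integral {0..1} (\<lambda>x. (coeff P j * of_real (exp (2 * pi * of_nat j * y))) * echar (- int j - n) x))"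
        by (rule integral_sum) (auto intro!: integrable_on_unit_interval continuous_intros)
      finally show ?thesis unfolding integral_mult_right .
    qed
    also have "\<dots> = (\<Sum>j\<le>degree P. if j = nat (- n) \<and> n \<le> 0 then coeff P j * of_real (exp (2 * pi * of_nat j * y)) else 0)"
      by (intro sum.cong) (auto simp: integral_echar)
    also have "\<dots> = p n * of_real (exp (- 2 * pi * of_int n * y))"
    proof (cases "n \<le> 0")
      case True
      then have *: "real (nat (- n)) = - of_int n" by simp
      have "(\<Sum>j\<le>degree P. if j = nat (- n) \<and> n \<le> 0 then coeff P j * of_real (exp (2 * pi * of_nat j * y)) else 0)
          = (if nat (- n) \<le> degree P then coeff P (nat (- n)) * complex_of_real (exp (2 * pi * real (nat (- n)) * y)) else 0)"
        using True by simp
      also have "\<dots> = p n * of_real (exp (- 2 * pi * of_int n * y))"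
        unfolding * using True by (auto simp: p_def coeff_eq_0)
      finally show ?thesis .
    qed (simp add: p_def)
    finally have Qn: "fourier_coeff Q n = p n * of_real (exp (- 2 * pi * of_int n * y))" .
    have "fourier_coeff (\<lambda>x. f (Complex x y)) n - fourier_coeff Q n
        = integral {0..1} (\<lambda>x. f (Complex x y) * echar (- n) x - Q x * echar (- n) x)"
      unfolding fourier_coeff_def
      by (rule integral_diff[symmetric]) (intro integrable_on_unit_interval continuous_intros Qc C1_continuous_line[OF C1 y0])+
    also have "norm \<dots> \<le> (C * exp (- \<epsilon> * y)) * (1 - 0)"
    proof (rule integral_bound)
      show "continuous_on {0..1} (\<lambda>x. f (Complex x y) * echar (- n) x - Q x * echar (- n) x)"
        by (intro continuous_intros Qc C1_continuous_line[OF C1 y0])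
      fix x :: real
      have "norm (f (Complex x y) * echar (- n) x - Q x * echar (- n) x) = norm (f (Complex x y) - Q x)"
        unfolding left_diff_distrib[symmetric] norm_mult by simp
      also have "\<dots> \<le> C * exp (- \<epsilon> * y)" using Y[of "Complex x y"] y by (simp add: Q_def)
      finally show "norm (f (Complex x y) * echar (- n) x - Q x * echar (- n) x) \<le> C * exp (- \<epsilon> * y)" .
    qed simp
    finally show "norm (fourier_coeff (\<lambda>x. f (Complex x y)) n - p n * of_real (exp (- 2 * pi * of_int n * y))) \<le> C * exp (- \<epsilon> * y)"
      unfolding Qn by simp
  qed (use \<epsilon> C in auto)
qed

lemma exp_beats_powr:
  fixes \<epsilon> D K Y :: real
  assumes "\<epsilon> > 0" "Y \<ge> 1" and bd: "\<And>y. y \<ge> Y \<Longrightarrow> (y + 1) powr (- K) \<le> D * exp (- \<epsilon> * y)"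
  shows False
proof -
  obtain A where A: "A > 0" "\<And>x. x \<ge> 1 \<Longrightarrow> x powr K \<le> A * exp (\<epsilon> / 2 * x)"
    by (rule powr_le_exp[OF half_gt_zero[OF assms(1)] zero_less_one, of K], rule that)
  have "1 \<le> \<bar>D\<bar> * A * exp (\<epsilon> / 2) * exp (- (\<epsilon> / 2) * y)" if y: "y \<ge> Y" for y
  proof -
    have "1 = (y + 1) powr K * (y + 1) powr (- K)" using y assms(2) by (simp add: powr_add[symmetric])
    also have "\<dots> \<le> (A * exp (\<epsilon> / 2 * (y + 1))) * (\<bar>D\<bar> * exp (- \<epsilon> * y))"
    proof (rule mult_mono)
      show "(y + 1) powr K \<le> A * exp (\<epsilon> / 2 * (y + 1))" using A(2)[of "y + 1"] y assms(2) by simp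
      have "(y + 1) powr (- K) \<le> D * exp (- \<epsilon> * y)" by (rule bd[OF y])
      also have "\<dots> \<le> \<bar>D\<bar> * exp (- \<epsilon> * y)" by (intro mult_right_mono) auto
      finally show "(y + 1) powr (- K) \<le> \<bar>D\<bar> * exp (- \<epsilon> * y)" .
    qed (use A(1) in auto)
    also have "\<dots> = \<bar>D\<bar> * A * (exp (\<epsilon> / 2 * (y + 1)) * exp (- \<epsilon> * y))" by (simp only: mult_ac)
    also have "exp (\<epsilon> / 2 * (y + 1)) * exp (- \<epsilon> * y) = exp (\<epsilon> / 2) * exp (- (\<epsilon> / 2) * y)"
      unfolding exp_add[symmetric] by (simp add: field_simps)
    finally show ?thesis by (simp only: mult.assoc)
  qed
  then have "\<forall>\<^sub>F y in at_top. 1 \<le> \<bar>D\<bar> * A * exp (\<epsilon> / 2) * exp (- (\<epsilon> / 2) * y)"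
    by (auto simp: eventually_at_top_linorder)
  moreover have "((\<lambda>y. \<bar>D\<bar> * A * exp (\<epsilon> / 2) * exp (- (\<epsilon> / 2) * y)) \<longlongrightarrow> \<bar>D\<bar> * A * exp (\<epsilon> / 2) * 0) at_top"
    by (intro tendsto_mult tendsto_const) (use assms(1) in real_asymp)
  ultimately have "(1::real) \<le> \<bar>D\<bar> * A * exp (\<epsilon> / 2) * 0"
    by (intro tendsto_lowerbound[of _ _ at_top]) auto
  then show False by simp
qed

text \<open>If \<open>\<kappa> \<noteq> 0\<close>, then \<open>d / \<kappa>\<close> has a positive real derivative, which is at least
  \<open>(y + 1) powr (- \<bar>k\<bar>) * exp (4 \<pi> n y)\<close> on \<open>[y, y + 1]\<close>.  By the mean value theorem \<open>d\<close> would be too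
  large for the assumed bound.\<close>

lemma ODE_solution_trivial_if_small:
  fixes d :: "real \<Rightarrow> complex" and \<epsilon> C Y :: real
  assumes d: "\<And>y. y > 0 \<Longrightarrow> (d has_vector_derivative \<kappa> * of_real (y powr (- of_int k) * exp (4 * pi * of_int n * y))) (at y)"
    and n: "n \<ge> 0" and \<epsilon>: "\<epsilon> > 0" "Y \<ge> 1" "C \<ge> 0"
    and bd: "\<And>y. y \<ge> Y \<Longrightarrow> norm (d y) \<le> C * exp (- \<epsilon> * y) * exp (2 * pi * of_int n * y)"
  shows "\<kappa> = 0"
proof (rule ccontr)
  assume \<kappa>: "\<kappa> \<noteq> 0"
  define r where "r y = Re (d y / \<kappa>)" for y
  let ?r' = "\<lambda>y. y powr (- of_int k) * exp (4 * pi * of_int n * y)"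
  have rd: "(r has_real_derivative ?r' y) (at y)" if "y > 0" for y
  proof -
    have "((\<lambda>y. d y / \<kappa>) has_vector_derivative \<kappa> * of_real (?r' y) / \<kappa>) (at y)"
      by (rule has_vector_derivative_divide[OF d[OF that]])
    then have "((\<lambda>y. Re (d y / \<kappa>)) has_vector_derivative Re (\<kappa> * of_real (?r' y) / \<kappa>)) (at y)"
      by (rule bounded_linear.has_vector_derivative[OF bounded_linear_Re])
    moreover have "\<kappa> * of_real (?r' y) / \<kappa> = of_real (?r' y)" using \<kappa> by simp
    ultimately show ?thesis
      unfolding r_def has_real_derivative_iff_has_vector_derivative by (simp only: Re_complex_of_real)
  qed
  let ?e = "exp (2 * pi * of_int n)"
  define D where "D = C / norm \<kappa> * (?e + 1)"
  have rb: "\<bar>r y\<bar> \<le> C / norm \<kappa> * (exp (- \<epsilon> * y) * exp (2 * pi * of_int n * y))" if "y \<ge> Y" for y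
  proof -
    have "\<bar>r y\<bar> \<le> norm (d y) / norm \<kappa>" unfolding r_def norm_divide[symmetric] by (rule abs_Re_le_cmod)
    also have "\<dots> \<le> (C * exp (- \<epsilon> * y) * exp (2 * pi * of_int n * y)) / norm \<kappa>"
      by (intro divide_right_mono bd that) simp
    finally show ?thesis by simp
  qed
  show False
  proof (rule exp_beats_powr[OF \<epsilon>(1,2)])
    fix y assume y: "y \<ge> Y"
    let ?E = "exp (2 * pi * of_int n * y)"
    have "\<exists>z>y. z < y + 1 \<and> r (y + 1) - r y = (y + 1 - y) * ?r' z"
      by (rule MVT2) (use rd y \<epsilon>(2) in auto)
    then obtain z where z: "y < z" "z < y + 1" "r (y + 1) - r y = ?r' z" by auto
    have "(y + 1) powr (- \<bar>of_int k\<bar>) * ?E \<le> ?r' z"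
    proof (rule mult_mono)
      have "(y + 1) powr (- \<bar>of_int k\<bar>) \<le> z powr (- \<bar>of_int k\<bar>)"
        using z y \<epsilon>(2) by (intro powr_mono2') auto
      also have "\<dots> \<le> z powr (- of_int k)" using z y \<epsilon>(2) by (intro powr_mono) auto
      finally show "(y + 1) powr (- \<bar>of_int k\<bar>) \<le> z powr (- of_int k)" .
      have "2 * y \<le> 4 * z" using z y \<epsilon>(2) by linarith
      then have "of_int n * pi * (2 * y) \<le> of_int n * pi * (4 * z)" using n by (intro mult_left_mono) auto
      then show "?E \<le> exp (4 * pi * of_int n * z)" by (simp add: mult_ac)
    qed auto
    also have "\<dots> \<le> \<bar>r (y + 1)\<bar> + \<bar>r y\<bar>" using z(3) by linarith
    also have "\<dots> \<le> C / norm \<kappa> * (exp (- \<epsilon> * (y + 1)) * exp (2 * pi * of_int n * (y + 1)))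
        + C / norm \<kappa> * (exp (- \<epsilon> * y) * ?E)"
      using y by (intro add_mono rb) auto
    also have "\<dots> \<le> C / norm \<kappa> * (exp (- \<epsilon> * y) * (?e * ?E)) + C / norm \<kappa> * (exp (- \<epsilon> * y) * ?E)"
    proof (intro add_right_mono mult_left_mono mult_mono)
      show "exp (- \<epsilon> * (y + 1)) \<le> exp (- \<epsilon> * y)" using \<epsilon>(1) by simp
      show "exp (2 * pi * of_int n * (y + 1)) \<le> ?e * ?E" by (simp add: exp_add[symmetric] algebra_simps)
    qed (use \<epsilon>(3) in auto)
    also have "\<dots> = D * exp (- \<epsilon> * y) * ?E" by (simp add: D_def algebra_simps)
    finally show "(y + 1) powr (- \<bar>of_int k\<bar>) \<le> D * exp (- \<epsilon> * y)" by (rule mult_right_le_imp_le) simp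
  qed
qed

text \<open>The coefficient of \<open>echar n\<close> in the expansion \<open>maass_expansion k f n0 a b\<close> at height \<open>y\<close>.\<close>

definition fourier_term :: "int \<Rightarrow> nat \<Rightarrow> (int \<Rightarrow> complex) \<Rightarrow> (int \<Rightarrow> complex) \<Rightarrow> int \<Rightarrow> real \<Rightarrow> complex" where
  "fourier_term k n0 a b n y =
     (if n \<ge> - int n0 \<and> n \<noteq> 0 then a n * of_real (exp (- 2 * pi * of_int n * y)) else 0) +
     (if n < 0 then b n * of_real (inc_Gamma (1 - of_int k) (- 4 * pi * of_int n * y))
        * of_real (exp (- 2 * pi * of_int n * y)) else 0)"

lemma inc_Gamma_scaled_deriv:
  assumes y: "y > 0" and n: "n < 0"
  shows "((\<lambda>y. inc_Gamma (1 - of_int k) (- 4 * pi * of_int n * y)) has_real_derivative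
    - ((- 4 * pi * of_int n) powr (1 - of_int k)) * (y powr (- of_int k) * exp (4 * pi * of_int n * y))) (at y)"
proof -
  let ?m = "- 4 * pi * of_int n :: real"
  have m: "?m > 0" using mult_pos_neg[of pi "real_of_int n"] n by simp
  then have my: "?m * y > 0" using y by (rule mult_pos_pos)
  have "((\<lambda>y. inc_Gamma (1 - of_int k) (?m * y)) has_real_derivative
      - (exp (- (?m * y)) * (?m * y) powr (1 - of_int k - 1)) * ?m) (at y)"
    by (rule DERIV_chain2[where f = "inc_Gamma (1 - of_int k)" and g = "\<lambda>y. ?m * y", OF inc_Gamma_deriv[OF my]])
      (auto intro!: derivative_eq_intros)
  moreover have "(M * y) powr (1 - of_int k - 1) = M powr (1 - of_int k) / M * y powr (- of_int k)" if "M > 0" for M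
    using that y by (simp add: powr_mult powr_diff powr_minus field_simps)
  note this[OF m]
  moreover have "- (exp (- (?m * y)) * (?m powr (1 - of_int k) / ?m * y powr (- of_int k))) * ?m
      = - (?m powr (1 - of_int k)) * (y powr (- of_int k) * exp (4 * pi * of_int n * y))"
    using m by (simp add: mult_ac)
  ultimately show ?thesis by simp
qed

text \<open>Let \<open>d n\<close> be the \<open>n\<close>-th coefficient times \<open>exp (2 \<pi> n y)\<close>.  For \<open>n \<ge> 0\<close> the growth condition forces
  \<open>d n\<close> to be constant, and to be \<open>0\<close> if \<open>n = 0\<close>.  For \<open>n < 0\<close> the differential equation is solved by a
  multiple of the incomplete Gamma function plus a constant.  That constant is \<open>p n\<close>, since the Gamma
  function and the error term of the growth condition both tend to \<open>0\<close>.\<close>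

lemma maass_coeff_fourier_term:
  assumes f: "f \<in> HC k N"
  obtains n0 a b where "\<And>n y. y > 0 \<Longrightarrow> fourier_coeff (\<lambda>x. f (Complex x y)) n = fourier_term k n0 a b n y"
proof -
  have hm: "harmonic_maass_form k N f" using f by (simp add: HC_def)
  obtain p n0 \<epsilon> C Y where G: "\<epsilon> > 0" "Y \<ge> 1" "C \<ge> 0" "\<And>n. n \<ge> 0 \<Longrightarrow> p n = 0" "\<And>n. n < - int n0 \<Longrightarrow> p n = 0"
    and bd: "\<And>n y. y \<ge> Y \<Longrightarrow> norm (fourier_coeff (\<lambda>x. f (Complex x y)) n - p n * of_real (exp (- 2 * pi * of_int n * y)))
      \<le> C * exp (- \<epsilon> * y)"
    by (rule maass_coeff_growth[OF f], rule that)
  define c where "c n y = fourier_coeff (\<lambda>x. f (Complex x y)) n" for n y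
  define d where "d n y = c n y * of_real (exp (2 * pi * of_int n * y))" for n y
  have cd: "c n y = d n y * of_real (exp (- 2 * pi * of_int n * y))" for n y
    unfolding d_def mult.assoc of_real_mult[symmetric] exp_add[symmetric] by simp
  have "\<exists>\<kappa>. \<forall>y>0. (d n has_vector_derivative \<kappa> * of_real (y powr (- of_int k) * exp (4 * pi * of_int n * y))) (at y)" for n
    unfolding d_def[abs_def] c_def by (rule maass_coeff_ODE[OF hm, of n]) blast
  then obtain \<kappa> where \<kappa>: "\<And>n y. y > 0 \<Longrightarrow>
      (d n has_vector_derivative \<kappa> n * of_real (y powr (- of_int k) * exp (4 * pi * of_int n * y))) (at y)"
    by metis
  have db: "norm (d n y - p n) \<le> C * exp (- \<epsilon> * y) * exp (2 * pi * of_int n * y)" if "y \<ge> Y" for n y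
  proof -
    have "d n y - p n = (c n y - p n * of_real (exp (- 2 * pi * of_int n * y))) * of_real (exp (2 * pi * of_int n * y))"
      unfolding d_def left_diff_distrib mult.assoc of_real_mult[symmetric] exp_add[symmetric] by simp
    then have "norm (d n y - p n) = norm (c n y - p n * of_real (exp (- 2 * pi * of_int n * y))) * exp (2 * pi * of_int n * y)"
      by (simp only: norm_mult norm_of_real) simp
    also have "\<dots> \<le> C * exp (- \<epsilon> * y) * exp (2 * pi * of_int n * y)"
      unfolding c_def by (intro mult_right_mono bd that) simp
    finally show ?thesis .
  qed
  have pos: "\<exists>A. \<forall>y>0. d n y = A" if n: "n \<ge> 0" for n
  proof -
    have "\<kappa> n = 0"
      by (rule ODE_solution_trivial_if_small[OF \<kappa> n G(1-3)]) (use db[of _ n] G(4)[OF n] in simp_all)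
    then have "\<And>y. y > 0 \<Longrightarrow> (d n has_vector_derivative 0) (at y)" using \<kappa>[of _ n] by simp
    then show ?thesis by (rule const_if_vector_derivative_zero)
  qed
  have zero: "d 0 y = 0" if y: "y > 0" for y
  proof -
    obtain A where A: "\<And>y. y > 0 \<Longrightarrow> d 0 y = A" using pos[of 0] by auto
    have "((\<lambda>y. C * exp (- \<epsilon> * y)) \<longlongrightarrow> 0) at_top" using G(1) by real_asymp
    moreover have "\<forall>\<^sub>F y in at_top. norm A \<le> C * exp (- \<epsilon> * y)"
      unfolding eventually_at_top_linorder
    proof (intro exI[of _ Y] allI impI)
      fix y assume "y \<ge> Y"
      then show "norm A \<le> C * exp (- \<epsilon> * y)" using db[of y 0] A[of y] G(2) G(4)[of 0] by simp
    qed
    ultimately have "norm A \<le> 0" by (rule tendsto_lowerbound) simp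
    then have "A = 0" by simp
    then show ?thesis using A[OF y] by simp
  qed
  have neg: "\<exists>\<beta>. \<forall>y>0. d n y = p n + \<beta> * of_real (inc_Gamma (1 - of_int k) (- 4 * pi * of_int n * y))" if n: "n < 0" for n
  proof -
    let ?m = "- 4 * pi * of_int n :: real"
    let ?\<Gamma> = "\<lambda>y. inc_Gamma (1 - of_int k) (?m * y)"
    have m: "?m > 0" using mult_pos_neg[of pi "real_of_int n"] n by simp
    \<comment> \<open>chosen so that \<open>\<beta>\<close> times the Gamma function has the derivative of \<open>d n\<close>\<close>
    define \<beta> where "\<beta> = - \<kappa> n / of_real (?m powr (1 - of_int k))"
    have "((\<lambda>y. d n y - \<beta> * of_real (?\<Gamma> y)) has_vector_derivative 0) (at y)" if y: "y > 0" for y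
    proof -
      have "((\<lambda>y. d n y - \<beta> * of_real (?\<Gamma> y)) has_vector_derivative
          \<kappa> n * of_real (y powr (- of_int k) * exp (4 * pi * of_int n * y))
          - \<beta> * of_real (- (?m powr (1 - of_int k)) * (y powr (- of_int k) * exp (4 * pi * of_int n * y)))) (at y)"
        by (intro has_vector_derivative_diff \<kappa> y has_vector_derivative_mult_right has_vector_derivative_of_real_fun
            inc_Gamma_scaled_deriv n)
      moreover have "\<beta> * of_real (?m powr (1 - of_int k)) = - \<kappa> n" unfolding \<beta>_def using m n by simp
      then have "\<beta> * of_real (- (?m powr (1 - of_int k)) * (y powr (- of_int k) * exp (4 * pi * of_int n * y)))
          = \<kappa> n * of_real (y powr (- of_int k) * exp (4 * pi * of_int n * y))"
        by (simp only: of_real_mult of_real_minus mult_minus_left mult_minus_right mult.assoc[symmetric]) simp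
      ultimately show ?thesis by (simp only: diff_self)
    qed
    then have "\<exists>A. \<forall>y>0. d n y - \<beta> * of_real (?\<Gamma> y) = A" by (rule const_if_vector_derivative_zero)
    then obtain A where A: "\<And>y. y > 0 \<Longrightarrow> d n y - \<beta> * of_real (?\<Gamma> y) = A" by blast
    have "filterlim (\<lambda>y. ?m * y) at_top at_top"
      using m by (intro filterlim_tendsto_pos_mult_at_top[OF tendsto_const]) (auto simp: filterlim_ident)
    from filterlim_compose[OF inc_Gamma_tendsto_0 this]
    have "((\<lambda>y. \<beta> * of_real (?\<Gamma> y)) \<longlongrightarrow> \<beta> * of_real 0) at_top"
      by (intro tendsto_mult tendsto_const tendsto_of_real)
    moreover have "((\<lambda>y. d n y - p n) \<longlongrightarrow> 0) at_top"
    proof (rule Lim_null_comparison)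
      show "\<forall>\<^sub>F y in at_top. norm (d n y - p n) \<le> C * exp (- \<epsilon> * y) * exp (2 * pi * of_int n * y)"
        using eventually_ge_at_top[of Y] by eventually_elim (rule db)
      have "2 * pi * of_int n < 0" using n by (simp add: mult_pos_neg)
      then show "((\<lambda>y. C * exp (- \<epsilon> * y) * exp (2 * pi * of_int n * y)) \<longlongrightarrow> 0) at_top"
        using G(1) by real_asymp
    qed
    ultimately have "((\<lambda>y. (d n y - p n) - \<beta> * of_real (?\<Gamma> y)) \<longlongrightarrow> 0 - \<beta> * of_real 0) at_top"
      by (intro tendsto_diff)
    moreover have "\<forall>\<^sub>F y in at_top. (d n y - p n) - \<beta> * of_real (?\<Gamma> y) = A - p n"
      using eventually_gt_at_top[of 0]
    proof eventually_elim
      case (elim y)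
      show ?case unfolding A[OF elim, symmetric] by simp
    qed
    ultimately have "((\<lambda>y::real. A - p n) \<longlongrightarrow> 0 - \<beta> * of_real 0) at_top" by (rule Lim_transform_eventually)
    then have "A = p n" by (simp add: tendsto_const_iff)
    then show ?thesis using A by (intro exI[of _ \<beta>]) (auto simp: algebra_simps)
  qed
  obtain A where A: "\<And>n y. n \<ge> 0 \<Longrightarrow> y > 0 \<Longrightarrow> d n y = A n" using pos by metis
  obtain \<beta> where \<beta>: "\<And>n y. n < 0 \<Longrightarrow> y > 0 \<Longrightarrow>
      d n y = p n + \<beta> n * of_real (inc_Gamma (1 - of_int k) (- 4 * pi * of_int n * y))"
    using neg by metis
  show ?thesis
  proof (rule that[of n0 "\<lambda>n. if n < 0 then p n else A n" \<beta>])
    fix n :: int and y :: real assume y: "y > 0"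
    show "fourier_coeff (\<lambda>x. f (Complex x y)) n = fourier_term k n0 (\<lambda>n. if n < 0 then p n else A n) \<beta> n y"
      unfolding c_def[symmetric] cd
      using \<beta>[OF _ y, of n] A[OF _ y, of n] zero[OF y] G(5)[of n]
      by (cases "n < 0"; cases "n = 0") (auto simp: fourier_term_def algebra_simps)
  qed
qed

section \<open>Growth of coefficients and existence of the expansion\<close>

abbreviation hol_index :: "nat \<Rightarrow> int set" where
  "hol_index n0 \<equiv> {n. n \<ge> - int n0 \<and> n \<noteq> 0}"

abbreviation neg_index :: "int set" where
  "neg_index \<equiv> {n. n < 0}"

text \<open>Growth slower than every exponential in \<open>\<bar>n\<bar>\<close>, which is what convergence of the expansion at all
  heights \<open>y > 0\<close> imposes on its coefficients.\<close>

definition subexp :: "int set \<Rightarrow> (int \<Rightarrow> complex) \<Rightarrow> bool" where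
  "subexp S a \<longleftrightarrow> (\<forall>\<delta>>0. \<exists>M. \<forall>n\<in>S. norm (a n) \<le> M * exp (\<delta> * \<bar>real_of_int n\<bar>))"

lemma subexpD:
  assumes "subexp S a" "\<delta> > 0"
  obtains M where "M \<ge> 0" "\<And>n. n \<in> S \<Longrightarrow> norm (a n) \<le> M * exp (\<delta> * \<bar>real_of_int n\<bar>)"
proof -
  obtain M where M: "\<forall>n\<in>S. norm (a n) \<le> M * exp (\<delta> * \<bar>real_of_int n\<bar>)"
    using assms unfolding subexp_def by blast
  have "norm (a n) \<le> \<bar>M\<bar> * exp (\<delta> * \<bar>real_of_int n\<bar>)" if "n \<in> S" for n
    by (rule order_trans[OF M[rule_format, OF that]]) (intro mult_right_mono, auto)
  then show ?thesis using that[of "\<bar>M\<bar>"] by simp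
qed

lemma subexp_cofinite:
  assumes "finite (S - T)" and "\<And>\<delta>. \<delta> > 0 \<Longrightarrow> \<exists>M. \<forall>n\<in>S \<inter> T. norm (a n) \<le> M * exp (\<delta> * \<bar>real_of_int n\<bar>)"
  shows "subexp S a"
  unfolding subexp_def
proof (intro allI impI)
  fix \<delta> :: real assume \<delta>: "\<delta> > 0"
  then obtain M where M: "\<And>n. n \<in> S \<inter> T \<Longrightarrow> norm (a n) \<le> M * exp (\<delta> * \<bar>real_of_int n\<bar>)"
    using assms(2) by metis
  define B where "B = (\<Sum>n\<in>S - T. norm (a n))"
  have B0: "B \<ge> 0" unfolding B_def by (intro sum_nonneg) simp
  show "\<exists>M. \<forall>n\<in>S. norm (a n) \<le> M * exp (\<delta> * \<bar>real_of_int n\<bar>)"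
  proof (intro exI[of _ "\<bar>M\<bar> + B"] ballI)
    fix n assume n: "n \<in> S"
    show "norm (a n) \<le> (\<bar>M\<bar> + B) * exp (\<delta> * \<bar>real_of_int n\<bar>)"
    proof (cases "n \<in> T")
      case True
      then have "norm (a n) \<le> M * exp (\<delta> * \<bar>real_of_int n\<bar>)" using M n by blast
      also have "\<dots> \<le> (\<bar>M\<bar> + B) * exp (\<delta> * \<bar>real_of_int n\<bar>)" using B0 by (intro mult_right_mono) auto
      finally show ?thesis .
    next
      case False
      then have "norm (a n) \<le> B" unfolding B_def using n assms(1) by (intro member_le_sum) auto
      also have "\<dots> \<le> (\<bar>M\<bar> + B) * 1" by simp
      also have "\<dots> \<le> (\<bar>M\<bar> + B) * exp (\<delta> * \<bar>real_of_int n\<bar>)" using B0 \<delta> by (intro mult_left_mono) auto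
      finally show ?thesis .
    qed
  qed
qed

lemma summable_exp_abs:
  assumes "c > 0"
  shows "(\<lambda>n::int. exp (- c * \<bar>real_of_int n\<bar>)) summable_on S"
proof -
  have g: "summable (\<lambda>m::nat. exp (- c) ^ m)" using assms by (intro summable_geometric) auto
  have e: "exp (- c * real m) = exp (- c) ^ m" for m using exp_of_nat_mult[of m "- c"] by (simp add: mult.commute)
  have s: "(\<lambda>m::nat. exp (- c * real m)) summable_on UNIV"
    unfolding e by (rule norm_summable_imp_summable_on) (use g in simp)
  have 1: "(\<lambda>n::int. exp (- c * \<bar>real_of_int n\<bar>)) summable_on range int"
    by (subst summable_on_reindex) (use s in \<open>auto simp: o_def inj_def\<close>)
  have 2: "(\<lambda>n::int. exp (- c * \<bar>real_of_int n\<bar>)) summable_on range (\<lambda>m. - int m)"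
    by (subst summable_on_reindex) (use s in \<open>auto simp: o_def inj_def\<close>)
  have "S \<subseteq> range int \<union> range (\<lambda>m. - int m)"
  proof
    fix n :: int
    show "n \<in> range int \<union> range (\<lambda>m. - int m)"
      by (cases n rule: int_cases2) auto
  qed
  then show ?thesis
    using summable_on_subset_banach[OF summable_on_union[OF 1 2]] by blast
qed

lemma summable_on_exp_bound:
  fixes g :: "int \<Rightarrow> real"
  assumes "c > 0" "\<And>n. n \<in> S \<Longrightarrow> 0 \<le> g n" "\<And>n. n \<in> S \<Longrightarrow> g n \<le> M * exp (- c * \<bar>real_of_int n\<bar>)"
  shows "g summable_on S"
  by (rule summable_on_comparison_test[OF summable_on_cmult_right[OF summable_exp_abs[OF assms(1)], of M]])
    (use assms in auto)

lemma hol_summable: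
  assumes a: "subexp (hol_index n0) a" and y: "y > 0"
  shows "(\<lambda>n. norm (a n) * exp (- 2 * pi * of_int n * y)) summable_on hol_index n0"
proof -
  have "pi * y > 0" using y by simp
  then obtain M where M: "M \<ge> 0" "\<And>n. n \<in> hol_index n0 \<Longrightarrow> norm (a n) \<le> M * exp (pi * y * \<bar>real_of_int n\<bar>)"
    using subexpD[OF a] by metis
  show ?thesis
  proof (rule summable_on_exp_bound[where c = "pi * y" and M = "M * exp (4 * pi * y * real n0)"])
    fix n assume n: "n \<in> hol_index n0"
    have "\<bar>real_of_int n\<bar> - real_of_int n \<le> 2 * real n0" using n by (auto simp: abs_if)
    then have "(2 * pi * y) * (\<bar>real_of_int n\<bar> - real_of_int n) \<le> (2 * pi * y) * (2 * real n0)"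
      using y by (intro mult_left_mono) auto
    then have *: "pi * y * \<bar>real_of_int n\<bar> + (- 2 * pi * of_int n * y) \<le> 4 * pi * y * real n0 + (- (pi * y) * \<bar>real_of_int n\<bar>)"
      by (simp add: algebra_simps)
    have "norm (a n) * exp (- 2 * pi * of_int n * y) \<le> M * exp (pi * y * \<bar>real_of_int n\<bar>) * exp (- 2 * pi * of_int n * y)"
      by (intro mult_right_mono M n) simp
    also have "\<dots> = M * exp (pi * y * \<bar>real_of_int n\<bar> + (- 2 * pi * of_int n * y))" by (simp only: exp_add mult.assoc)
    also have "\<dots> \<le> M * exp (4 * pi * y * real n0 + (- (pi * y) * \<bar>real_of_int n\<bar>))"
      using * M(1) by (intro mult_left_mono) auto
    finally show "norm (a n) * exp (- 2 * pi * of_int n * y)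
        \<le> M * exp (4 * pi * y * real n0) * exp (- (pi * y) * \<bar>real_of_int n\<bar>)"
      by (simp only: exp_add mult.assoc)
  qed (use y in auto)
qed

lemma inc_Gamma_pos: "x > 0 \<Longrightarrow> inc_Gamma r x > 0"
proof -
  assume x: "x > 0"
  obtain C c where c: "C > 0" "c > 0" "\<And>y. y \<ge> x \<Longrightarrow> inc_Gamma r y \<le> C * exp (- 3 / 4 * y)"
    "\<And>y. y \<ge> x \<Longrightarrow> c * exp (- 5 / 4 * y) \<le> inc_Gamma r y"
    by (rule inc_Gamma_bounds[OF x, of r], rule that)
  have "0 < c * exp (- 5 / 4 * x)" using c(2) by simp
  also have "\<dots> \<le> inc_Gamma r x" by (rule c(4)) simp
  finally show ?thesis .
qed

lemma neg_arg: "n < 0 \<Longrightarrow> y > 0 \<Longrightarrow> - 4 * pi * real_of_int n * y = 4 * pi * y * \<bar>real_of_int n\<bar>"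
  and neg_arg_ge: "n < 0 \<Longrightarrow> y > 0 \<Longrightarrow> 4 * pi * y \<le> - 4 * pi * real_of_int n * y"
proof -
  assume n: "n < 0" and y: "y > 0"
  then show *: "- 4 * pi * real_of_int n * y = 4 * pi * y * \<bar>real_of_int n\<bar>" by simp
  have "(4 * pi * y) * 1 \<le> (4 * pi * y) * \<bar>real_of_int n\<bar>" using n y by (intro mult_left_mono) auto
  then show "4 * pi * y \<le> - 4 * pi * real_of_int n * y" unfolding * by simp
qed

text \<open>The Gamma factor is at most a multiple of \<open>exp (- 3 \<pi> \<bar>n\<bar> t)\<close>, against \<open>exp (2 \<pi> \<bar>n\<bar> t)\<close> from the
  character.  Of the remaining decay \<open>exp (- \<pi> \<bar>n\<bar> t)\<close>, half is spent on the coefficient.\<close>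

lemma nonhol_bound:
  assumes b: "subexp neg_index b" and y: "y > 0"
  obtains M where "\<And>n t. n < 0 \<Longrightarrow> t \<ge> y \<Longrightarrow>
    norm (b n) * inc_Gamma r (- 4 * pi * of_int n * t) * exp (- 2 * pi * of_int n * t)
      \<le> M * exp (- (pi / 2) * t * \<bar>real_of_int n\<bar>)" "M \<ge> 0"
proof -
  have "pi / 2 * y > 0" using y by simp
  then obtain M where M: "M \<ge> 0" "\<And>n. n \<in> neg_index \<Longrightarrow> norm (b n) \<le> M * exp (pi / 2 * y * \<bar>real_of_int n\<bar>)"
    using subexpD[OF b] by metis
  have y4: "4 * pi * y > 0" using y by simp
  obtain C c where C: "C > 0" "c > 0" "\<And>x. x \<ge> 4 * pi * y \<Longrightarrow> inc_Gamma r x \<le> C * exp (- 3 / 4 * x)"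
    "\<And>x. x \<ge> 4 * pi * y \<Longrightarrow> c * exp (- 5 / 4 * x) \<le> inc_Gamma r x"
    by (rule inc_Gamma_bounds[OF y4, of r], rule that)
  show ?thesis
  proof (rule that[of "M * C"])
    fix n :: int and t :: real assume n: "n < 0" and t: "t \<ge> y"
    have t0: "t > 0" using t y by simp
    have "4 * pi * y \<le> 4 * pi * t" using t by simp
    also have "\<dots> \<le> - 4 * pi * real_of_int n * t" by (rule neg_arg_ge[OF n t0])
    finally have x: "4 * pi * y \<le> - 4 * pi * real_of_int n * t" .
    have e: "exp (- 2 * pi * of_int n * t) = exp (2 * pi * t * \<bar>real_of_int n\<bar>)" using n by (simp add: mult_ac)
    have "norm (b n) * inc_Gamma r (- 4 * pi * of_int n * t) * exp (- 2 * pi * of_int n * t)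
        \<le> (M * exp (pi / 2 * t * \<bar>real_of_int n\<bar>)) * (C * exp (- 3 / 4 * (4 * pi * t * \<bar>real_of_int n\<bar>))) * exp (2 * pi * t * \<bar>real_of_int n\<bar>)"
      unfolding e
    proof (intro mult_right_mono mult_mono)
      have "norm (b n) \<le> M * exp (pi / 2 * y * \<bar>real_of_int n\<bar>)" using M(2)[of n] n by simp
      also have "\<dots> \<le> M * exp (pi / 2 * t * \<bar>real_of_int n\<bar>)" using t M(1) by (intro mult_left_mono) (auto intro!: mult_right_mono)
      finally show "norm (b n) \<le> M * exp (pi / 2 * t * \<bar>real_of_int n\<bar>)" .
      show "inc_Gamma r (- 4 * pi * of_int n * t) \<le> C * exp (- 3 / 4 * (4 * pi * t * \<bar>real_of_int n\<bar>))"
        using C(3)[OF x] unfolding neg_arg[OF n t0] .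
      have "0 < - 4 * pi * of_int n * t" using x y4 by linarith
      then show "0 \<le> inc_Gamma r (- 4 * pi * of_int n * t)" by (rule less_imp_le[OF inc_Gamma_pos])
    qed (use M(1) in auto)
    also have "\<dots> = M * C * (exp (pi / 2 * t * \<bar>real_of_int n\<bar>) * exp (- 3 / 4 * (4 * pi * t * \<bar>real_of_int n\<bar>)) * exp (2 * pi * t * \<bar>real_of_int n\<bar>))"
      by (simp only: mult_ac)
    also have "\<dots> = M * C * exp (- (pi / 2) * t * \<bar>real_of_int n\<bar>)"
      unfolding exp_add[symmetric] by (simp add: algebra_simps)
    finally show "norm (b n) * inc_Gamma r (- 4 * pi * of_int n * t) * exp (- 2 * pi * of_int n * t)
      \<le> M * C * exp (- (pi / 2) * t * \<bar>real_of_int n\<bar>)" .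
  qed (use M(1) C(1) in auto)
qed

lemma nonhol_summable:
  assumes b: "subexp neg_index b" and y: "y > 0"
  shows "(\<lambda>n. norm (b n) * inc_Gamma r (- 4 * pi * of_int n * y) * exp (- 2 * pi * of_int n * y)) summable_on neg_index"
proof -
  obtain M where M: "\<And>n t. n < 0 \<Longrightarrow> t \<ge> y \<Longrightarrow>
    norm (b n) * inc_Gamma r (- 4 * pi * of_int n * t) * exp (- 2 * pi * of_int n * t)
      \<le> M * exp (- (pi / 2) * t * \<bar>real_of_int n\<bar>)" "M \<ge> 0"
    by (rule nonhol_bound[OF b y, of r], rule that)
  show ?thesis
  proof (rule summable_on_exp_bound[where c = "pi / 2 * y" and M = M])
    fix n assume "n \<in> neg_index"
    then have n: "n < 0" by simp
    show "norm (b n) * inc_Gamma r (- 4 * pi * of_int n * y) * exp (- 2 * pi * of_int n * y) \<le> M * exp (- (pi / 2 * y) * \<bar>real_of_int n\<bar>)"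
      using M(1)[OF n order_refl] by (simp only: mult_minus_left)
    have "- 4 * pi * of_int n * y > 0" using neg_arg_ge[OF n y] y by (smt (verit) mult_pos_pos pi_gt_zero)
    then have "inc_Gamma r (- 4 * pi * of_int n * y) > 0" by (rule inc_Gamma_pos)
    then show "0 \<le> norm (b n) * inc_Gamma r (- 4 * pi * of_int n * y) * exp (- 2 * pi * of_int n * y)"
      by (intro mult_nonneg_nonneg) auto
  qed (use y in auto)
qed

lemma has_sum_zero_extension:
  "((\<lambda>n. if n \<in> S then g n else 0) has_sum A) UNIV \<longleftrightarrow> (g has_sum A) S"
  by (rule has_sum_cong_neutral) auto

lemma maass_expansion_has_sum:
  assumes e: "maass_expansion k f n0 a b" and y: "y > 0"
  shows "((\<lambda>n. fourier_term k n0 a b n y * echar n x) has_sum f (Complex x y)) UNIV"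
proof -
  obtain A B where A: "((\<lambda>n. a n * exp (2 * of_real pi * \<i> * of_int n * Complex x y)) has_sum A) (hol_index n0)"
    and B: "((\<lambda>n. b n * of_real (inc_Gamma (1 - of_int k) (- 4 * pi * of_int n * Im (Complex x y)))
                  * exp (2 * of_real pi * \<i> * of_int n * Complex x y)) has_sum B) neg_index"
    and f: "f (Complex x y) = A + B"
    using bspec[OF e[unfolded maass_expansion_def] Complex_in_upper[THEN iffD2, OF y, of x]] by blast
  from has_sum_add[OF has_sum_zero_extension[THEN iffD2, OF A] has_sum_zero_extension[THEN iffD2, OF B]]
  show ?thesis
    unfolding f exp_eq_echar
    by (rule has_sum_cong[THEN iffD1, rotated]) (auto simp: fourier_term_def algebra_simps)
qed

lemma maass_expansion_imp_coeff:
  assumes e: "maass_expansion k f n0 a b" and f: "C1_periodic f" and y: "y > 0"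
  shows "fourier_coeff (\<lambda>x. f (Complex x y)) n = fourier_term k n0 a b n y"
proof (rule fourier_coeff_of_series)
  show "continuous_on {0..1} (\<lambda>x. f (Complex x y))" by (rule C1_continuous_line[OF f y])
  show "((\<lambda>n. fourier_term k n0 a b n y * echar n x) has_sum f (Complex x y)) UNIV" for x
    by (rule maass_expansion_has_sum[OF e y])
  from this[of 0] have "(\<lambda>n. fourier_term k n0 a b n y) summable_on UNIV" by (auto simp: summable_on_def)
  then show "(\<lambda>n. norm (fourier_term k n0 a b n y)) summable_on UNIV"
    by (simp add: summable_on_iff_abs_summable_on_complex)
qed

text \<open>On each line the Fourier coefficients are bounded, and the line can be taken close to the real axis.
  The height \<open>\<delta> / (2 \<pi>)\<close> gives the rate \<open>\<delta>\<close> for \<open>a\<close>.  For \<open>b\<close> the Gamma factor is bounded below by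
  \<open>exp (- 5 \<pi> \<bar>n\<bar> y)\<close>, against \<open>exp (2 \<pi> \<bar>n\<bar> y)\<close> from the character; hence the height
  \<open>\<delta> / (3 \<pi>)\<close>.\<close>

lemma coeff_imp_subexp:
  assumes f: "C1_periodic f"
    and c: "\<And>n y. y > 0 \<Longrightarrow> fourier_coeff (\<lambda>x. f (Complex x y)) n = fourier_term k n0 a b n y"
  shows "subexp (hol_index n0) a" and "subexp neg_index b"
proof -
  show "subexp (hol_index n0) a"
  proof (rule subexp_cofinite[where T = "{0<..}"])
    show "finite (hol_index n0 - {0<..})"
      by (rule finite_subset[of _ "{- int n0..0}"]) auto
    fix \<delta> :: real assume \<delta>: "\<delta> > 0"
    define y where "y = \<delta> / (2 * pi)"
    have y: "y > 0" "2 * pi * y = \<delta>" using \<delta> by (simp_all add: y_def)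
    obtain M where M: "M \<ge> 0" "\<And>n. norm (fourier_coeff (\<lambda>x. f (Complex x y)) n) \<le> M"
      by (rule C1_fourier_coeff_bound[OF f y(1)], rule that)
    show "\<exists>M. \<forall>n\<in>hol_index n0 \<inter> {0<..}. norm (a n) \<le> M * exp (\<delta> * \<bar>real_of_int n\<bar>)"
    proof (intro exI[of _ M] ballI)
      fix n assume "n \<in> hol_index n0 \<inter> {0<..}"
      then have n: "n > 0" by simp
      have "norm (a n) * exp (- 2 * pi * of_int n * y) \<le> M"
        using M(2)[of n] n by (simp add: c[OF y(1)] fourier_term_def norm_mult)
      then have "norm (a n) * exp (- 2 * pi * of_int n * y) * exp (\<delta> * \<bar>real_of_int n\<bar>) \<le> M * exp (\<delta> * \<bar>real_of_int n\<bar>)"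
        by (rule mult_right_mono) simp
      moreover have "exp (- 2 * pi * of_int n * y) * exp (\<delta> * \<bar>real_of_int n\<bar>) = 1"
        unfolding exp_add[symmetric] y(2)[symmetric] using n by simp
      ultimately show "norm (a n) \<le> M * exp (\<delta> * \<bar>real_of_int n\<bar>)" by (simp only: mult.assoc mult_1_right)
    qed
  qed
  show "subexp neg_index b"
  proof (rule subexp_cofinite[where T = "{..<- int n0}"])
    show "finite (neg_index - {..<- int n0})"
      by (rule finite_subset[of _ "{- int n0..0}"]) auto
    fix \<delta> :: real assume \<delta>: "\<delta> > 0"
    define y where "y = \<delta> / (3 * pi)"
    have y: "y > 0" "3 * pi * y = \<delta>" using \<delta> by (simp_all add: y_def)
    obtain M where M: "M \<ge> 0" "\<And>n. norm (fourier_coeff (\<lambda>x. f (Complex x y)) n) \<le> M"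
      by (rule C1_fourier_coeff_bound[OF f y(1)], rule that)
    have y4: "4 * pi * y > 0" using y(1) by simp
    obtain C c' where C: "C > 0" "c' > 0" "\<And>x. x \<ge> 4 * pi * y \<Longrightarrow> inc_Gamma (1 - of_int k) x \<le> C * exp (- 3 / 4 * x)"
      "\<And>x. x \<ge> 4 * pi * y \<Longrightarrow> c' * exp (- 5 / 4 * x) \<le> inc_Gamma (1 - of_int k) x"
      by (rule inc_Gamma_bounds[OF y4, of "1 - of_int k"], rule that)
    show "\<exists>M. \<forall>n\<in>neg_index \<inter> {..<- int n0}. norm (b n) \<le> M * exp (\<delta> * \<bar>real_of_int n\<bar>)"
    proof (intro exI[of _ "M / c'"] ballI)
      fix n assume "n \<in> neg_index \<inter> {..<- int n0}"
      then have n: "n < 0" "n < - int n0" by auto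
      let ?x = "- 4 * pi * real_of_int n * y"
      have e: "exp (- 2 * pi * of_int n * y) = exp (2 * pi * y * \<bar>real_of_int n\<bar>)" using n by (simp add: mult_ac)
      have "norm (b n) * (c' * exp (- 5 / 4 * ?x)) * exp (2 * pi * y * \<bar>real_of_int n\<bar>)
          \<le> norm (b n) * inc_Gamma (1 - of_int k) ?x * exp (2 * pi * y * \<bar>real_of_int n\<bar>)"
        by (intro mult_right_mono mult_left_mono C(4) neg_arg_ge n y) auto
      also have "\<dots> \<le> M"
      proof -
        have "?x > 0" using neg_arg_ge[OF n(1) y(1)] y4 by linarith
        then have "\<bar>inc_Gamma (1 - of_int k) ?x\<bar> = inc_Gamma (1 - of_int k) ?x" using inc_Gamma_pos[of ?x] by (simp only: abs_of_pos)
        moreover have "norm (fourier_term k n0 a b n y) = norm (b n) * \<bar>inc_Gamma (1 - of_int k) ?x\<bar> * exp (- 2 * pi * of_int n * y)"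
          using n by (simp add: fourier_term_def norm_mult)
        ultimately show ?thesis using M(2)[of n] unfolding c[OF y(1)] e by simp
      qed
      finally have "norm (b n) * (c' * exp (- 5 / 4 * ?x)) * exp (2 * pi * y * \<bar>real_of_int n\<bar>) * exp (\<delta> * \<bar>real_of_int n\<bar>) \<le> M * exp (\<delta> * \<bar>real_of_int n\<bar>)"
        by (rule mult_right_mono) simp
      moreover have "norm (b n) * (c' * exp (- 5 / 4 * ?x)) * exp (2 * pi * y * \<bar>real_of_int n\<bar>) * exp (\<delta> * \<bar>real_of_int n\<bar>)
          = norm (b n) * c' * exp (- 5 / 4 * ?x + 2 * pi * y * \<bar>real_of_int n\<bar> + \<delta> * \<bar>real_of_int n\<bar>)"
        by (simp only: exp_add mult_ac)
      moreover have "- 5 / 4 * ?x + 2 * pi * y * \<bar>real_of_int n\<bar> + \<delta> * \<bar>real_of_int n\<bar> = 0"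
        unfolding neg_arg[OF n(1) y(1)] y(2)[symmetric] by (simp add: algebra_simps)
      ultimately have "norm (b n) * c' \<le> M * exp (\<delta> * \<bar>real_of_int n\<bar>)" by (simp only: exp_zero mult_1_right)
      then show "norm (b n) \<le> M / c' * exp (\<delta> * \<bar>real_of_int n\<bar>)" using C(2) by (simp add: field_simps)
    qed
  qed
qed

text \<open>Both parts converge absolutely by the growth of \<open>a\<close> and \<open>b\<close>, so the sum given by Fourier
  inversion may be split.\<close>

lemma coeff_imp_maass_expansion:
  assumes f: "C1_periodic f"
    and c: "\<And>n y. y > 0 \<Longrightarrow> fourier_coeff (\<lambda>x. f (Complex x y)) n = fourier_term k n0 a b n y"
  shows "maass_expansion k f n0 a b"
  unfolding maass_expansion_def
proof
  fix z assume "z \<in> upper_half_plane"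
  then obtain x y where z: "z = Complex x y" and y: "y > 0"
    by (metis Complex_in_upper complex_surj)
  note s = coeff_imp_subexp[OF f c]
  define F where "F n = a n * exp (2 * of_real pi * \<i> * of_int n * z)" for n
  define G where "G n = b n * of_real (inc_Gamma (1 - of_int k) (- 4 * pi * of_int n * Im z)) * exp (2 * of_real pi * \<i> * of_int n * z)" for n
  have "(\<lambda>n. norm (F n)) summable_on hol_index n0"
    using hol_summable[OF s(1) y] unfolding F_def exp_eq_echar by (simp add: norm_mult z)
  then have Fs: "(\<lambda>n. norm (if n \<in> hol_index n0 then F n else 0)) summable_on UNIV"
    by (rule summable_on_cong_neutral[THEN iffD1, rotated -1]) auto
  have "(\<lambda>n. norm (G n)) summable_on neg_index"
  proof (rule summable_on_cong[THEN iffD1, OF _ nonhol_summable[OF s(2) y, of "1 - of_int k"]])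
    fix n assume "n \<in> neg_index"
    then have n: "n < 0" by simp
    have "- 4 * pi * real_of_int n * y > 0" using neg_arg_ge[OF n y] y by (smt (verit) mult_pos_pos pi_gt_zero)
    then have "inc_Gamma (1 - of_int k) (- 4 * pi * real_of_int n * y) > 0" by (rule inc_Gamma_pos)
    then show "norm (b n) * inc_Gamma (1 - of_int k) (- 4 * pi * of_int n * y) * exp (- 2 * pi * of_int n * y) = norm (G n)"
      unfolding G_def exp_eq_echar by (simp add: norm_mult z)
  qed
  then have Gs: "(\<lambda>n. norm (if n \<in> neg_index then G n else 0)) summable_on UNIV"
    by (rule summable_on_cong_neutral[THEN iffD1, rotated -1]) auto
  obtain A where A: "((\<lambda>n. if n \<in> hol_index n0 then F n else 0) has_sum A) UNIV"
    using abs_summable_summable[OF Fs] by (auto simp: summable_on_def)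
  obtain B where B: "((\<lambda>n. if n \<in> neg_index then G n else 0) has_sum B) UNIV"
    using abs_summable_summable[OF Gs] by (auto simp: summable_on_def)
  have eq: "fourier_term k n0 a b n y * echar n x = (if n \<in> hol_index n0 then F n else 0) + (if n \<in> neg_index then G n else 0)" for n
    unfolding F_def G_def exp_eq_echar by (auto simp: fourier_term_def z algebra_simps)
  have "(\<lambda>n. norm (fourier_coeff (\<lambda>x. f (Complex x y)) n)) summable_on UNIV"
  proof (rule summable_on_comparison_test[OF summable_on_add[OF Fs Gs]])
    fix n :: int
    have "norm (fourier_coeff (\<lambda>x. f (Complex x y)) n) = norm (fourier_term k n0 a b n y * echar n x)"
      by (simp add: c[OF y] norm_mult)
    also have "\<dots> \<le> norm (if n \<in> hol_index n0 then F n else 0) + norm (if n \<in> neg_index then G n else 0)"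
      unfolding eq by (rule norm_triangle_ineq)
    finally show "norm (fourier_coeff (\<lambda>x. f (Complex x y)) n) \<le> \<dots>" .
  qed simp
  from C1_fourier_inversion[OF f y this, of x]
  have "((\<lambda>n. (if n \<in> hol_index n0 then F n else 0) + (if n \<in> neg_index then G n else 0)) has_sum f z) UNIV"
    unfolding c[OF y] eq z .
  then have "f z = A + B" using has_sum_add[OF A B] by (rule has_sum_unique)
  then show "\<exists>A B. ((\<lambda>n. a n * exp (2 * of_real pi * \<i> * of_int n * z)) has_sum A) (hol_index n0) \<and>
    ((\<lambda>n. b n * of_real (inc_Gamma (1 - of_int k) (- 4 * pi * of_int n * Im z)) * exp (2 * of_real pi * \<i> * of_int n * z)) has_sum B) neg_index \<and>
    f z = A + B"
    using A B unfolding has_sum_zero_extension F_def G_def by blast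
qed

lemma ex_maass_expansion:
  assumes f: "f \<in> HC k N"
  obtains n0 a b where "maass_expansion k f n0 a b"
proof -
  have "C1_periodic f" using f harmonic_maass_form_C1(1) unfolding HC_def by blast
  then show ?thesis
    using maass_coeff_fourier_term[OF f] coeff_imp_maass_expansion that by metis
qed

section \<open>The expansion of the image under the operator xi\<close>

text \<open>The factor \<open>exp (- 2 \<pi> n y)\<close> is annihilated by \<open>2 \<pi> n + d/dy\<close>, so only the derivative of the
  Gamma factor contributes.\<close>

lemma d_zbar_coeff:
  assumes f: "C1_periodic f" and e: "maass_expansion k f n0 a b" and y: "y > 0"
  shows "fourier_coeff (\<lambda>x. d_zbar f (Complex x y)) n = (if n < 0 then
      - \<i> / 2 * b n * of_real ((- 4 * pi * of_int n) powr (1 - of_int k) * (y powr (- of_int k) * exp (2 * pi * of_int n * y))) else 0)"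
proof -
  \<comment> \<open>outside the two index sets the terms are absent, whatever the values of \<open>a\<close> and \<open>b\<close>\<close>
  define A where "A = (if n \<ge> - int n0 \<and> n \<noteq> 0 then a n else 0)"
  define B where "B = (if n < 0 then b n else 0)"
  define \<Gamma> where "\<Gamma> y = inc_Gamma (1 - of_int k) (- 4 * pi * of_int n * y)" for y
  define E where "E y = exp (- 2 * pi * of_int n * y)" for y
  have c: "fourier_coeff (\<lambda>x. f (Complex x y)) n = (A + B * of_real (\<Gamma> y)) * of_real (E y)" if "y > 0" for y
    unfolding maass_expansion_imp_coeff[OF e f that] fourier_term_def A_def B_def \<Gamma>_def E_def
    by (simp add: algebra_simps)
  define \<gamma> where "\<gamma> = - ((- 4 * pi * of_int n) powr (1 - of_int k)) * (y powr (- of_int k) * exp (4 * pi * of_int n * y))"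
  have Ed: "(E has_real_derivative - 2 * pi * of_int n * E y) (at y)"
    unfolding E_def by (auto intro!: derivative_eq_intros)
  have BG: "((\<lambda>y. B * of_real (\<Gamma> y)) has_vector_derivative B * of_real \<gamma>) (at y)"
  proof (cases "n < 0")
    case True
    then show ?thesis unfolding \<Gamma>_def \<gamma>_def
      by (intro has_vector_derivative_mult_right has_vector_derivative_of_real_fun inc_Gamma_scaled_deriv y)
  qed (simp add: B_def)
  have "((\<lambda>y. (A + B * of_real (\<Gamma> y)) * of_real (E y)) has_vector_derivative
      ((A + B * of_real (\<Gamma> y)) * of_real (- 2 * pi * of_int n * E y) + (0 + B * of_real \<gamma>) * of_real (E y))) (at y)"
    by (intro has_vector_derivative_mult has_vector_derivative_add has_vector_derivative_const BG has_vector_derivative_of_real_fun Ed)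
  then have d: "((\<lambda>y. fourier_coeff (\<lambda>x. f (Complex x y)) n) has_vector_derivative
      ((A + B * of_real (\<Gamma> y)) * of_real (- 2 * pi * of_int n * E y) + (0 + B * of_real \<gamma>) * of_real (E y))) (at y)"
    by (rule has_vector_derivative_transform_within_open[of _ _ _ "{0<..}"]) (use y c in auto)
  have "fourier_coeff (\<lambda>x. d_zbar f (Complex x y)) n = \<i> / 2 * (B * (of_real \<gamma> * of_real (E y)))"
    unfolding fourier_coeff_d_zbar(1)[OF f y d] c[OF y] by (simp add: algebra_simps)
  also have "of_real \<gamma> * of_real (E y) = (of_real (- ((- 4 * pi * of_int n) powr (1 - of_int k)
      * (y powr (- of_int k) * (exp (4 * pi * of_int n * y) * E y)))) :: complex)"
    unfolding \<gamma>_def of_real_mult[symmetric] by (simp only: mult_minus_left mult.assoc)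
  also have "exp (4 * pi * of_int n * y) * E y = exp (2 * pi * of_int n * y)"
    unfolding E_def exp_add[symmetric] by simp
  finally show ?thesis by (simp add: B_def)
qed

lemma xi_conj_form:
  assumes f: "C1_periodic f" and z: "z \<in> upper_half_plane"
  shows "xi k (conj_form f) z = - 2 * \<i> * of_real (Im z) powi k * d_zbar f (- cnj z)"
proof -
  have z': "- cnj z \<in> upper_half_plane" using z by (simp add: upper_half_plane_def)
  then have "f differentiable (at (- cnj z))" using f by (simp add: C1_periodic_def)
  then have D: "(f has_derivative frechet_derivative f (at (- cnj z))) (at (- cnj z))"
    by (simp add: frechet_derivative_works)
  have "((\<lambda>z. - cnj z) has_derivative (\<lambda>h. - cnj h)) (at z)"
    by (intro has_derivative_minus bounded_linear.has_derivative[OF bounded_linear_cnj] has_derivative_ident)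
  from bounded_linear.has_derivative[OF bounded_linear_cnj has_derivative_compose[OF this D]]
  have "(conj_form f has_derivative (\<lambda>h. cnj (frechet_derivative f (at (- cnj z)) (- cnj h)))) (at z)"
    by (simp add: conj_form_def[abs_def])
  note e = frechet_derivative_at[OF this, symmetric]
  have "linear (frechet_derivative f (at (- cnj z)))" using has_derivative_linear[OF D] .
  then have "frechet_derivative f (at (- cnj z)) (- 1) = - dx f (- cnj z)"
    unfolding dx_def using linear_neg by blast
  then have "d_zbar (conj_form f) z = - cnj (d_zbar f (- cnj z))"
    unfolding d_zbar_def dx_def[of "conj_form f"] dy_def[of "conj_form f"] e
    by (simp add: dy_def[of f] field_simps)
  then show ?thesis by (simp add: xi_def)
qed

text \<open>The coefficients of \<open>\<xi>\<^sub>k f\<^sup>c\<close>; the index \<open>n < 0\<close> belongs to the character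
  \<open>exp (- 2 \<pi> \<i> n z)\<close>.\<close>

definition xi_coeff :: "int \<Rightarrow> (int \<Rightarrow> complex) \<Rightarrow> int \<Rightarrow> complex" where
  "xi_coeff k b n = - b n * of_real ((- 4 * pi * of_int n) powr (1 - of_int k))"

lemma xi_coeff_subexp:
  assumes "subexp neg_index b"
  shows "subexp neg_index (xi_coeff k b)"
  unfolding subexp_def
proof (intro allI impI)
  fix \<delta> :: real assume \<delta>: "\<delta> > 0"
  obtain M where M: "M \<ge> 0" "\<And>n. n \<in> neg_index \<Longrightarrow> norm (b n) \<le> M * exp (\<delta> / 2 * \<bar>real_of_int n\<bar>)"
    by (rule subexpD[OF assms half_gt_zero[OF \<delta>]], rule that)
  have p: "\<delta> / (8 * pi) > 0" "4 * pi > 0" using \<delta> by auto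
  obtain C where C: "C > 0" "\<And>x. x \<ge> 4 * pi \<Longrightarrow> x powr (1 - of_int k) \<le> C * exp (\<delta> / (8 * pi) * x)"
    by (rule powr_le_exp[OF p, of "1 - of_int k"], rule that)
  show "\<exists>M. \<forall>n\<in>neg_index. norm (xi_coeff k b n) \<le> M * exp (\<delta> * \<bar>real_of_int n\<bar>)"
  proof (intro exI[of _ "M * C"] ballI)
    fix n assume n: "n \<in> neg_index"
    have x: "4 * pi \<le> - 4 * pi * of_int n" "- 4 * pi * of_int n = 4 * pi * \<bar>real_of_int n\<bar>"
      using neg_arg_ge[of n 1] neg_arg[of n 1] n by auto
    have "norm (xi_coeff k b n) = norm (b n) * (- 4 * pi * of_int n) powr (1 - of_int k)"
      by (simp add: xi_coeff_def norm_mult)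
    also have "\<dots> \<le> (M * exp (\<delta> / 2 * \<bar>real_of_int n\<bar>)) * (C * exp (\<delta> / (8 * pi) * (4 * pi * \<bar>real_of_int n\<bar>)))"
      using C(2)[OF x(1)] M n unfolding x(2) by (intro mult_mono) auto
    also have "\<delta> / (8 * pi) * (4 * pi * \<bar>real_of_int n\<bar>) = \<delta> / 2 * \<bar>real_of_int n\<bar>" by simp
    also have "(M * exp (\<delta> / 2 * \<bar>real_of_int n\<bar>)) * (C * exp (\<delta> / 2 * \<bar>real_of_int n\<bar>))
        = M * C * exp (\<delta> / 2 * \<bar>real_of_int n\<bar> + \<delta> / 2 * \<bar>real_of_int n\<bar>)" by (simp only: exp_add mult_ac)
    also have "\<delta> / 2 * \<bar>real_of_int n\<bar> + \<delta> / 2 * \<bar>real_of_int n\<bar> = \<delta> * \<bar>real_of_int n\<bar>" by simp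
    finally show "norm (xi_coeff k b n) \<le> M * C * exp (\<delta> * \<bar>real_of_int n\<bar>)" .
  qed
qed

text \<open>The factor \<open>y powr (- k)\<close> in the coefficients of \<open>d_zbar f\<close> cancels against \<open>y powi k\<close> in the
  definition of \<open>xi\<close>, and the terms become holomorphic in \<open>z\<close>.\<close>

lemma xi_expansion:
  assumes f: "C1_periodic f" and h: "C1_periodic (d_zbar f)" and e: "maass_expansion k f n0 a b"
    and z: "z \<in> upper_half_plane"
  shows "((\<lambda>n. xi_coeff k b n * exp (- (2 * of_real pi * \<i> * of_int n * z))) has_sum xi k (conj_form f) z) neg_index"
proof -
  obtain x y where xy: "- cnj z = Complex x y" by (metis complex_surj)
  have y: "y = Im z" "x = - Re z" using xy by (simp_all add: complex_eq_iff)
  have y0: "y > 0" using z y by (simp add: upper_half_plane_def)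
  note s = coeff_imp_subexp(2)[OF f maass_expansion_imp_coeff[OF e f]]
  define H where "H n = fourier_coeff (\<lambda>x. d_zbar f (Complex x y)) n" for n
  have H: "H n = (if n \<in> neg_index then \<i> / 2 * of_real (y powr (- of_int k)) * (xi_coeff k b n * of_real (exp (2 * pi * of_int n * y))) else 0)" for n
    unfolding H_def d_zbar_coeff[OF f e y0] by (simp add: xi_coeff_def)
  have "pi * y > 0" using y0 by simp
  then obtain M where M: "M \<ge> 0" "\<And>n. n \<in> neg_index \<Longrightarrow> norm (xi_coeff k b n) \<le> M * exp (pi * y * \<bar>real_of_int n\<bar>)"
    using subexpD[OF xi_coeff_subexp[OF s, of k]] by metis
  have "(\<lambda>n. norm (H n)) summable_on UNIV"
  proof (rule summable_on_exp_bound[where c = "pi * y" and M = "y powr (- of_int k) / 2 * M"])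
    fix n :: int
    show "norm (H n) \<le> y powr (- of_int k) / 2 * M * exp (- (pi * y) * \<bar>real_of_int n\<bar>)"
    proof (cases "n \<in> neg_index")
      case True
      then have en: "exp (2 * pi * of_int n * y) = exp (- (2 * pi * y * \<bar>real_of_int n\<bar>))" by (simp add: mult_ac)
      have "norm (H n) = y powr (- of_int k) / 2 * (norm (xi_coeff k b n) * exp (2 * pi * of_int n * y))"
        unfolding H using True by (simp add: norm_mult)
      also have "\<dots> \<le> y powr (- of_int k) / 2 * ((M * exp (pi * y * \<bar>real_of_int n\<bar>)) * exp (- (2 * pi * y * \<bar>real_of_int n\<bar>)))"
        unfolding en by (intro mult_left_mono mult_right_mono M True) auto
      also have "\<dots> = y powr (- of_int k) / 2 * M * exp (pi * y * \<bar>real_of_int n\<bar> + - (2 * pi * y * \<bar>real_of_int n\<bar>))"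
        by (simp only: exp_add mult.assoc)
      also have "pi * y * \<bar>real_of_int n\<bar> + - (2 * pi * y * \<bar>real_of_int n\<bar>) = - (pi * y) * \<bar>real_of_int n\<bar>" by simp
      finally show ?thesis .
    qed (use M(1) in \<open>simp add: H\<close>)
  qed (use y0 in auto)
  from C1_fourier_inversion[OF h y0 this[unfolded H_def], of x]
  have hs: "((\<lambda>n. H n * echar n x) has_sum d_zbar f (- cnj z)) UNIV"
    unfolding H_def xy .
  let ?c = "- 2 * \<i> * of_real (Im z) powi k :: complex"
  have pw: "of_real (Im z) powi k * of_real (y powr (- of_int k)) = (1::complex)"
  proof -
    have "of_real (Im z) powi k = (of_real (y powr of_int k) :: complex)"
      using y0 y(1) by (simp add: powr_real_of_int' of_real_power_int)
    moreover have "y powr of_int k * y powr (- of_int k) = 1" using y0 by (simp add: powr_add[symmetric])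
    ultimately show ?thesis by (simp only: of_real_mult[symmetric]) simp
  qed
  have eqn: "?c * (H n * echar n x) = (if n \<in> neg_index then xi_coeff k b n * exp (- (2 * of_real pi * \<i> * of_int n * z)) else 0)" for n
  proof (cases "n \<in> neg_index")
    case True
    have "exp (- (2 * of_real pi * \<i> * of_int n * z)) = of_real (exp (2 * pi * of_int n * y)) * echar n x"
      using exp_eq_echar[of "- n" z] by (simp add: y echar_def mult_ac)
    moreover have "?c * (H n * echar n x) = (- 2 * \<i> * (\<i> / 2)) * (of_real (Im z) powi k * of_real (y powr (- of_int k)))
        * (xi_coeff k b n * (of_real (exp (2 * pi * of_int n * y)) * echar n x))"
      unfolding H by (simp only: True if_True mult_ac)
    ultimately show ?thesis unfolding pw using True by simp
  qed (simp add: H)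
  from has_sum_cmult_right[OF hs, of ?c]
  show ?thesis unfolding eqn has_sum_zero_extension xi_conj_form[OF f z] .
qed

section \<open>Laplace integrals on the horizontal ray\<close>

text \<open>The function \<open>exp (\<i> t w z) z\<^sup>s\<^sup>-\<^sup>1\<close> at the point \<open>z = \<i> + x\<close>.\<close>

definition ray_kernel :: "real \<Rightarrow> complex \<Rightarrow> real \<Rightarrow> real \<Rightarrow> complex" where
  "ray_kernel s w t x =
     exp (\<i> * of_real t * w * (\<i> + of_real x)) * (\<i> + of_real x) powr (of_real s - 1)"

lemma ray_point_not_slit: "x \<ge> 0 \<Longrightarrow> \<i> + complex_of_real x \<notin> \<real>\<^sub>\<le>\<^sub>0"
  by (simp add: complex_nonpos_Reals_iff)

lemma norm_exp_ray: "norm (exp (\<i> * of_real t * w * (\<i> + of_real x))) = exp (- t * Re w - t * x * Im w)"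
  by (simp add: algebra_simps)

lemma ray_kernel_shift:
  "ray_kernel s (c + w) t x = exp (\<i> * of_real t * c * (\<i> + of_real x)) * ray_kernel s w t x"
  by (simp add: ray_kernel_def exp_add[symmetric] algebra_simps)

lemma continuous_on_ray_powr:
  assumes "continuous_on S g" "\<And>p. p \<in> S \<Longrightarrow> g p \<ge> 0"
  shows "continuous_on S (\<lambda>p. (\<i> + complex_of_real (g p)) powr c)"
proof (rule continuous_on_compose2[of "- \<real>\<^sub>\<le>\<^sub>0" "\<lambda>z. z powr c"])
  show "continuous_on (- \<real>\<^sub>\<le>\<^sub>0) (\<lambda>z::complex. z powr c)"
    by (intro holomorphic_on_imp_continuous_on holomorphic_intros) auto
  show "continuous_on S (\<lambda>p. \<i> + complex_of_real (g p))" by (intro continuous_intros assms)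
qed (use assms(2) ray_point_not_slit in auto)

lemma continuous_on_ray_kernel:
  assumes "continuous_on S t" "continuous_on S x" "\<And>p. p \<in> S \<Longrightarrow> x p \<ge> 0"
  shows "continuous_on S (\<lambda>p. ray_kernel s w (t p) (x p))"
  unfolding ray_kernel_def
  by (intro continuous_on_mult continuous_on_exp continuous_intros assms continuous_on_ray_powr)

text \<open>Writing \<open>\<i> + x = \<i> (1 - \<i> x)\<close> reduces this to \<open>upper_Gamma_rotated\<close>.\<close>

lemma ray_kernel_integral:
  assumes u: "Im u > 0" and t: "t > 0"
  shows "set_integrable lborel {0..} (ray_kernel s u t)"
    and "(LINT x:{0..}|lborel. ray_kernel s u t x)
      = \<i> powr of_real s * (of_real (t powr (- s)) * (u powr (- of_real s) * upper_Gamma s (u * of_real t)))"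
proof -
  let ?h = "\<lambda>x::real. exp (- (u * of_real t * (1 - \<i> * of_real x))) * (1 - \<i> * of_real x) powr (of_real s - 1)"
  note rot = upper_Gamma_rotated[OF u t, of s]
  have eq: "ray_kernel s u t x = \<i> powr (of_real s - 1) * ?h x" if "x \<ge> 0" for x
  proof -
    have i: "\<i> + of_real x = \<i> * (1 - \<i> * of_real x)" by (simp add: algebra_simps)
    have "(\<i> * (1 - \<i> * of_real x)) powr (of_real s - 1) = \<i> powr (of_real s - 1) * (1 - \<i> * of_real x) powr (of_real s - 1)"
      using that by (intro powr_mult_upper_lower) auto
    moreover have "\<i> * of_real t * u * (\<i> * (1 - \<i> * of_real x)) = - (u * of_real t * (1 - \<i> * of_real x))"
      by (simp add: algebra_simps)
    ultimately show ?thesis unfolding ray_kernel_def i by (simp only: mult_ac)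
  qed
  have "set_integrable lborel {0..} (\<lambda>x. \<i> powr (of_real s - 1) * ?h x)"
    by (rule set_integrable_mult_right) (rule rot(1))
  then show "set_integrable lborel {0..} (ray_kernel s u t)"
    by (subst set_integrable_cong[OF refl refl eq]) auto
  have "(LINT x:{0..}|lborel. ray_kernel s u t x) = (LINT x:{0..}|lborel. \<i> powr (of_real s - 1) * ?h x)"
    by (rule set_lebesgue_integral_cong, simp, intro allI impI, rule eq, simp)
  also have "\<dots> = \<i> powr (of_real s - 1) * (LINT x:{0..}|lborel. ?h x)"
    by (rule set_integral_mult_right)
  also have "\<dots> = (\<i> powr (of_real s - 1) * \<i>) * (of_real (t powr (- s)) * (u powr (- of_real s) * upper_Gamma s (u * of_real t)))"
    unfolding rot(2) by (simp only: mult.assoc)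
  also have "\<i> powr (of_real s - 1) * \<i> = \<i> powr of_real s"
    using powr_add[of \<i> "of_real s - 1" 1] by simp
  finally show "(LINT x:{0..}|lborel. ray_kernel s u t x)
      = \<i> powr of_real s * (of_real (t powr (- s)) * (u powr (- of_real s) * upper_Gamma s (u * of_real t)))" .
qed

text \<open>Half of the decay \<open>exp (- x Im w)\<close> absorbs the power of \<open>z\<close>.  The bound is uniform in \<open>t\<close> because
  \<open>exp (- t Re w) \<le> 1\<close>.\<close>

lemma ray_kernel_bound:
  assumes w: "Im w > 0" "Re w \<ge> 0"
  obtains C where "C > 0"
    "\<And>t x. t \<ge> 1 \<Longrightarrow> x \<ge> 0 \<Longrightarrow> norm (ray_kernel s w t x) \<le> C * exp (- (Im w / 2) * x)"
proof -
  have h: "Im w / 2 > 0" using w by simp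
  obtain C where C: "C > 0" "\<And>x. x \<ge> 1 \<Longrightarrow> x powr (s - 1) \<le> C * exp (Im w / 2 * x)"
    by (rule powr_le_exp[OF h zero_less_one, of "s - 1"], rule that)
  show ?thesis
  proof (rule that[of "C * exp (Im w / 2)"])
    fix t x :: real assume t: "t \<ge> 1" and x: "x \<ge> 0"
    let ?z = "\<i> + complex_of_real x"
    have z1: "norm ?z \<ge> 1" using abs_Im_le_cmod[of ?z] by simp
    have z2: "norm ?z \<le> 1 + x" using norm_triangle_ineq[of \<i> "of_real x"] x by simp
    have "norm (?z powr (of_real s - 1)) = norm ?z powr (s - 1)"
      using norm_powr_real_powr'[of "of_real s - 1" ?z] by simp
    also have "\<dots> \<le> C * exp (Im w / 2 * norm ?z)" by (rule C(2)[OF z1])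
    also have "\<dots> \<le> C * exp (Im w / 2 * (1 + x))"
      using C(1) z2 w by (intro mult_left_mono) auto
    finally have p: "norm (?z powr (of_real s - 1)) \<le> C * exp (Im w / 2 * (1 + x))" .
    have "x * Im w * 1 \<le> x * Im w * t" using t x w by (intro mult_left_mono) auto
    moreover have "0 \<le> t * Re w" using t w by simp
    ultimately have "exp (- t * Re w - t * x * Im w) \<le> exp (- (x * Im w))" by (simp add: mult_ac)
    then have "norm (ray_kernel s w t x) \<le> exp (- (x * Im w)) * (C * exp (Im w / 2 * (1 + x)))"
      unfolding ray_kernel_def norm_mult norm_exp_ray by (intro mult_mono p) auto
    also have "\<dots> = C * exp (- (x * Im w) + Im w / 2 * (1 + x))" unfolding exp_add by (simp only: mult_ac)
    also have "- (x * Im w) + Im w / 2 * (1 + x) = Im w / 2 + - (Im w / 2) * x" by (simp add: field_simps)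
    finally show "norm (ray_kernel s w t x) \<le> C * exp (Im w / 2) * exp (- (Im w / 2) * x)"
      by (simp only: exp_add mult.assoc)
  qed (use C(1) in auto)
qed

text \<open>For \<open>Re u > 0\<close> this is the integral of \<open>exp (- u v) v\<^sup>s\<^sup>-\<^sup>1\<close> over \<open>v \<ge> t\<close>; the formula continues it
  to all \<open>u\<close> with \<open>Im u > 0\<close>.\<close>

definition ray_Gamma :: "real \<Rightarrow> complex \<Rightarrow> real \<Rightarrow> complex" where
  "ray_Gamma s u t = u powr (- of_real s) * upper_Gamma s (u * of_real t)"

lemma slit_mult_real: "Im u > 0 \<Longrightarrow> t > 0 \<Longrightarrow> u * complex_of_real t \<notin> \<real>\<^sub>\<le>\<^sub>0"
  by (simp add: complex_nonpos_Reals_iff)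

lemma ray_Gamma_deriv:
  assumes u: "Im u > 0" and t: "t > 0"
  shows "(ray_Gamma s u has_vector_derivative - (exp (- u * of_real t) * of_real (t powr (s - 1)))) (at t within S)"
proof -
  have u0: "u \<noteq> 0" using u by auto
  have "((\<lambda>z. u * z) has_field_derivative u) (at (of_real t))"
    by (auto intro!: derivative_eq_intros)
  from DERIV_cmult[OF DERIV_chain2[of "upper_Gamma s" _ "\<lambda>z. u * z", OF upper_Gamma_deriv[OF slit_mult_real[OF u t]] this]]
  have "((\<lambda>z. u powr (- of_real s) * upper_Gamma s (u * z)) has_field_derivative
      u powr (- of_real s) * (- (exp (- (u * of_real t)) * (u * of_real t) powr (of_real s - 1)) * u)) (at (of_real t))" .
  also have "(u * of_real t) powr (of_real s - 1) = of_real (t powr (s - 1)) * u powr (of_real s - 1)"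
    using t powr_of_real[of t "s - 1"] by (subst mult.commute, subst powr_times_real_left) auto
  also have "u powr (- of_real s) * (- (exp (- (u * of_real t)) * (of_real (t powr (s - 1)) * u powr (of_real s - 1))) * u)
      = - (exp (- (u * of_real t)) * of_real (t powr (s - 1))) * (u powr (- of_real s) * (u powr (of_real s - 1) * u))"
    by (simp add: mult_ac)
  also have "u powr (- of_real s) * (u powr (of_real s - 1) * u) = 1"
    using u0 powr_add[of u "of_real s - 1" 1] by (simp add: powr_minus field_simps)
  finally have "((\<lambda>z. u powr (- of_real s) * upper_Gamma s (u * z)) has_field_derivative
      - (exp (- u * of_real t) * of_real (t powr (s - 1)))) (at (of_real t))" by simp
  then show ?thesis
    unfolding ray_Gamma_def[abs_def] by (rule has_vector_derivative_real_field[OF has_field_derivative_at_within])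
qed

lemma continuous_on_ray_Gamma: "Im u > 0 \<Longrightarrow> S \<subseteq> {0<..} \<Longrightarrow> continuous_on S (ray_Gamma s u)"
  by (rule continuous_on_vector_derivative[OF ray_Gamma_deriv]) auto

lemma norm_exp_shift:
  "norm (exp (\<i> * of_real t * (2 * of_real pi * of_int n) * (\<i> + of_real x))) = exp (- 2 * pi * of_int n * t)"
  using norm_exp_ray[of t "2 * of_real pi * of_int n" x] by (simp add: mult_ac)

text \<open>The character has modulus \<open>exp (- 2 \<pi> n t)\<close> on the ray, and what remains of the integral is
  bounded independently of \<open>n\<close> and \<open>t\<close>.\<close>

lemma ray_Gamma_bound:
  assumes w: "Im w > 0" "Re w \<ge> 0"
  obtains C where "C \<ge> 0"
    "\<And>n t. t \<ge> 1 \<Longrightarrow> norm (ray_Gamma s (2 * of_real pi * of_int n + w) t) \<le> C * t powr s * exp (- 2 * pi * of_int n * t)"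
proof -
  obtain C where C: "C > 0" "\<And>t x. t \<ge> 1 \<Longrightarrow> x \<ge> 0 \<Longrightarrow> norm (ray_kernel s w t x) \<le> C * exp (- (Im w / 2) * x)"
    by (rule ray_kernel_bound[OF w, of s], rule that)
  define I where "I = (LINT x:{0..}|lborel. C * exp (- (Im w / 2) * x))"
  have gi: "set_integrable lborel {0..} (\<lambda>x. complex_of_real (C * exp (- (Im w / 2) * x)))"
    by (rule set_integrable_exp_bound[where d = "Im w / 2" and C = C])
      (use w C(1) in \<open>auto intro!: continuous_intros simp: norm_mult\<close>)
  have gi': "set_integrable lborel {0..} (\<lambda>x. C * exp (- (Im w / 2) * x))"
    using set_integrable_norm[OF gi] C(1) by (simp add: norm_mult)
  have I0: "I \<ge> 0" unfolding I_def set_lebesgue_integral_def using C(1) by (intro Bochner_Integration.integral_nonneg) auto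
  show ?thesis
  proof (rule that[OF I0])
    fix n :: int and t :: real assume t: "t \<ge> 1"
    let ?u = "2 * of_real pi * of_int n + w"
    have u: "Im ?u > 0" using w by simp
    have t0: "t > 0" using t by simp
    note J = ray_kernel_integral[OF u t0, of s]
    have "norm (LINT x:{0..}|lborel. ray_kernel s ?u t x) \<le> (LINT x:{0..}|lborel. norm (ray_kernel s ?u t x))"
      by (rule set_integral_norm_bound[OF J(1)])
    also have "\<dots> \<le> (LINT x:{0..}|lborel. exp (- 2 * pi * of_int n * t) * (C * exp (- (Im w / 2) * x)))"
    proof (rule set_integral_mono[OF set_integrable_norm[OF J(1)]])
      show "set_integrable lborel {0..} (\<lambda>x. exp (- 2 * pi * of_int n * t) * (C * exp (- (Im w / 2) * x)))"
        by (rule set_integrable_mult_right) (rule gi')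
      fix x :: real assume "x \<in> {0..}"
      then show "norm (ray_kernel s ?u t x) \<le> exp (- 2 * pi * of_int n * t) * (C * exp (- (Im w / 2) * x))"
        unfolding ray_kernel_shift norm_mult norm_exp_shift by (intro mult_left_mono C(2) t) auto
    qed
    also have "\<dots> = exp (- 2 * pi * of_int n * t) * I" unfolding I_def by (rule set_integral_mult_right)
    finally have "norm (\<i> powr of_real s) * (t powr (- s) * norm (ray_Gamma s ?u t)) \<le> exp (- 2 * pi * of_int n * t) * I"
      unfolding J(2) ray_Gamma_def by (simp add: norm_mult)
    moreover have "norm (\<i> powr complex_of_real s) = 1"
      using norm_powr_real_powr'[of "of_real s" \<i>] by simp
    ultimately have "t powr s * (t powr (- s) * norm (ray_Gamma s ?u t)) \<le> t powr s * (exp (- 2 * pi * of_int n * t) * I)"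
      by (intro mult_left_mono) auto
    also have "t powr s * (t powr (- s) * norm (ray_Gamma s ?u t)) = norm (ray_Gamma s ?u t)"
      using t by (simp add: mult.assoc[symmetric] powr_add[symmetric])
    finally show "norm (ray_Gamma s ?u t) \<le> I * t powr s * exp (- 2 * pi * of_int n * t)"
      by (simp only: mult_ac)
  qed
qed

text \<open>\<open>- ray_Gamma s u\<close> is a primitive of \<open>exp (- u t) t\<^sup>s\<^sup>-\<^sup>1\<close>.  At infinity the boundary term vanishes:
  the Gamma factor is at most a multiple of \<open>exp (- 3 \<pi> \<bar>n\<bar> t)\<close>, while \<open>ray_Gamma s u\<close> grows at most
  like \<open>t\<^sup>s exp (2 \<pi> \<bar>n\<bar> t)\<close>.\<close>

lemma inc_Gamma_Laplace_by_parts: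
  assumes w: "Im w > 0" "Re w \<ge> 0" and n: "n < 0"
  defines "u \<equiv> 2 * of_real pi * of_int n + w"
  shows "integral {1..} (\<lambda>t. of_real (inc_Gamma (1 - of_int k) (- 4 * pi * of_int n * t)) * exp (- u * of_real t) * of_real (t powr (s - 1)))
    = of_real (inc_Gamma (1 - of_int k) (- 4 * pi * of_int n)) * ray_Gamma s u 1
      - of_real ((- 4 * pi * of_int n) powr (1 - of_int k))
        * (LINT t:{1..}|lborel. of_real (t powr (- of_int k) * exp (4 * pi * of_int n * t)) * ray_Gamma s u t)"
    and "set_integrable lborel {1..} (\<lambda>t. of_real (t powr (- of_int k) * exp (4 * pi * of_int n * t)) * ray_Gamma s u t)"
proof -
  define m where "m = - real_of_int n"
  have m: "m \<ge> 1" using n by (simp add: m_def)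
  have mp: "pi * m > 0" using m by simp
  have Im: "Im u > 0" using w by (simp add: u_def)
  define g where "g t = inc_Gamma (1 - of_int k) (- 4 * pi * of_int n * t)" for t
  define p where "p t = t powr (- of_int k) * exp (4 * pi * of_int n * t)" for t
  define c where "c = (- 4 * pi * real_of_int n) powr (1 - of_int k)"
  have gd: "(g has_real_derivative - c * p t) (at t)" if "t > 0" for t
    unfolding g_def c_def p_def by (rule inc_Gamma_scaled_deriv[OF that n])
  have gd': "((\<lambda>t. complex_of_real (g t)) has_vector_derivative of_real (- c * p t)) (at t within S)" if "t > 0" for t S
    by (rule has_vector_derivative_at_within[OF has_vector_derivative_of_real_fun[OF gd[OF that]]])
  have p4: "4 * pi > 0" by simp
  obtain G G' where G: "G > 0" "G' > 0" "\<And>x. x \<ge> 4 * pi \<Longrightarrow> inc_Gamma (1 - of_int k) x \<le> G * exp (- 3 / 4 * x)"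
     "\<And>x. x \<ge> 4 * pi \<Longrightarrow> G' * exp (- 5 / 4 * x) \<le> inc_Gamma (1 - of_int k) x"
    by (rule inc_Gamma_bounds[OF p4, of "1 - of_int k"], rule that)
  have gb: "\<bar>g t\<bar> \<le> G * exp (- 3 * pi * m * t)" if t: "t \<ge> 1" for t
  proof -
    have t0: "t > 0" using t by simp
    have "4 * pi * 1 \<le> 4 * pi * t" using t by (intro mult_left_mono) auto
    then have x: "4 * pi \<le> - 4 * pi * of_int n * t" using neg_arg_ge[OF n t0] by linarith
    then have "0 < - 4 * pi * of_int n * t" using pi_gt_zero by linarith
    then have "\<bar>g t\<bar> = g t" unfolding g_def using inc_Gamma_pos[of "- 4 * pi * of_int n * t"] by (simp only: abs_of_pos)
    also have "\<dots> \<le> G * exp (- 3 / 4 * (- 4 * pi * of_int n * t))" unfolding g_def by (rule G(3)[OF x])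
    also have "- 3 / 4 * (- 4 * pi * of_int n * t) = - 3 * pi * m * t" by (simp add: m_def)
    finally show ?thesis .
  qed
  have ht: "pi * m / 2 > 0" using mp by simp
  \<comment> \<open>the power of \<open>t\<close> may cost half of the decay \<open>exp (- \<pi> \<bar>n\<bar> t)\<close> that the Gamma factor has to spare\<close>
  obtain C1 where C1: "C1 > 0" "\<And>t. t \<ge> 1 \<Longrightarrow> t powr (s - 1) \<le> C1 * exp (pi * m / 2 * t)"
    by (rule powr_le_exp[OF ht zero_less_one, of "s - 1"], rule that)
  obtain C2 where C2: "C2 > 0" "\<And>t. t \<ge> 1 \<Longrightarrow> t powr s \<le> C2 * exp (pi * m / 2 * t)"
    by (rule powr_le_exp[OF ht zero_less_one, of s], rule that)
  obtain C3 where C3: "C3 > 0" "\<And>t. t \<ge> 1 \<Longrightarrow> t powr (s - of_int k) \<le> C3 * exp (pi * m / 2 * t)"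
    by (rule powr_le_exp[OF ht zero_less_one, of "s - of_int k"], rule that)
  obtain Q where Q0: "Q \<ge> 0" "\<And>n t. t \<ge> 1 \<Longrightarrow>
      norm (ray_Gamma s (2 * of_real pi * of_int n + w) t) \<le> Q * t powr s * exp (- 2 * pi * of_int n * t)"
    by (rule ray_Gamma_bound[OF w, of s], rule that)
  note Q = Q0(1) Q0(2)[of _ n, folded u_def]
  have e2: "exp (- 2 * pi * of_int n * t) = exp (2 * pi * m * t)" for t by (simp add: m_def)
  define P where "P t = exp (- u * of_real t) * complex_of_real (t powr (s - 1))" for t
  have Pn: "norm (P t) \<le> C1 * exp (5 / 2 * pi * m * t)" if t: "t \<ge> 1" for t
  proof -
    have "Re (- u * of_real t) \<le> 2 * pi * m * t"
      using w(2) t by (simp add: u_def m_def algebra_simps)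
    then have "norm (P t) \<le> exp (2 * pi * m * t) * (C1 * exp (pi * m / 2 * t))"
      unfolding P_def norm_mult norm_exp_eq_Re using C1(2)[OF t] by (intro mult_mono) auto
    also have "\<dots> = C1 * exp (2 * pi * m * t + pi * m / 2 * t)" by (simp only: exp_add mult_ac)
    also have "2 * pi * m * t + pi * m / 2 * t = 5 / 2 * pi * m * t" by (simp add: field_simps)
    finally show ?thesis .
  qed
  have gc: "continuous_on {1..} (\<lambda>t. complex_of_real (g t))"
    by (rule continuous_on_vector_derivative[OF gd']) auto
  have Qc: "continuous_on {1..} (ray_Gamma s u)" by (rule continuous_on_ray_Gamma[OF Im]) auto
  have pc: "continuous_on {1..} (\<lambda>t. complex_of_real (p t))"
    unfolding p_def by (intro continuous_intros) auto
  have Pc: "continuous_on {1..} P" unfolding P_def by (intro continuous_intros) auto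
  have gPi: "set_integrable lborel {1..} (\<lambda>t. of_real (g t) * P t)"
  proof (rule set_integrable_exp_bound[OF _ ht])
    show "continuous_on {1..} (\<lambda>t. of_real (g t) * P t)" by (intro continuous_intros gc Pc)
    fix t :: real assume t: "t \<ge> 1"
    have "norm (of_real (g t) * P t) \<le> (G * exp (- 3 * pi * m * t)) * (C1 * exp (5 / 2 * pi * m * t))"
      unfolding norm_mult norm_of_real by (intro mult_mono gb Pn t) (use G(1) in auto)
    also have "\<dots> = G * C1 * exp (- 3 * pi * m * t + 5 / 2 * pi * m * t)" by (simp only: exp_add mult_ac)
    also have "- 3 * pi * m * t + 5 / 2 * pi * m * t = - (pi * m / 2) * t" by (simp add: field_simps)
    finally show "norm (of_real (g t) * P t) \<le> G * C1 * exp (- (pi * m / 2) * t)" .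
  qed
  have pQi: "set_integrable lborel {1..} (\<lambda>t. of_real (p t) * ray_Gamma s u t)"
  proof (rule set_integrable_exp_bound[OF _ mp])
    show "continuous_on {1..} (\<lambda>t. of_real (p t) * ray_Gamma s u t)" by (intro continuous_intros pc Qc)
    fix t :: real assume t: "t \<ge> 1"
    have p: "\<bar>p t\<bar> = t powr (- of_int k) * exp (- 4 * pi * m * t)" by (simp add: p_def m_def)
    have tt: "t powr (- of_int k) * t powr s = t powr (s - of_int k)" by (simp add: powr_add[symmetric])
    have "norm (of_real (p t) * ray_Gamma s u t) \<le> (t powr (- of_int k) * exp (- 4 * pi * m * t)) * (Q * t powr s * exp (2 * pi * m * t))"
      unfolding norm_mult norm_of_real p using Q(2)[OF t] unfolding e2 by (intro mult_left_mono) auto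
    also have "\<dots> = Q * (t powr (- of_int k) * t powr s) * exp (- 4 * pi * m * t + 2 * pi * m * t)"
      by (simp only: exp_add mult_ac)
    also have "\<dots> \<le> Q * (C3 * exp (pi * m / 2 * t)) * exp (- 4 * pi * m * t + 2 * pi * m * t)"
      unfolding tt using C3(2)[OF t] Q(1) by (intro mult_right_mono mult_left_mono) auto
    also have "\<dots> = Q * C3 * exp (pi * m / 2 * t + (- 4 * pi * m * t + 2 * pi * m * t))"
      by (simp only: exp_add mult_ac)
    also have "\<dots> \<le> Q * C3 * exp (- (pi * m) * t)"
      using Q(1) C3(1) m t by (intro mult_left_mono) (auto simp: field_simps)
    finally show "norm (of_real (p t) * ray_Gamma s u t) \<le> Q * C3 * exp (- (pi * m) * t)" .
  qed
  then show "set_integrable lborel {1..} (\<lambda>t. of_real (t powr (- of_int k) * exp (4 * pi * of_int n * t)) * ray_Gamma s u t)"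
    by (simp only: p_def)
  have lim: "((\<lambda>t. of_real (g t) * ray_Gamma s u t) \<longlongrightarrow> 0) at_top"
  proof (rule Lim_null_comparison)
    show "((\<lambda>t. G * Q * C2 * exp (- (pi * m / 2) * t)) \<longlongrightarrow> 0) at_top"
    proof (intro tendsto_mult_right_zero)
      have "((\<lambda>t. exp (- r * t)) \<longlongrightarrow> 0) at_top" if "r > 0" for r :: real
        using that by real_asymp
      from this[OF ht] show "((\<lambda>t. exp (- (pi * m / 2) * t)) \<longlongrightarrow> 0) at_top" .
    qed
    show "\<forall>\<^sub>F t in at_top. norm (of_real (g t) * ray_Gamma s u t) \<le> G * Q * C2 * exp (- (pi * m / 2) * t)"
      using eventually_ge_at_top[of 1]
    proof eventually_elim
      case (elim t)
      have "norm (of_real (g t) * ray_Gamma s u t) \<le> (G * exp (- 3 * pi * m * t)) * (Q * t powr s * exp (2 * pi * m * t))"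
        unfolding norm_mult norm_of_real using Q(2)[OF elim] G(1) unfolding e2 by (intro mult_mono gb elim) auto
      also have "\<dots> \<le> (G * exp (- 3 * pi * m * t)) * (Q * (C2 * exp (pi * m / 2 * t)) * exp (2 * pi * m * t))"
        using Q(1) G(1) C2(2)[OF elim] by (intro mult_right_mono mult_left_mono) auto
      also have "\<dots> = G * Q * C2 * exp (- 3 * pi * m * t + pi * m / 2 * t + 2 * pi * m * t)" by (simp only: exp_add mult_ac)
      also have "- 3 * pi * m * t + pi * m / 2 * t + 2 * pi * m * t = - (pi * m / 2) * t" by (simp add: field_simps)
      finally show ?case .
    qed
  qed
  have "(LINT t:{1..}|lborel. of_real (g t) * (- P t) + of_real (- c * p t) * ray_Gamma s u t)
      = 0 - of_real (g 1) * ray_Gamma s u 1"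
  proof (rule set_integral_FTC_Ici[OF _ _ _ lim])
    fix t :: real assume "t \<ge> 1"
    then show "((\<lambda>t. of_real (g t) * ray_Gamma s u t) has_vector_derivative of_real (g t) * (- P t) + of_real (- c * p t) * ray_Gamma s u t) (at t within {1..})"
      unfolding P_def by (intro has_vector_derivative_mult gd' ray_Gamma_deriv Im) auto
  next
    have "set_integrable lborel {1..} (\<lambda>t. (- 1) * (of_real (g t) * P t) + - of_real c * (of_real (p t) * ray_Gamma s u t))"
      by (intro set_integral_add(1) set_integrable_mult_right gPi pQi)
    then show "set_integrable lborel {1..} (\<lambda>t. of_real (g t) * (- P t) + of_real (- c * p t) * ray_Gamma s u t)"
      by (simp add: mult_ac)
    have "continuous_on {1..} (\<lambda>t. of_real (g t) * (- P t) + - of_real c * of_real (p t) * ray_Gamma s u t)"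
      by (intro continuous_intros gc Pc pc Qc)
    then show "continuous_on {1..} (\<lambda>t. of_real (g t) * (- P t) + of_real (- c * p t) * ray_Gamma s u t)" by simp
  qed
  moreover have "(LINT t:{1..}|lborel. of_real (g t) * (- P t) + of_real (- c * p t) * ray_Gamma s u t)
      = (LINT t:{1..}|lborel. (- 1) * (of_real (g t) * P t) - of_real c * (of_real (p t) * ray_Gamma s u t))"
    by (simp add: mult_ac)
  moreover have "\<dots> = (LINT t:{1..}|lborel. (- 1) * (of_real (g t) * P t)) - (LINT t:{1..}|lborel. of_real c * (of_real (p t) * ray_Gamma s u t))"
    by (intro set_integral_diff(2) set_integrable_mult_right gPi pQi)
  moreover have "(LINT t:{1..}|lborel. (- 1) * (of_real (g t) * P t)) = (- 1) * (LINT t:{1..}|lborel. of_real (g t) * P t)"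
    by (rule set_integral_mult_right)
  moreover have "(LINT t:{1..}|lborel. of_real c * (of_real (p t) * ray_Gamma s u t)) = of_real c * (LINT t:{1..}|lborel. of_real (p t) * ray_Gamma s u t)"
    by (rule set_integral_mult_right)
  ultimately have "(LINT t:{1..}|lborel. of_real (g t) * P t)
      = of_real (g 1) * ray_Gamma s u 1 - of_real c * (LINT t:{1..}|lborel. of_real (p t) * ray_Gamma s u t)"
    by (simp only:) (simp add: algebra_simps)
  then show "integral {1..} (\<lambda>t. of_real (inc_Gamma (1 - of_int k) (- 4 * pi * of_int n * t)) * exp (- u * of_real t) * of_real (t powr (s - 1)))
    = of_real (inc_Gamma (1 - of_int k) (- 4 * pi * of_int n)) * ray_Gamma s u 1
      - of_real ((- 4 * pi * of_int n) powr (1 - of_int k))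
        * (LINT t:{1..}|lborel. of_real (t powr (- of_int k) * exp (4 * pi * of_int n * t)) * ray_Gamma s u t)"
    using set_borel_integral_eq_integral(2)[OF gPi]
    by (simp only: g_def p_def c_def P_def mult.assoc mult_1_right)
qed

lemma set_integrable_exp:
  fixes C d :: real
  assumes "d > 0"
  shows "set_integrable lborel {a..} (\<lambda>x::real. C * exp (- d * x))"
proof -
  have "set_integrable lborel {a..} (\<lambda>x::real. complex_of_real (\<bar>C\<bar> * exp (- d * x)))"
    by (rule set_integrable_exp_bound[OF _ assms, where C = "\<bar>C\<bar>"]) (auto intro!: continuous_intros simp: norm_mult)
  from set_integrable_norm[OF this] have "set_integrable lborel {a..} (\<lambda>x. sgn C * (\<bar>C\<bar> * exp (- d * x)))"
    by (intro set_integrable_mult_right) (simp add: norm_mult abs_mult)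
  then show ?thesis by (simp add: mult.assoc[symmetric] sgn_mult_abs)
qed

section \<open>Series integrated over the horizontal ray\<close>

text \<open>The \<open>n\<close>-th character times the kernel with parameter \<open>w\<close> is the kernel with parameter
  \<open>2 \<pi> n + w\<close>, whose integral is known.\<close>

lemma ray_series_integral:
  fixes \<alpha> :: "int \<Rightarrow> complex"
  assumes w: "Im w > 0" "Re w \<ge> 0"
    and \<alpha>: "(\<lambda>n. norm (\<alpha> n) * exp (- 2 * pi * of_int n)) summable_on A"
    and F: "\<And>x. x \<ge> 0 \<Longrightarrow> ((\<lambda>n. \<alpha> n * exp (2 * of_real pi * \<i> * of_int n * (\<i> + of_real x))) has_sum F x) A"
  shows "set_integrable lborel {0..} (\<lambda>x. F x * ray_kernel s w 1 x)"
    and "((\<lambda>n. \<i> powr of_real s * (\<alpha> n * ray_Gamma s (2 * of_real pi * of_int n + w) 1)) has_sum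
      (LINT x:{0..}|lborel. F x * ray_kernel s w 1 x)) A"
proof -
  obtain C where C: "C > 0" "\<And>t x. t \<ge> 1 \<Longrightarrow> x \<ge> 0 \<Longrightarrow> norm (ray_kernel s w t x) \<le> C * exp (- (Im w / 2) * x)"
    by (rule ray_kernel_bound[OF w, of s], rule that)
  let ?E = "\<lambda>n x. exp (2 * of_real pi * \<i> * of_int n * (\<i> + of_real x))"
  let ?u = "\<lambda>n. 2 * of_real pi * of_int n + w"
  have u: "Im (?u n) > 0" for n using w by simp
  have sh: "?E n x * ray_kernel s w 1 x = ray_kernel s (?u n) 1 x" for n x
    unfolding ray_kernel_shift by (simp add: mult_ac)
  have sha: "v * ?E n x * ray_kernel s w 1 x = v * ray_kernel s (?u n) 1 x" for v n x
    unfolding sh[symmetric] by (rule mult.assoc)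
  have nE: "norm (?E n x) = exp (- 2 * pi * of_int n)" for n x
    using norm_exp_shift[of 1 n x] by (simp add: mult_ac)
  have "set_integrable lborel {0..} (\<lambda>x. \<alpha> n * ray_kernel s (?u n) 1 x)" for n
    by (rule set_integrable_mult_right) (rule ray_kernel_integral(1)[OF u], simp)
  then have 1: "set_integrable lborel {0..} (\<lambda>x. \<alpha> n * ?E n x * ray_kernel s w 1 x)" for n
    unfolding sha .
  have 2: "set_integrable lborel {0..} (\<lambda>x. C * exp (- (Im w / 2) * x))"
    by (rule set_integrable_exp) (use w in simp)
  have 3: "norm (\<alpha> n * ?E n x * ray_kernel s w 1 x) \<le> (norm (\<alpha> n) * exp (- 2 * pi * of_int n)) * (C * exp (- (Im w / 2) * x))"
    if "x \<in> {0..}" for n x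
    unfolding norm_mult nE using C(2)[of 1 x] that by (intro mult_left_mono) auto
  have 4: "((\<lambda>n. \<alpha> n * ?E n x * ray_kernel s w 1 x) has_sum (F x * ray_kernel s w 1 x)) A" if "x \<in> {0..}" for x
    by (rule has_sum_cmult_left[OF F]) (use that in simp)
  show "set_integrable lborel {0..} (\<lambda>x. F x * ray_kernel s w 1 x)"
    by (rule has_sum_set_integral(1)[OF _ _ 1 2 \<alpha> 3 4]) auto
  have "((\<lambda>n. LINT x:{0..}|lborel. \<alpha> n * ?E n x * ray_kernel s w 1 x) has_sum
      (LINT x:{0..}|lborel. F x * ray_kernel s w 1 x)) A"
    by (rule has_sum_set_integral(2)[OF _ _ 1 2 \<alpha> 3 4]) auto
  moreover have "(LINT x:{0..}|lborel. \<alpha> n * ?E n x * ray_kernel s w 1 x)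
      = \<i> powr of_real s * (\<alpha> n * ray_Gamma s (?u n) 1)" for n
  proof -
    have "(LINT x:{0..}|lborel. \<alpha> n * ?E n x * ray_kernel s w 1 x) = \<alpha> n * (LINT x:{0..}|lborel. ray_kernel s (?u n) 1 x)"
      unfolding sha by (rule set_integral_mult_right)
    also have "\<dots> = \<i> powr of_real s * (\<alpha> n * ray_Gamma s (?u n) 1)"
      unfolding ray_kernel_integral(2)[OF u zero_less_one] by (simp add: ray_Gamma_def mult_ac)
    finally show ?thesis .
  qed
  ultimately show "((\<lambda>n. \<i> powr of_real s * (\<alpha> n * ray_Gamma s (?u n) 1)) has_sum
      (LINT x:{0..}|lborel. F x * ray_kernel s w 1 x)) A" by simp
qed

text \<open>For \<open>\<bar>n\<bar> \<ge> 1\<close> and \<open>Im z \<ge> 1\<close> one has \<open>2 \<bar>n\<bar> Im z \<ge> \<bar>n\<bar> + Im z\<close>, which separates the decay in \<open>n\<close> from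
  the decay in \<open>Im z\<close>.\<close>

lemma xi_series_bounds:
  assumes c: "subexp neg_index c"
    and X: "\<And>z. z \<in> upper_half_plane \<Longrightarrow> ((\<lambda>n. c n * exp (- (2 * of_real pi * \<i> * of_int n * z))) has_sum \<Xi> z) neg_index"
  shows "(\<lambda>n. norm (c n) * exp (- pi * \<bar>real_of_int n\<bar>)) summable_on neg_index"
    and "\<And>z n. Im z \<ge> 1 \<Longrightarrow> n \<in> neg_index \<Longrightarrow>
      norm (c n * exp (- (2 * of_real pi * \<i> * of_int n * z))) \<le> (norm (c n) * exp (- pi * \<bar>real_of_int n\<bar>)) * exp (- pi * Im z)"
    and "\<And>z. Im z \<ge> 1 \<Longrightarrow> norm (\<Xi> z) \<le> (\<Sum>\<^sub>\<infinity>n\<in>neg_index. norm (c n) * exp (- pi * \<bar>real_of_int n\<bar>)) * exp (- pi * Im z)"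
proof -
  have "pi / 2 > 0" by simp
  then obtain M where M: "M \<ge> 0" "\<And>n. n \<in> neg_index \<Longrightarrow> norm (c n) \<le> M * exp (pi / 2 * \<bar>real_of_int n\<bar>)"
    using subexpD[OF c] by metis
  show s: "(\<lambda>n. norm (c n) * exp (- pi * \<bar>real_of_int n\<bar>)) summable_on neg_index"
  proof (rule summable_on_exp_bound[where c = "pi / 2" and M = M])
    fix n assume n: "n \<in> neg_index"
    have "norm (c n) * exp (- pi * \<bar>real_of_int n\<bar>) \<le> (M * exp (pi / 2 * \<bar>real_of_int n\<bar>)) * exp (- pi * \<bar>real_of_int n\<bar>)"
      by (intro mult_right_mono M n) simp
    also have "\<dots> = M * exp (pi / 2 * \<bar>real_of_int n\<bar> + - pi * \<bar>real_of_int n\<bar>)" by (simp only: exp_add mult.assoc)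
    also have "pi / 2 * \<bar>real_of_int n\<bar> + - pi * \<bar>real_of_int n\<bar> = - (pi / 2) * \<bar>real_of_int n\<bar>" by (simp add: field_simps)
    finally show "norm (c n) * exp (- pi * \<bar>real_of_int n\<bar>) \<le> M * exp (- (pi / 2) * \<bar>real_of_int n\<bar>)" .
  qed auto
  show b: "norm (c n * exp (- (2 * of_real pi * \<i> * of_int n * z))) \<le> (norm (c n) * exp (- pi * \<bar>real_of_int n\<bar>)) * exp (- pi * Im z)"
    if z: "Im z \<ge> 1" and n: "n \<in> neg_index" for z n
  proof -
    define m where "m = \<bar>real_of_int n\<bar>"
    have m: "m \<ge> 1" "real_of_int n = - m" using n by (auto simp: m_def)
    have "m * 1 \<le> m * Im z" "1 * Im z \<le> m * Im z" using m z by (intro mult_left_mono mult_right_mono; simp)+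
    then have "pi * (m + Im z) \<le> pi * (2 * m * Im z)" by (intro mult_left_mono) auto
    then have "exp (- (2 * pi * m * Im z)) \<le> exp (- pi * m + - pi * Im z)" by (simp add: algebra_simps)
    moreover have "norm (exp (- (2 * of_real pi * \<i> * of_int n * z))) = exp (- (2 * pi * m * Im z))"
      by (simp add: m(2))
    ultimately have "norm (exp (- (2 * of_real pi * \<i> * of_int n * z))) \<le> exp (- pi * m) * exp (- pi * Im z)"
      by (simp only: exp_add)
    then have "norm (c n) * norm (exp (- (2 * of_real pi * \<i> * of_int n * z))) \<le> norm (c n) * (exp (- pi * m) * exp (- pi * Im z))"
      by (rule mult_left_mono) simp
    then show ?thesis unfolding norm_mult m_def mult.assoc .
  qed
  show "norm (\<Xi> z) \<le> (\<Sum>\<^sub>\<infinity>n\<in>neg_index. norm (c n) * exp (- pi * \<bar>real_of_int n\<bar>)) * exp (- pi * Im z)" if z: "Im z \<ge> 1" for z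
  proof (rule norm_infsum_le[OF X has_sum_cmult_left[OF has_sum_infsum[OF s]]])
    show "z \<in> upper_half_plane" using z by (simp add: upper_half_plane_def)
  qed (use b[OF z] in blast)
qed

text \<open>The sum over \<open>m\<close> is unrolled to the half-line \<open>x \<ge> 0\<close>, the order of integration is exchanged, and
  \<open>\<Xi>\<close> is expanded; the integral of each term over \<open>x\<close> is then a value of \<open>ray_Gamma\<close>.  All exchanges
  rest on a bound of \<open>K t x\<close> by a product of two decaying exponentials, in \<open>t\<close> and in \<open>x\<close>.\<close>

lemma xi_series_integral:
  fixes c :: "int \<Rightarrow> complex" and \<Xi> :: "complex \<Rightarrow> complex" and s :: real and k :: int
  assumes w: "Im w > 0" "Re w \<ge> 0"
    and c: "subexp neg_index c"
    and X: "\<And>z. z \<in> upper_half_plane \<Longrightarrow> ((\<lambda>n. c n * exp (- (2 * of_real pi * \<i> * of_int n * z))) has_sum \<Xi> z) neg_index"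
    and Xc: "continuous_on upper_half_plane \<Xi>"
    and Qi: "\<And>n. n < 0 \<Longrightarrow> set_integrable lborel {1..}
      (\<lambda>t. of_real (t powr (- of_int k) * exp (4 * pi * of_int n * t)) * ray_Gamma s (2 * of_real pi * of_int n + w) t)"
  defines "K \<equiv> \<lambda>t x. of_real (t powr (s - of_int k)) * ray_kernel s w t x * \<Xi> (of_real t * (\<i> - of_real x))"
  shows "\<And>t x. t \<ge> 1 \<Longrightarrow> x \<ge> 0 \<Longrightarrow> summable (\<lambda>m::nat. norm (K t (x + real m)))"
    and "set_integrable lborel {0..1} (\<lambda>x. LINT t:{1..}|lborel. (\<Sum>m::nat. K t (x + real m)))"
    and "\<And>x. x \<ge> 0 \<Longrightarrow> set_integrable lborel {1..} (\<lambda>t. \<Sum>m::nat. K t (x + real m))"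
    and "((\<lambda>n. \<i> powr of_real s * (c n * (LINT t:{1..}|lborel.
        of_real (t powr (- of_int k) * exp (4 * pi * of_int n * t)) * ray_Gamma s (2 * of_real pi * of_int n + w) t)))
      has_sum (LINT x:{0..1}|lborel. LINT t:{1..}|lborel. (\<Sum>m::nat. K t (x + real m)))) neg_index"
proof -
  note D = xi_series_bounds[OF c X]
  \<comment> \<open>the majorants: \<open>d\<close> in the index, \<open>p\<close> in \<open>t\<close> and \<open>q\<close> in \<open>x\<close>\<close>
  define d where "d n = norm (c n) * exp (- pi * \<bar>real_of_int n\<bar>)" for n
  define S where "S = infsum d neg_index"
  have ds: "d summable_on neg_index" unfolding d_def by (rule D(1))
  have S0: "S \<ge> 0" unfolding S_def by (rule infsum_nonneg) (simp add: d_def)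
  define \<nu> where "\<nu> = Im w / 2"
  have \<nu>: "\<nu> > 0" using w by (simp add: \<nu>_def)
  obtain C where C': "C > 0" "\<And>t x. t \<ge> 1 \<Longrightarrow> x \<ge> 0 \<Longrightarrow> norm (ray_kernel s w t x) \<le> C * exp (- (Im w / 2) * x)"
    by (rule ray_kernel_bound[OF w, of s], rule that)
  note C = C'[folded \<nu>_def]
  have hp: "pi / 2 > 0" by simp
  obtain A where A: "A > 0" "\<And>t. t \<ge> 1 \<Longrightarrow> t powr (s - of_int k) \<le> A * exp (pi / 2 * t)"
    by (rule powr_le_exp[OF hp zero_less_one, of "s - of_int k"], rule that)
  define p where "p t = A * exp (- (pi / 2) * t)" for t :: real
  define q where "q x = C * exp (- \<nu> * x)" for x :: real
  have p0: "p t \<ge> 0" for t using A(1) by (simp add: p_def)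
  have q0: "q t \<ge> 0" for t using C(1) by (simp add: q_def)
  have pi: "set_integrable lborel {1..} p" unfolding p_def by (rule set_integrable_exp) simp
  have qi: "set_integrable lborel {0..} q" unfolding q_def by (rule set_integrable_exp[OF \<nu>])
  have tp: "t powr (s - of_int k) * exp (- pi * t) \<le> p t" if "t \<ge> 1" for t
  proof -
    have "t powr (s - of_int k) * exp (- pi * t) \<le> A * exp (pi / 2 * t) * exp (- pi * t)"
      by (intro mult_right_mono A that) simp
    also have "\<dots> = A * exp (pi / 2 * t + - pi * t)" by (simp only: exp_add mult.assoc)
    also have "pi / 2 * t + - pi * t = - (pi / 2) * t" by (simp add: field_simps)
    finally show ?thesis unfolding p_def .
  qed
  let ?z = "\<lambda>t x. of_real t * (\<i> - of_real x) :: complex"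
  define Kn where "Kn n t x = of_real (t powr (s - of_int k)) * ray_kernel s w t x * (c n * exp (- (2 * of_real pi * \<i> * of_int n * ?z t x)))"
    for n t x
  have Kbound: "norm (of_real (t powr (s - of_int k)) * ray_kernel s w t x * v) \<le> B * p t * q x"
    if t: "t \<ge> 1" and x: "x \<ge> 0" and v: "norm v \<le> B * exp (- pi * t)" and B: "B \<ge> 0" for t x v B
  proof -
    have "norm (of_real (t powr (s - of_int k)) * ray_kernel s w t x * v) \<le> (t powr (s - of_int k) * q x) * (B * exp (- pi * t))"
      unfolding norm_mult norm_of_real
      using C(2)[OF t x] v q0[of x] by (intro mult_mono) (auto simp: q_def intro!: mult_left_mono)
    also have "\<dots> = B * (t powr (s - of_int k) * exp (- pi * t)) * q x" by (simp only: mult_ac)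
    also have "\<dots> \<le> B * p t * q x" by (intro mult_right_mono mult_left_mono tp t B q0)
    finally show ?thesis .
  qed
  have Kb: "norm (K t x) \<le> S * p t * q x" if t: "t \<ge> 1" and x: "x \<ge> 0" for t x
    unfolding K_def by (rule Kbound[OF t x _ S0]) (use D(3)[of "?z t x"] t in \<open>simp add: S_def d_def[abs_def]\<close>)
  have Kc: "continuous_on ({1..} \<times> {0..}) (\<lambda>(t, x). K t x)"
    unfolding K_def case_prod_unfold
  proof (intro continuous_on_mult)
    show "continuous_on ({1..} \<times> {0..}) (\<lambda>p. complex_of_real (fst p powr (s - of_int k)))"
      by (intro continuous_intros) auto
    show "continuous_on ({1..} \<times> {0..}) (\<lambda>p. ray_kernel s w (fst p) (snd p))"
      by (rule continuous_on_ray_kernel) (auto intro!: continuous_intros)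
    show "continuous_on ({1..} \<times> {0..}) (\<lambda>p. \<Xi> (?z (fst p) (snd p)))"
      by (rule continuous_on_compose2[OF Xc]) (auto intro!: continuous_intros simp: upper_half_plane_def)
  qed
  have Kct: "continuous_on {1..} (\<lambda>t. K t x)" if "x \<ge> 0" for x
  proof -
    have "continuous_on {1..} (\<lambda>t. (\<lambda>(t, x). K t x) (t, x))"
      by (rule continuous_on_compose2[OF Kc]) (use that in \<open>auto intro!: continuous_intros\<close>)
    then show ?thesis by simp
  qed
  have Kcx: "continuous_on {0..} (K t)" if "t \<ge> 1" for t
  proof -
    have "continuous_on {0..} (\<lambda>x. (\<lambda>(t, x). K t x) (t, x))"
      by (rule continuous_on_compose2[OF Kc]) (use that in \<open>auto intro!: continuous_intros\<close>)
    then show ?thesis by simp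
  qed
  have Kix: "set_integrable lborel {0..} (K t)" if t: "t \<ge> 1" for t
    by (rule set_integrable_exp_bound[OF Kcx[OF t] \<nu>, of "S * p t * C"]) (use Kb[OF t] in \<open>simp add: q_def mult.assoc\<close>)
  have Kit: "set_integrable lborel {1..} (\<lambda>t. K t x)" if x: "x \<ge> 0" for x
    by (rule set_integrable_exp_bound[OF Kct[OF x] hp, of "S * A * q x"]) (use Kb[OF _ x] in \<open>simp add: p_def mult_ac\<close>)
  show summ: "summable (\<lambda>m::nat. norm (K t (x + real m)))" if t: "t \<ge> 1" and x: "x \<ge> 0" for t x
    by (rule set_integral_unroll(3)[OF Kix[OF t] \<nu> _ x, of "S * p t * C"]) (use Kb[OF t] in \<open>simp add: q_def mult.assoc\<close>)
  define I1 where "I1 = (LINT t:{1..}|lborel. S * p t)"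
  have Spi: "set_integrable lborel {1..} (\<lambda>t. S * p t)" by (rule set_integrable_mult_right) (rule pi)
  define G where "G x = (LINT t:{1..}|lborel. K t x)" for x
  have Gb: "norm (G x) \<le> (I1 * C) * exp (- \<nu> * x)" if x: "x \<ge> 0" for x
  proof -
    have "norm (G x) \<le> (LINT t:{1..}|lborel. norm (K t x))"
      unfolding G_def by (rule set_integral_norm_bound[OF Kit[OF x]])
    also have "\<dots> \<le> (LINT t:{1..}|lborel. q x * (S * p t))"
      by (rule set_integral_mono[OF set_integrable_norm[OF Kit[OF x]]], rule set_integrable_mult_right, rule Spi)
        (use Kb[OF _ x] in \<open>simp add: mult_ac\<close>)
    also have "\<dots> = q x * I1" unfolding I1_def by (rule set_integral_mult_right)
    finally show ?thesis by (simp add: q_def mult_ac)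
  qed
  have Kb': "norm (K t x) \<le> (S * p t) * q x" if "t \<in> {1..}" "x \<in> {0..}" for t x
    using Kb[of t x] that by simp
  note Fub = set_integral_Fubini_product_bound[OF Kc closed_atLeast closed_atLeast Spi qi Kb']
  have Gi: "set_integrable lborel {0..} G" unfolding G_def by (rule Fub(2))
  have geo: "(\<lambda>m::nat. C * exp (- \<nu>) ^ m) summable_on UNIV"
    by (rule norm_summable_imp_summable_on)
      (use \<nu> C(1) in \<open>auto simp: norm_mult norm_power intro!: summable_mult summable_geometric\<close>)
  have mb: "norm (K t (x + real m)) \<le> (C * exp (- \<nu>) ^ m) * (S * p t)" if t: "t \<in> {1..}" and x: "x \<ge> 0" for t x m
  proof -
    have "norm (K t (x + real m)) \<le> S * p t * q (x + real m)" using Kb[of t "x + real m"] t x by simp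
    also have "\<dots> \<le> S * p t * (C * exp (- \<nu> * real m))"
      unfolding q_def using \<nu> x S0 p0[of t] C(1) by (intro mult_left_mono) auto
    also have "exp (- \<nu> * real m) = exp (- \<nu>) ^ m" using exp_of_nat_mult[of m "- \<nu>"] by (simp add: mult.commute)
    finally show ?thesis by (simp only: mult_ac)
  qed
  have hsm: "((\<lambda>m. K t (x + real m)) has_sum (\<Sum>m. K t (x + real m))) UNIV" if t: "t \<in> {1..}" and x: "x \<ge> 0" for t x
  proof (rule norm_summable_imp_has_sum)
    show "summable (\<lambda>m. norm (K t (x + real m)))" using summ[of t x] t x by simp
    then show "(\<lambda>m. K t (x + real m)) sums (\<Sum>m. K t (x + real m))"
      by (rule summable_sums[OF summable_norm_cancel])
  qed
  have Kim: "set_integrable lborel {1..} (\<lambda>t. K t (x + real m))" if "x \<ge> 0" for x and m :: nat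
    by (rule Kit) (use that in simp)
  show "set_integrable lborel {1..} (\<lambda>t. \<Sum>m::nat. K t (x + real m))" if x: "x \<ge> 0" for x
    by (rule has_sum_set_integral(1)[of "UNIV :: nat set", OF _ _ Kim[OF x] Spi geo mb[OF _ x] hsm[OF _ x]]) simp_all
  have swap: "(LINT t:{1..}|lborel. (\<Sum>m::nat. K t (x + real m))) = (\<Sum>m. G (x + real m))" if x: "x \<ge> 0" for x
  proof -
    have "((\<lambda>m. LINT t:{1..}|lborel. K t (x + real m)) has_sum (LINT t:{1..}|lborel. (\<Sum>m::nat. K t (x + real m)))) UNIV"
      by (rule has_sum_set_integral(2)[of "UNIV :: nat set", OF _ _ Kim[OF x] Spi geo mb[OF _ x] hsm[OF _ x]]) simp_all
    then have "(\<lambda>m. G (x + real m)) sums (LINT t:{1..}|lborel. (\<Sum>m::nat. K t (x + real m)))"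
      unfolding G_def by (rule has_sum_imp_sums)
    then show ?thesis by (rule sums_unique)
  qed
  note unroll = set_integral_unroll[OF Gi \<nu> Gb]
  show "set_integrable lborel {0..1} (\<lambda>x. LINT t:{1..}|lborel. (\<Sum>m::nat. K t (x + real m)))"
    by (subst set_integrable_cong[OF refl refl swap]) (use unroll(2) in auto)
  have "(LINT x:{0..1}|lborel. LINT t:{1..}|lborel. (\<Sum>m::nat. K t (x + real m))) = (LINT x:{0..1}|lborel. \<Sum>m. G (x + real m))"
    by (rule set_lebesgue_integral_cong, simp, intro allI impI, rule swap, simp)
  also have "\<dots> = (LINT x:{0..}|lborel. G x)" by (rule unroll(1))
  also have "\<dots> = (LINT t:{1..}|lborel. LINT x:{0..}|lborel. K t x)" unfolding G_def by (rule Fub(1)[symmetric])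
  finally have total: "(LINT x:{0..1}|lborel. LINT t:{1..}|lborel. (\<Sum>m::nat. K t (x + real m)))
      = (LINT t:{1..}|lborel. LINT x:{0..}|lborel. K t x)" .
  define I2 where "I2 = (LINT x:{0..}|lborel. q x)"
  define J where "J n t = \<i> powr of_real s * (c n * (of_real (t powr (- of_int k) * exp (4 * pi * of_int n * t))
      * ray_Gamma s (2 * of_real pi * of_int n + w) t))" for n t
  have ray_term: "set_integrable lborel {0..} (Kn n t)" "(LINT x:{0..}|lborel. Kn n t x) = J n t" if t: "t \<ge> 1" for n t
  proof -
    let ?u = "2 * of_real pi * of_int n + w"
    have u: "Im ?u > 0" using w by simp
    have t0: "t > 0" using t by simp
    let ?a = "of_real (t powr (s - of_int k)) * c n * of_real (exp (4 * pi * of_int n * t)) :: complex"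
    have eq: "Kn n t x = ?a * ray_kernel s ?u t x" for x
    proof -
      have "exp (- (2 * of_real pi * \<i> * of_int n * ?z t x))
          = of_real (exp (4 * pi * of_int n * t)) * exp (\<i> * of_real t * (2 * of_real pi * of_int n) * (\<i> + of_real x))"
        unfolding exp_of_real[symmetric] exp_add[symmetric] by (simp add: algebra_simps)
      then show ?thesis unfolding Kn_def ray_kernel_shift by (simp only: mult_ac)
    qed
    show "set_integrable lborel {0..} (Kn n t)"
      unfolding eq[abs_def] by (rule set_integrable_mult_right) (rule ray_kernel_integral(1)[OF u t0])
    have "(LINT x:{0..}|lborel. Kn n t x) = ?a * (LINT x:{0..}|lborel. ray_kernel s ?u t x)"
      unfolding eq by (rule set_integral_mult_right)
    also have "\<dots> = (of_real (t powr (s - of_int k)) * of_real (t powr (- s))) * (c n * of_real (exp (4 * pi * of_int n * t))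
        * (\<i> powr of_real s * ray_Gamma s ?u t))"
      unfolding ray_kernel_integral(2)[OF u t0] ray_Gamma_def by (simp only: mult_ac)
    also have "of_real (t powr (s - of_int k)) * of_real (t powr (- s)) = (of_real (t powr (- of_int k)) :: complex)"
      unfolding of_real_mult[symmetric] powr_add[symmetric] by simp
    finally show "(LINT x:{0..}|lborel. Kn n t x) = J n t"
      unfolding J_def by (simp only: of_real_mult mult_ac)
  qed
  have Knb: "norm (Kn n t x) \<le> d n * (p t * q x)" if t: "t \<ge> 1" and x: "x \<in> {0..}" and n: "n \<in> neg_index" for n t x
  proof -
    have "norm (Kn n t x) \<le> d n * p t * q x" unfolding Kn_def
      by (rule Kbound[OF t]) (use D(2)[of "?z t x" n] x t n in \<open>simp_all add: d_def\<close>)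
    then show ?thesis by (simp only: mult.assoc)
  qed
  have Knsum: "((\<lambda>n. Kn n t x) has_sum K t x) neg_index" if t: "t \<ge> 1" for t x
    unfolding Kn_def K_def by (intro has_sum_cmult_right X) (use t in \<open>simp add: upper_half_plane_def\<close>)
  have Jsum: "((\<lambda>n. J n t) has_sum (LINT x:{0..}|lborel. K t x)) neg_index" if t: "t \<in> {1..}" for t
  proof -
    have t1: "t \<ge> 1" using t by simp
    have pq: "set_integrable lborel {0..} (\<lambda>x. p t * q x)" by (rule set_integrable_mult_right) (rule qi)
    have "((\<lambda>n. LINT x:{0..}|lborel. Kn n t x) has_sum (LINT x:{0..}|lborel. K t x)) neg_index"
      by (rule has_sum_set_integral(2)[OF _ _ ray_term(1)[OF t1] pq ds Knb[OF t1] Knsum[OF t1]]) auto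
    then show ?thesis unfolding ray_term(2)[OF t1] .
  qed
  have Jb: "norm (J n t) \<le> d n * (p t * I2)" if n: "n \<in> neg_index" and t: "t \<in> {1..}" for n t
  proof -
    have t1: "t \<ge> 1" using t by simp
    have "norm (J n t) \<le> (LINT x:{0..}|lborel. norm (Kn n t x))"
      unfolding ray_term(2)[OF t1, symmetric] by (rule set_integral_norm_bound[OF ray_term(1)[OF t1]])
    also have "\<dots> \<le> (LINT x:{0..}|lborel. (d n * p t) * q x)"
      by (rule set_integral_mono[OF set_integrable_norm[OF ray_term(1)[OF t1]]], rule set_integrable_mult_right, rule qi)
        (use Knb[OF t1 _ n] in \<open>simp add: mult.assoc\<close>)
    also have "\<dots> = (d n * p t) * I2" unfolding I2_def by (rule set_integral_mult_right)
    finally show ?thesis by (simp only: mult.assoc)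
  qed
  have Ji: "set_integrable lborel {1..} (J n)" if "n \<in> neg_index" for n
    unfolding J_def by (rule set_integrable_mult_right, rule set_integrable_mult_right, rule Qi) (use that in simp)
  have pI: "set_integrable lborel {1..} (\<lambda>t. p t * I2)" by (rule set_integrable_mult_left) (rule pi)
  have "((\<lambda>n. LINT t:{1..}|lborel. J n t) has_sum (LINT t:{1..}|lborel. LINT x:{0..}|lborel. K t x)) neg_index"
    by (rule has_sum_set_integral(2)[OF _ _ Ji pI ds Jb Jsum]) auto
  then show "((\<lambda>n. \<i> powr of_real s * (c n * (LINT t:{1..}|lborel.
        of_real (t powr (- of_int k) * exp (4 * pi * of_int n * t)) * ray_Gamma s (2 * of_real pi * of_int n + w) t)))
      has_sum (LINT x:{0..1}|lborel. LINT t:{1..}|lborel. (\<Sum>m::nat. K t (x + real m)))) neg_index"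
    unfolding total J_def by (simp only: set_integral_mult_right)
qed

section \<open>The integral formula\<close>

lemma lerch_zeta_unfolded:
  assumes w: "Im w > 0" "Re w \<ge> 0" and x: "x \<ge> 0"
  defines "z \<equiv> \<i> + complex_of_real x"
  shows "exp (\<i> * w * z) * lerch_zeta (1 - of_real s) (w / (2 * of_real pi)) z = (\<Sum>m::nat. ray_kernel s w 1 (x + real m))"
    and "summable (\<lambda>m::nat. ray_kernel s w 1 (x + real m))"
proof -
  obtain C where C: "C > 0" "\<And>t x. t \<ge> 1 \<Longrightarrow> x \<ge> 0 \<Longrightarrow> norm (ray_kernel s w t x) \<le> C * exp (- (Im w / 2) * x)"
    by (rule ray_kernel_bound[OF w, of s], rule that)
  have nu: "Im w / 2 > 0" using w by simp
  have "summable (\<lambda>m::nat. norm (ray_kernel s w 1 (x + real m)))"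
    by (rule set_integral_unroll(3)[OF ray_kernel_integral(1)[OF w(1) zero_less_one] nu C(2)[OF order_refl] x])
  then show s: "summable (\<lambda>m::nat. ray_kernel s w 1 (x + real m))" by (rule summable_norm_cancel)
  let ?T = "\<lambda>m::nat. exp (2 * of_real pi * \<i> * of_nat m * (w / (2 * of_real pi))) * (z + of_nat m) powr (- (1 - of_real s))"
  have eq: "ray_kernel s w 1 (x + real m) = exp (\<i> * w * z) * ?T m" for m
  proof -
    have "2 * of_real pi * \<i> * of_nat m * (w / (2 * of_real pi)) = \<i> * w * of_nat m" by simp
    moreover have "\<i> * of_real 1 * w * (\<i> + of_real (x + real m)) = \<i> * w * z + \<i> * w * of_nat m"
      by (simp add: z_def algebra_simps)
    moreover have "\<i> + complex_of_real (x + real m) = z + of_nat m" by (simp add: z_def)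
    ultimately show ?thesis unfolding ray_kernel_def by (simp only: exp_add) (simp add: mult.assoc)
  qed
  have "summable ?T" using s unfolding eq by (simp add: summable_cmult_iff)
  then show "exp (\<i> * w * z) * lerch_zeta (1 - of_real s) (w / (2 * of_real pi)) z = (\<Sum>m::nat. ray_kernel s w 1 (x + real m))"
    unfolding lerch_zeta_def eq by (rule suminf_mult[symmetric])
qed

lemma R_series_unfolded:
  fixes x t s :: real and w :: complex and f :: "complex \<Rightarrow> complex" and k :: int
  defines "z \<equiv> \<i> + complex_of_real x"
    and "K \<equiv> \<lambda>t x. of_real (t powr (s - of_int k)) * ray_kernel s w t x
      * xi k (conj_form f) (of_real t * (\<i> - of_real x))"
  assumes t: "t \<ge> 1" and x: "x \<ge> 0" and s: "summable (\<lambda>m::nat. norm (K t (x + real m)))"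
  shows "exp (\<i> * of_real t * z * w) * of_real (t powr (s - of_int k)) * R_series k f s t z w
    = (\<Sum>m::nat. K t (x + real m))"
proof -
  let ?c = "exp (\<i> * of_real t * z * w) * of_real (t powr (s - of_int k))"
  let ?R = "\<lambda>m::nat. xi k (conj_form f) (of_real t * (2 * \<i> - z - of_nat m))
                / (z + of_nat m) powr (1 - of_real s) * exp (\<i> * of_real t * of_nat m * w)"
  have eq: "K t (x + real m) = ?c * ?R m" for m
  proof -
    have "2 * \<i> - z - of_nat m = \<i> - complex_of_real (x + real m)" by (simp add: z_def)
    moreover have "\<i> + complex_of_real (x + real m) = z + of_nat m" by (simp add: z_def)
    moreover have "\<i> * of_real t * w * (z + of_nat m) = \<i> * of_real t * z * w + \<i> * of_real t * of_nat m * w"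
      by (simp add: algebra_simps)
    moreover have "(z + of_nat m) powr (of_real s - 1) = inverse ((z + of_nat m) powr (1 - of_real s))"
      using powr_minus[of "z + of_nat m" "1 - of_real s"] by simp
    ultimately show ?thesis
      unfolding K_def ray_kernel_def by (simp only: exp_add divide_inverse mult_ac)
  qed
  have "?c \<noteq> 0" using t by simp
  then have "summable ?R" using summable_norm_cancel[OF s] unfolding eq summable_cmult_iff by blast
  then show ?thesis unfolding R_series_def eq by (rule suminf_mult[symmetric])
qed

lemma upper_half_plane_ray: "\<i> + complex_of_real x \<in> upper_half_plane"
  by (simp add: upper_half_plane_def)

theorem theorem4p4:
  fixes k :: int and N :: nat and f :: "complex \<Rightarrow> complex" and s :: real and w :: complex
  assumes "N \<ge> 1"
    and "f \<in> HC k N"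
    and "Im w > 0" and "Re w \<ge> 0"
  shows "L_phi k f s w =
    \<i> powr (- of_real s) *
    contour_integral (linepath \<i> (\<i> + 1))
      (\<lambda>z. f z * exp (\<i> * w * z) * lerch_zeta (1 - of_real s) (w / (2 * of_real pi)) z
         + integral {1..} (\<lambda>t::real.
             exp (\<i> * of_real t * z * w) * of_real (t powr (s - of_int k)) * R_series k f s t z w))"
proof -
  note w = assms(3,4)
  have hm: "harmonic_maass_form k N f" using assms(2) by (simp add: HC_def)
  note C1 = harmonic_maass_form_C1[OF hm]
  obtain n0 a b where T: "(SOME (n0, a, b). maass_expansion k f n0 a b) = (n0, a, b)"
    by (metis prod_cases3)
  have e: "maass_expansion k f n0 a b"
  proof -
    obtain n0' a' b' where "maass_expansion k f n0' a' b'" by (rule ex_maass_expansion[OF assms(2)], rule that)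
    then have "case (n0', a', b') of (n0, a, b) \<Rightarrow> maass_expansion k f n0 a b" by simp
    then have "case (SOME (n0, a, b). maass_expansion k f n0 a b) of (n0, a, b) \<Rightarrow> maass_expansion k f n0 a b"
      by (rule someI)
    then show ?thesis unfolding T by simp
  qed
  have L: "L_phi k f s w = L_series k n0 a b s w" unfolding L_phi_def T by simp
  note sub = coeff_imp_subexp[OF C1(1) maass_expansion_imp_coeff[OF e C1(1)]]
  let ?u = "\<lambda>n. 2 * of_real pi * of_int n + w"
  let ?\<Gamma> = "\<lambda>n. inc_Gamma (1 - of_int k) (- 4 * pi * of_int n)"
  define c where "c = xi_coeff k b"
  define \<Xi> where "\<Xi> = xi k (conj_form f)"
  define K where "K t x = of_real (t powr (s - of_int k)) * ray_kernel s w t x * \<Xi> (of_real t * (\<i> - of_real x))" for t x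
  define I where "I n = (LINT t:{1..}|lborel. of_real (t powr (- of_int k) * exp (4 * pi * of_int n * t)) * ray_Gamma s (?u n) t)" for n

  \<comment> \<open>the holomorphic and the non-holomorphic part of \<open>f\<close> on the line \<open>Im z = 1\<close>\<close>
  define Fa where "Fa x = (\<Sum>\<^sub>\<infinity>n\<in>hol_index n0. a n * exp (2 * of_real pi * \<i> * of_int n * (\<i> + of_real x)))" for x :: real
  define Fb where "Fb x = (\<Sum>\<^sub>\<infinity>n\<in>neg_index. (b n * of_real (?\<Gamma> n)) * exp (2 * of_real pi * \<i> * of_int n * (\<i> + of_real x)))" for x :: real
  have F: "((\<lambda>n. a n * exp (2 * of_real pi * \<i> * of_int n * (\<i> + of_real x))) has_sum Fa x) (hol_index n0)"
    "((\<lambda>n. (b n * of_real (?\<Gamma> n)) * exp (2 * of_real pi * \<i> * of_int n * (\<i> + of_real x))) has_sum Fb x) neg_index"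
    "f (\<i> + of_real x) = Fa x + Fb x" for x :: real
  proof -
    obtain A B where AB: "((\<lambda>n. a n * exp (2 * of_real pi * \<i> * of_int n * (\<i> + of_real x))) has_sum A) (hol_index n0)"
      "((\<lambda>n. b n * of_real (inc_Gamma (1 - of_int k) (- 4 * pi * of_int n * Im (\<i> + of_real x)))
                  * exp (2 * of_real pi * \<i> * of_int n * (\<i> + of_real x))) has_sum B) neg_index"
      "f (\<i> + of_real x) = A + B"
      using bspec[OF e[unfolded maass_expansion_def] upper_half_plane_ray[of x]] by blast
    have B: "((\<lambda>n. (b n * of_real (?\<Gamma> n)) * exp (2 * of_real pi * \<i> * of_int n * (\<i> + of_real x))) has_sum B) neg_index"
      using AB(2) by simp
    have AF: "Fa x = A" unfolding Fa_def by (rule infsumI[OF AB(1)])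
    have BF: "Fb x = B" unfolding Fb_def by (rule infsumI[OF B])
    show "((\<lambda>n. a n * exp (2 * of_real pi * \<i> * of_int n * (\<i> + of_real x))) has_sum Fa x) (hol_index n0)"
      unfolding AF by (rule AB(1))
    show "((\<lambda>n. (b n * of_real (?\<Gamma> n)) * exp (2 * of_real pi * \<i> * of_int n * (\<i> + of_real x))) has_sum Fb x) neg_index"
      unfolding BF by (rule B)
    show "f (\<i> + of_real x) = Fa x + Fb x" unfolding AF BF by (rule AB(3))
  qed
  have sa: "(\<lambda>n. norm (a n) * exp (- 2 * pi * of_int n)) summable_on hol_index n0"
    using hol_summable[OF sub(1) zero_less_one] by simp
  have sb: "(\<lambda>n. norm (b n * of_real (?\<Gamma> n)) * exp (- 2 * pi * of_int n)) summable_on neg_index"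
  proof (rule summable_on_cong[THEN iffD1, OF _ nonhol_summable[OF sub(2) zero_less_one, of "1 - of_int k"]])
    fix n assume "n \<in> neg_index"
    then have "4 * pi \<le> - 4 * pi * real_of_int n" using neg_arg_ge[of n 1] by simp
    then have "- 4 * pi * real_of_int n > 0" using pi_gt_zero by linarith
    then have "?\<Gamma> n > 0" by (rule inc_Gamma_pos)
    then show "norm (b n) * inc_Gamma (1 - of_int k) (- 4 * pi * of_int n * 1) * exp (- 2 * pi * of_int n * 1)
        = norm (b n * of_real (?\<Gamma> n)) * exp (- 2 * pi * of_int n)"
      by (simp add: norm_mult)
  qed
  note Ia = ray_series_integral[where s = s, OF w sa F(1)] and Ib = ray_series_integral[where s = s, OF w sb F(2)]

  have f_per: "f (\<i> + of_real (x + real m)) = f (\<i> + of_real x)" for x and m :: nat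
  proof (induction m)
    case (Suc m)
    have "f ((\<i> + of_real (x + real m)) + 1) = f (\<i> + of_real (x + real m))"
      using C1(1) upper_half_plane_ray unfolding C1_periodic_def by blast
    then show ?case using Suc by (simp add: add_ac)
  qed simp
  obtain M where M: "\<And>x. norm (f (\<i> + of_real x)) \<le> M"
  proof -
    have hs: "((\<lambda>n. fourier_term k n0 a b n 1 * echar n x) has_sum f (Complex x 1)) UNIV" for x
      by (rule maass_expansion_has_sum[OF e zero_less_one])
    from hs[of 0] have "(\<lambda>n. fourier_term k n0 a b n 1) summable_on UNIV" by (auto simp: summable_on_def)
    then have ns: "(\<lambda>n. norm (fourier_term k n0 a b n 1)) summable_on UNIV"
      by (simp add: summable_on_iff_abs_summable_on_complex)
    have "norm (f (\<i> + of_real x)) \<le> infsum (\<lambda>n. norm (fourier_term k n0 a b n 1)) UNIV" for x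
    proof -
      have "\<i> + of_real x = Complex x 1" by (simp add: complex_eq_iff)
      then show ?thesis
        using norm_infsum_le[OF hs[of x] has_sum_infsum[OF ns]] by (simp add: norm_mult)
    qed
    then show ?thesis by (rule that)
  qed
  have M0: "M \<ge> 0" using order_trans[OF norm_ge_zero M[of 0]] .
  define \<Phi> where "\<Phi> x = f (\<i> + of_real x) * ray_kernel s w 1 x" for x
  have \<Phi>eq: "\<Phi> x = Fa x * ray_kernel s w 1 x + Fb x * ray_kernel s w 1 x" for x
    unfolding \<Phi>_def F(3) by (rule distrib_right)
  have \<Phi>i: "set_integrable lborel {0..} \<Phi>"
    unfolding \<Phi>eq[abs_def] by (rule set_integral_add(1)[OF Ia(1) Ib(1)])
  have \<Phi>int: "(LINT x:{0..}|lborel. \<Phi> x) = (LINT x:{0..}|lborel. Fa x * ray_kernel s w 1 x) + (LINT x:{0..}|lborel. Fb x * ray_kernel s w 1 x)"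
    unfolding \<Phi>eq by (rule set_integral_add(2)[OF Ia(1) Ib(1)])
  obtain C where C: "C > 0" "\<And>t x. t \<ge> 1 \<Longrightarrow> x \<ge> 0 \<Longrightarrow> norm (ray_kernel s w t x) \<le> C * exp (- (Im w / 2) * x)"
    by (rule ray_kernel_bound[OF w, of s], rule that)
  have nu: "Im w / 2 > 0" using w by simp
  have \<Phi>b: "norm (\<Phi> x) \<le> (M * C) * exp (- (Im w / 2) * x)" if "x \<ge> 0" for x
    unfolding \<Phi>_def norm_mult mult.assoc using C(2)[of 1 x] that M0 by (intro mult_mono M) auto
  note U1 = set_integral_unroll[OF \<Phi>i nu \<Phi>b]

  have \<Xi>c: "continuous_on upper_half_plane \<Xi>"
  proof -
    have "continuous_on upper_half_plane (\<lambda>z. - 2 * \<i> * of_real (Im z) powi k * d_zbar f (- cnj z))"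
      by (intro continuous_intros continuous_on_power_int continuous_on_compose2[OF C1_continuous[OF C1(2)]])
        (auto simp: upper_half_plane_def)
    then show ?thesis
      by (rule continuous_on_eq) (simp add: \<Xi>_def xi_conj_form[OF C1(1)])
  qed
  have csub: "subexp neg_index c" unfolding c_def by (rule xi_coeff_subexp[OF sub(2)])
  have cX: "((\<lambda>n. c n * exp (- (2 * of_real pi * \<i> * of_int n * z))) has_sum \<Xi> z) neg_index"
    if "z \<in> upper_half_plane" for z
    unfolding c_def \<Xi>_def by (rule xi_expansion[OF C1 e that])
  note by_parts = inc_Gamma_Laplace_by_parts[OF w]
  have U2: "\<And>t x. t \<ge> 1 \<Longrightarrow> x \<ge> 0 \<Longrightarrow> summable (\<lambda>m::nat. norm (K t (x + real m)))"
    "set_integrable lborel {0..1} (\<lambda>x. LINT t:{1..}|lborel. (\<Sum>m::nat. K t (x + real m)))"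
    "\<And>x. x \<ge> 0 \<Longrightarrow> set_integrable lborel {1..} (\<lambda>t. \<Sum>m::nat. K t (x + real m))"
    "((\<lambda>n. \<i> powr of_real s * (c n * I n)) has_sum
      (LINT x:{0..1}|lborel. LINT t:{1..}|lborel. (\<Sum>m::nat. K t (x + real m)))) neg_index"
    unfolding K_def I_def by (rule xi_series_integral[OF w csub cX \<Xi>c by_parts(2)]; assumption)+

  \<comment> \<open>on the segment the integrand is a pair of sums over \<open>m\<close>, ready to be unrolled\<close>
  define h where "h z = f z * exp (\<i> * w * z) * lerch_zeta (1 - of_real s) (w / (2 * of_real pi)) z
         + integral {1..} (\<lambda>t::real.
             exp (\<i> * of_real t * z * w) * of_real (t powr (s - of_int k)) * R_series k f s t z w)" for z
  have h: "h (\<i> + of_real x) = (\<Sum>m::nat. \<Phi> (x + real m)) + (LINT t:{1..}|lborel. (\<Sum>m::nat. K t (x + real m)))"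
    if x: "x \<in> {0..1}" for x
  proof -
    have x0: "x \<ge> 0" using x by simp
    have "f (\<i> + of_real x) * exp (\<i> * w * (\<i> + of_real x)) * lerch_zeta (1 - of_real s) (w / (2 * of_real pi)) (\<i> + of_real x)
        = f (\<i> + of_real x) * (\<Sum>m::nat. ray_kernel s w 1 (x + real m))"
      using arg_cong[OF lerch_zeta_unfolded(1)[OF w x0, of s], of "\<lambda>v. f (\<i> + of_real x) * v"]
      by (simp only: mult.assoc)
    also have "\<dots> = (\<Sum>m::nat. \<Phi> (x + real m))"
      unfolding \<Phi>_def f_per by (rule suminf_mult[symmetric, OF lerch_zeta_unfolded(2)[OF w x0]])
    finally have 1: "f (\<i> + of_real x) * exp (\<i> * w * (\<i> + of_real x)) * lerch_zeta (1 - of_real s) (w / (2 * of_real pi)) (\<i> + of_real x)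
        = (\<Sum>m::nat. \<Phi> (x + real m))" .
    have "integral {1..} (\<lambda>t::real. exp (\<i> * of_real t * (\<i> + of_real x) * w) * of_real (t powr (s - of_int k)) * R_series k f s t (\<i> + of_real x) w)
        = integral {1..} (\<lambda>t. \<Sum>m::nat. K t (x + real m))"
    proof (rule integral_cong)
      fix t :: real assume "t \<in> {1..}"
      then have t: "t \<ge> 1" by simp
      show "exp (\<i> * of_real t * (\<i> + of_real x) * w) * of_real (t powr (s - of_int k)) * R_series k f s t (\<i> + of_real x) w
          = (\<Sum>m::nat. K t (x + real m))"
        unfolding K_def \<Xi>_def
        by (rule R_series_unfolded[OF t x0]) (use U2(1)[OF t x0] in \<open>simp add: K_def \<Xi>_def\<close>)
    qed
    also have "\<dots> = (LINT t:{1..}|lborel. (\<Sum>m::nat. K t (x + real m)))"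
      by (rule set_borel_integral_eq_integral(2)[OF U2(3)[OF x0], symmetric])
    finally show ?thesis unfolding h_def 1 by (rule arg_cong)
  qed
  have "contour_integral (linepath \<i> (\<i> + 1)) h = integral {0..1} (\<lambda>x. h (\<i> + of_real x))"
  proof -
    have "linepath \<i> (\<i> + 1) x = \<i> + complex_of_real x" for x
      by (simp add: linepath_def scaleR_conv_of_real algebra_simps)
    then show ?thesis
      by (simp add: contour_integral_integral)
  qed
  also have "\<dots> = integral {0..1} (\<lambda>x. (\<Sum>m::nat. \<Phi> (x + real m)) + (LINT t:{1..}|lborel. (\<Sum>m::nat. K t (x + real m))))"
    by (rule integral_cong) (rule h)
  also have "\<dots> = (LINT x:{0..1}|lborel. (\<Sum>m::nat. \<Phi> (x + real m)) + (LINT t:{1..}|lborel. (\<Sum>m::nat. K t (x + real m))))"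
    by (rule set_borel_integral_eq_integral(2)[symmetric, OF set_integral_add(1)[OF U1(2) U2(2)]])
  also have "\<dots> = (LINT x:{0..1}|lborel. (\<Sum>m::nat. \<Phi> (x + real m))) + (LINT x:{0..1}|lborel. LINT t:{1..}|lborel. (\<Sum>m::nat. K t (x + real m)))"
    by (rule set_integral_add(2)[OF U1(2) U2(2)])
  also have "(LINT x:{0..1}|lborel. (\<Sum>m::nat. \<Phi> (x + real m))) = (LINT x:{0..}|lborel. \<Phi> x)" by (rule U1(1))
  finally have contour: "contour_integral (linepath \<i> (\<i> + 1)) h
      = (LINT x:{0..}|lborel. Fa x * ray_kernel s w 1 x) + ((LINT x:{0..}|lborel. Fb x * ray_kernel s w 1 x)
        + (LINT x:{0..1}|lborel. LINT t:{1..}|lborel. (\<Sum>m::nat. K t (x + real m))))"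
    unfolding \<Phi>int by (simp only: add.assoc)

  have ii: "\<i> powr (- of_real s) * (\<i> powr of_real s * v) = v" for v :: complex
    by (simp add: powr_minus)
  have E: "exp_integral (1 - of_real s) (?u n) = ray_Gamma s (?u n) 1" for n
  proof -
    have "?u n \<notin> \<real>\<^sub>\<le>\<^sub>0" using w(1) by (simp add: complex_nonpos_Reals_iff)
    then show ?thesis by (simp add: exp_integral_eq_upper_Gamma ray_Gamma_def)
  qed
  have La: "(\<Sum>\<^sub>\<infinity>n\<in>hol_index n0. a n * exp_integral (1 - of_real s) (?u n))
      = \<i> powr (- of_real s) * (LINT x:{0..}|lborel. Fa x * ray_kernel s w 1 x)"
    using has_sum_cmult_right[OF Ia(2), of "\<i> powr (- of_real s)"] unfolding ii E[symmetric] by (rule infsumI)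
  have Lb: "(\<Sum>\<^sub>\<infinity>n\<in>neg_index. b n * integral {1..} (\<lambda>t::real.
          of_real (inc_Gamma (1 - of_int k) (- 4 * pi * of_int n * t))
          * exp (- (2 * of_real pi * of_int n + w) * of_real t) * of_real (t powr (s - 1))))
      = \<i> powr (- of_real s) * ((LINT x:{0..}|lborel. Fb x * ray_kernel s w 1 x)
        + (LINT x:{0..1}|lborel. LINT t:{1..}|lborel. (\<Sum>m::nat. K t (x + real m))))"
  proof (rule infsumI)
    have ray_term: "b n * integral {1..} (\<lambda>t::real.
          of_real (inc_Gamma (1 - of_int k) (- 4 * pi * of_int n * t))
          * exp (- (2 * of_real pi * of_int n + w) * of_real t) * of_real (t powr (s - 1)))
        = b n * of_real (?\<Gamma> n) * ray_Gamma s (?u n) 1 + c n * I n" if "n \<in> neg_index" for n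
    proof -
      have n: "n < 0" using that by simp
      show ?thesis unfolding by_parts(1)[OF n] c_def xi_coeff_def I_def by (simp add: algebra_simps)
    qed
    have "((\<lambda>n. \<i> powr (- of_real s) * (\<i> powr of_real s * (b n * of_real (?\<Gamma> n) * ray_Gamma s (?u n) 1) + \<i> powr of_real s * (c n * I n)))
       has_sum \<i> powr (- of_real s) * ((LINT x:{0..}|lborel. Fb x * ray_kernel s w 1 x)
        + (LINT x:{0..1}|lborel. LINT t:{1..}|lborel. (\<Sum>m::nat. K t (x + real m))))) neg_index"
      by (intro has_sum_cmult_right has_sum_add Ib(2) U2(4))
    then show "((\<lambda>n. b n * integral {1..} (\<lambda>t::real.
          of_real (inc_Gamma (1 - of_int k) (- 4 * pi * of_int n * t))
          * exp (- (2 * of_real pi * of_int n + w) * of_real t) * of_real (t powr (s - 1))))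
       has_sum \<i> powr (- of_real s) * ((LINT x:{0..}|lborel. Fb x * ray_kernel s w 1 x)
        + (LINT x:{0..1}|lborel. LINT t:{1..}|lborel. (\<Sum>m::nat. K t (x + real m))))) neg_index"
      unfolding distrib_left[symmetric, of "\<i> powr of_real s"] ii
      by (subst has_sum_cong[OF ray_term])
  qed
  show ?thesis
    unfolding L L_series_def La Lb h_def[symmetric] contour by (rule distrib_left[symmetric])
qed

end
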